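(* Let $R$ be a commutative noetherian ring. For any $R$-complex $M$, one has $$\mathrm{coSupp}_R M=\bigcup_{i\in\mathbb{Z}}\mathrm{coSupp}_R \mathrm{H}_i(M).$$ In particular, $M\not\simeq 0$ in the derived category $\mathrm{D}(R)$ if and only if $\mathrm{coSupp}_R M\neq\emptyset$.
   Context: $R$ is a commutative noetherian ring, not necessarily local. $R$-complexes are arbitrary (unbounded) chain complexes of $R$-modules, $\mathrm{D}(R)$ is the derived category, and $\simeq$ denotes isomorphism in the derived category. $E(R/\mathfrak{p})=E_R(R/\mathfrak p)$ is the injective envelope of $R/\mathfrak{p}$, and $k(\mathfrak p)=R_\mathfrak p/\mathfrak pR_\mathfrak p$. Put $D_R(-)=\mathrm{Hom}_R(-,\bigoplus_{\mathfrak{m}\in\mathrm{Max}R}E(R/\mathfrak{m}))$. For an $R$-complex $M$ and $\mathfrak{p}\in\mathrm{Spec}R$, the co-localization of $M$ at $\mathfrak p$ is the $R_\mathfrak p$-complex ${}^{\mathfrak{p}}M=\mathrm{Hom}_{R_\mathfrak{p}}(D_R(M)_\mathfrak{p},E_{R_\mathfrak{p}}(k(\mathfrak{p})))\simeq\mathrm{Hom}_R(D_R(M),E_R(R/\mathfrak p))$. The big cosupport is $\mathrm{coSupp}_R M=\{\mathfrak{p}\in\mathrm{Spec}R \mid {}^{\mathfrak{p}}M\not\simeq 0\}$; modules are regarded as complexes concentrated in degree $0$. *)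

theory Defs
  imports "HOL-Algebra.Ring_Divisibility"
begin

section \<open>Modules\<close>

definition mod_hom ::
    "('r,'s) ring_scheme \<Rightarrow> ('r,'m,'x) module_scheme \<Rightarrow> ('r,'n,'y) module_scheme \<Rightarrow> ('m \<Rightarrow> 'n) set"
  where "mod_hom R M N =
    {f \<in> carrier M \<rightarrow> carrier N.
       (\<forall>x\<in>carrier M. \<forall>y\<in>carrier M. f (x \<oplus>\<^bsub>M\<^esub> y) = f x \<oplus>\<^bsub>N\<^esub> f y) \<and>
       (\<forall>r\<in>carrier R. \<forall>x\<in>carrier M. f (r \<odot>\<^bsub>M\<^esub> x) = r \<odot>\<^bsub>N\<^esub> f x)}"

text \<open>The fields \<open>mult\<close> and \<open>one\<close> of the record type of modules carry no meaning for a module; below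
  they are left unspecified.\<close>

definition self_module :: "('r,'s) ring_scheme \<Rightarrow> ('r,'r) module"
  where "self_module R =
    \<lparr>carrier = carrier R, monoid.mult = monoid.mult R, one = one R,
     ring.zero = ring.zero R, ring.add = ring.add R, smult = monoid.mult R\<rparr>"

definition zero_module :: "('r,'m) module"
  where "zero_module =
    \<lparr>carrier = {undefined}, monoid.mult = undefined, one = undefined, ring.zero = undefined,
     ring.add = (\<lambda>_ _. undefined), smult = (\<lambda>_ _. undefined)\<rparr>"

definition quot_module :: "('r,'m,'x) module_scheme \<Rightarrow> 'm set \<Rightarrow> ('r,'m set) module"
  where "quot_module M N =
    \<lparr>carrier = a_rcosets\<^bsub>M\<^esub> N, monoid.mult = undefined, one = undefined, ring.zero = N,
     ring.add = (\<lambda>U V. set_add M U V), smult = (\<lambda>r U. \<Union>x\<in>U. N +>\<^bsub>M\<^esub> (r \<odot>\<^bsub>M\<^esub> x))\<rparr>"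

text \<open>Elements of \<open>Hom\<^sub>R(M,N)\<close> are made extensional, so that equality of homomorphisms is equality on
  the carrier of \<open>M\<close>.\<close>

definition hom_module ::
    "('r,'s) ring_scheme \<Rightarrow> ('r,'m,'x) module_scheme \<Rightarrow> ('r,'n,'y) module_scheme \<Rightarrow> ('r,'m \<Rightarrow> 'n) module"
  where "hom_module R M N =
    \<lparr>carrier = mod_hom R M N \<inter> extensional (carrier M), monoid.mult = undefined, one = undefined,
     ring.zero = (\<lambda>x\<in>carrier M. \<zero>\<^bsub>N\<^esub>),
     ring.add = (\<lambda>f g. \<lambda>x\<in>carrier M. f x \<oplus>\<^bsub>N\<^esub> g x),
     smult = (\<lambda>r f. \<lambda>x\<in>carrier M. r \<odot>\<^bsub>N\<^esub> f x)\<rparr>"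

definition direct_sum :: "'i set \<Rightarrow> ('i \<Rightarrow> ('r,'m,'x) module_scheme) \<Rightarrow> ('r,'i \<Rightarrow> 'm) module"
  where "direct_sum I E =
    \<lparr>carrier = {f \<in> (\<Pi>\<^sub>E i\<in>I. carrier (E i)). finite {i\<in>I. f i \<noteq> \<zero>\<^bsub>E i\<^esub>}},
     monoid.mult = undefined, one = undefined,
     ring.zero = (\<lambda>i\<in>I. \<zero>\<^bsub>E i\<^esub>),
     ring.add = (\<lambda>f g. \<lambda>i\<in>I. f i \<oplus>\<^bsub>E i\<^esub> g i),
     smult = (\<lambda>r f. \<lambda>i\<in>I. r \<odot>\<^bsub>E i\<^esub> f i)\<rparr>"


section \<open>Injective modules and injective envelopes\<close>

text \<open>A definition cannot quantify over types, so the test modules \<open>A\<close> and \<open>B\<close> have carriers in the type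
  of the elements of \<open>R\<close>. Lemma \<open>injective_module_extend\<close> (Baer's criterion) shows that the lifting
  property then holds for test modules of arbitrary types.\<close>

definition injective_module :: "('r,'s) ring_scheme \<Rightarrow> ('r,'e,'x) module_scheme \<Rightarrow> bool"
  where "injective_module R E \<longleftrightarrow> module R E \<and>
    (\<forall>(A :: ('r,'r) module) (B :: ('r,'r) module). \<forall>f\<in>mod_hom R A B. \<forall>g\<in>mod_hom R A E.
       module R A \<and> module R B \<and> inj_on f (carrier A) \<longrightarrow>
       (\<exists>h\<in>mod_hom R B E. \<forall>a\<in>carrier A. h (f a) = g a))"

lemma mod_homD:
  assumes "f \<in> mod_hom R M N"
  shows "x \<in> carrier M \<Longrightarrow> f x \<in> carrier N"
    and "\<lbrakk>x \<in> carrier M; y \<in> carrier M\<rbrakk> \<Longrightarrow> f (x \<oplus>\<^bsub>M\<^esub> y) = f x \<oplus>\<^bsub>N\<^esub> f y"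
    and "\<lbrakk>r \<in> carrier R; x \<in> carrier M\<rbrakk> \<Longrightarrow> f (r \<odot>\<^bsub>M\<^esub> x) = r \<odot>\<^bsub>N\<^esub> f x"
  using assms by (auto simp: mod_hom_def)

lemma mod_hom_zero:
  assumes "module R M" "module R N" "f \<in> mod_hom R M N"
  shows "f \<zero>\<^bsub>M\<^esub> = \<zero>\<^bsub>N\<^esub>"
proof -
  interpret M: module R M by fact
  interpret N: module R N by fact
  have "f (\<zero>\<^bsub>R\<^esub> \<odot>\<^bsub>M\<^esub> \<zero>\<^bsub>M\<^esub>) = \<zero>\<^bsub>R\<^esub> \<odot>\<^bsub>N\<^esub> f \<zero>\<^bsub>M\<^esub>"
    using mod_homD(3)[OF assms(3)] by blast
  then show ?thesis
    using mod_homD(1)[OF assms(3)] by simp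
qed

lemma self_module_module:
  assumes "cring R"
  shows "module R (self_module R)"
proof -
  interpret R: cring R by fact
  show ?thesis
  proof (intro moduleI[OF assms] abelian_groupI)
    fix x assume "x \<in> carrier (self_module R)"
    then show "\<exists>y\<in>carrier (self_module R). y \<oplus>\<^bsub>self_module R\<^esub> x = \<zero>\<^bsub>self_module R\<^esub>"
      by (intro bexI[of _ "\<ominus>\<^bsub>R\<^esub> x"]) (simp_all add: self_module_def R.l_neg)
  qed (simp_all add: self_module_def R.a_ac R.m_assoc R.l_distr R.r_distr)
qed

lemma injective_module_extend:
  fixes R :: "('r,'s) ring_scheme" and E :: "('r,'e,'x) module_scheme"
    and A :: "('r,'a,'y) module_scheme" and B :: "('r,'b,'z) module_scheme"
  assumes E: "injective_module R E" and A: "module R A" and B: "module R B"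
    and f: "f \<in> mod_hom R A B" "inj_on f (carrier A)" and g: "g \<in> mod_hom R A E"
  shows "\<exists>h\<in>mod_hom R B E. \<forall>a\<in>carrier A. h (f a) = g a"
proof -
  have "module R E"
    using E by (simp add: injective_module_def)
  then interpret E: module R E .
  interpret A: module R A by fact
  interpret B: module R B by fact
  define P where "P G \<longleftrightarrow> G \<subseteq> carrier B \<times> carrier E
      \<and> (\<forall>b e b' e'. (b, e) \<in> G \<longrightarrow> (b', e') \<in> G \<longrightarrow> (b \<oplus>\<^bsub>B\<^esub> b', e \<oplus>\<^bsub>E\<^esub> e') \<in> G)
      \<and> (\<forall>r\<in>carrier R. \<forall>b e. (b, e) \<in> G \<longrightarrow> (r \<odot>\<^bsub>B\<^esub> b, r \<odot>\<^bsub>E\<^esub> e) \<in> G)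
      \<and> (\<forall>e. (\<zero>\<^bsub>B\<^esub>, e) \<in> G \<longrightarrow> e = \<zero>\<^bsub>E\<^esub>)
      \<and> (\<lambda>a. (f a, g a)) ` carrier A \<subseteq> G" for G
  have PD: "G \<subseteq> carrier B \<times> carrier E"
    "\<lbrakk>(b, e) \<in> G; (b', e') \<in> G\<rbrakk> \<Longrightarrow> (b \<oplus>\<^bsub>B\<^esub> b', e \<oplus>\<^bsub>E\<^esub> e') \<in> G"
    "\<lbrakk>r \<in> carrier R; (b, e) \<in> G\<rbrakk> \<Longrightarrow> (r \<odot>\<^bsub>B\<^esub> b, r \<odot>\<^bsub>E\<^esub> e) \<in> G"
    "(\<zero>\<^bsub>B\<^esub>, e) \<in> G \<Longrightarrow> e = \<zero>\<^bsub>E\<^esub>"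
    "(\<lambda>a. (f a, g a)) ` carrier A \<subseteq> G"
    if "P G" for G b e b' e' r
    using that unfolding P_def by simp_all
  have f0: "f \<zero>\<^bsub>A\<^esub> = \<zero>\<^bsub>B\<^esub>" and g0: "g \<zero>\<^bsub>A\<^esub> = \<zero>\<^bsub>E\<^esub>"
    using mod_hom_zero A B \<open>module R E\<close> f g by blast+
  have P0: "P ((\<lambda>a. (f a, g a)) ` carrier A)" (is "P ?G0")
  proof -
    have "e = \<zero>\<^bsub>E\<^esub>" if "(\<zero>\<^bsub>B\<^esub>, e) \<in> ?G0" for e
    proof -
      from that obtain a where "a \<in> carrier A" "f a = \<zero>\<^bsub>B\<^esub>" "e = g a" by auto
      moreover from this have "a = \<zero>\<^bsub>A\<^esub>"
        using f(2) f0 by (metis A.M.zero_closed inj_onD)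
      ultimately show ?thesis using g0 by simp
    qed
    moreover have "(f a \<oplus>\<^bsub>B\<^esub> f b, g a \<oplus>\<^bsub>E\<^esub> g b) \<in> ?G0" if "a \<in> carrier A" "b \<in> carrier A" for a b
      using that by (intro image_eqI[of _ _ "a \<oplus>\<^bsub>A\<^esub> b"]) (simp_all add: mod_homD[OF f(1)] mod_homD[OF g])
    moreover have "(r \<odot>\<^bsub>B\<^esub> f a, r \<odot>\<^bsub>E\<^esub> g a) \<in> ?G0" if "r \<in> carrier R" "a \<in> carrier A" for r a
      using that by (intro image_eqI[of _ _ "r \<odot>\<^bsub>A\<^esub> a"]) (simp_all add: mod_homD[OF f(1)] mod_homD[OF g])
    ultimately show ?thesis
      unfolding P_def using mod_homD(1)[OF f(1)] mod_homD(1)[OF g] by blast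
  qed
  have "\<exists>G\<in>Collect P. \<forall>H\<in>Collect P. G \<subseteq> H \<longrightarrow> H = G"
  proof (rule subset_Zorn_nonempty)
    show "Collect P \<noteq> {}" using P0 by blast
    fix C assume C: "C \<noteq> {}" "subset.chain (Collect P) C"
    then have CP: "P G" if "G \<in> C" for G
      using that by (auto simp: subset.chain_def)
    have dir: "\<exists>K\<in>C. p \<in> K \<and> q \<in> K" if "p \<in> \<Union>C" "q \<in> \<Union>C" for p q
    proof -
      from that obtain K L where KL: "K \<in> C" "p \<in> K" "L \<in> C" "q \<in> L" by blast
      then have "K \<subseteq> L \<or> L \<subseteq> K" using C(2) unfolding subset.chain_def by blast
      then show ?thesis using KL by blast
    qed
    have "(b \<oplus>\<^bsub>B\<^esub> b', e \<oplus>\<^bsub>E\<^esub> e') \<in> \<Union>C" if "(b, e) \<in> \<Union>C" "(b', e') \<in> \<Union>C" for b e b' e'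
      using dir[OF that] PD(2)[OF CP] by blast
    moreover have "(r \<odot>\<^bsub>B\<^esub> b, r \<odot>\<^bsub>E\<^esub> e) \<in> \<Union>C" if "r \<in> carrier R" "(b, e) \<in> \<Union>C" for r b e
      using that PD(3)[OF CP] by blast
    moreover have "\<Union>C \<subseteq> carrier B \<times> carrier E"
      using PD(1)[OF CP] by blast
    moreover have "e = \<zero>\<^bsub>E\<^esub>" if "(\<zero>\<^bsub>B\<^esub>, e) \<in> \<Union>C" for e
      using that PD(4)[OF CP] by blast
    moreover have "?G0 \<subseteq> \<Union>C"
      using C(1) PD(5)[OF CP] by blast
    ultimately show "\<Union>C \<in> Collect P"
      by (simp add: P_def)
  qed
  then obtain G where PG: "P G" and max: "\<And>H. P H \<Longrightarrow> G \<subseteq> H \<Longrightarrow> H = G"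
    by blast
  have sub: "b \<in> carrier B" "e \<in> carrier E" if "(b, e) \<in> G" for b e
    using PD(1)[OF PG] that by auto
  note add = PD(2)[OF PG] and smult = PD(3)[OF PG] and ker = PD(4)[OF PG]
  have base: "(f a, g a) \<in> G" if "a \<in> carrier A" for a
    using PD(5)[OF PG] that by auto
  have minus: "(\<ominus>\<^bsub>B\<^esub> b, \<ominus>\<^bsub>E\<^esub> e) \<in> G" if "(b, e) \<in> G" for b e
    using smult[of "\<ominus>\<^bsub>R\<^esub> \<one>\<^bsub>R\<^esub>", OF _ that] sub[OF that] by (simp add: B.smult_l_minus E.smult_l_minus)
  have sv: "e = e'" if "(b, e) \<in> G" "(b, e') \<in> G" for b e e'
  proof -
    have "(b \<oplus>\<^bsub>B\<^esub> \<ominus>\<^bsub>B\<^esub> b, e \<oplus>\<^bsub>E\<^esub> \<ominus>\<^bsub>E\<^esub> e') \<in> G"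
      using add minus that by blast
    then have "e \<oplus>\<^bsub>E\<^esub> \<ominus>\<^bsub>E\<^esub> e' = \<zero>\<^bsub>E\<^esub>"
      using ker sub[OF that(1)] by (simp add: B.M.r_neg)
    then show ?thesis
      using sub[OF that(1)] sub[OF that(2)] by (metis E.M.minus_equality E.M.minus_minus E.M.add.inv_closed E.M.a_comm)
  qed
  have zero: "(\<zero>\<^bsub>B\<^esub>, \<zero>\<^bsub>E\<^esub>) \<in> G"
    using base[of "\<zero>\<^bsub>A\<^esub>"] f0 g0 by simp
  have total: "\<exists>e. (b, e) \<in> G" if b: "b \<in> carrier B" for b
  proof -
    define I where "I = {r \<in> carrier R. \<exists>e. (r \<odot>\<^bsub>B\<^esub> b, e) \<in> G}"
    define \<phi> where "\<phi> r = (THE e. (r \<odot>\<^bsub>B\<^esub> b, e) \<in> G)" for r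
    have \<phi>: "(r \<odot>\<^bsub>B\<^esub> b, e) \<in> G \<Longrightarrow> \<phi> r = e" for r e
      unfolding \<phi>_def by (rule the_equality) (auto intro: sv)
    have \<phi>G: "r \<in> I \<Longrightarrow> (r \<odot>\<^bsub>B\<^esub> b, \<phi> r) \<in> G" for r
      using \<phi> I_def by auto
    have Iadd: "((r \<oplus>\<^bsub>R\<^esub> r') \<odot>\<^bsub>B\<^esub> b, \<phi> r \<oplus>\<^bsub>E\<^esub> \<phi> r') \<in> G" if "r \<in> I" "r' \<in> I" for r r'
      using add[OF \<phi>G \<phi>G, of r r'] that b by (simp add: B.smult_l_distr I_def)
    have Ismult: "((s \<otimes>\<^bsub>R\<^esub> r) \<odot>\<^bsub>B\<^esub> b, s \<odot>\<^bsub>E\<^esub> \<phi> r) \<in> G" if "s \<in> carrier R" "r \<in> I" for s r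
      using smult[OF _ \<phi>G, of s r] that b by (simp add: B.smult_assoc1 I_def)
    let ?S = "self_module R" and ?A = "(self_module R)\<lparr>carrier := I\<rparr>"
    interpret S: module R ?S by (rule self_module_module) (rule E.R.is_cring)
    have "submodule I R ?S"
    proof (rule S.submoduleI)
      show "I \<subseteq> carrier ?S" by (auto simp: I_def self_module_def)
      show "\<zero>\<^bsub>?S\<^esub> \<in> I" using zero b by (auto simp: I_def self_module_def)
      show "x \<oplus>\<^bsub>?S\<^esub> y \<in> I" if "x \<in> I" "y \<in> I" for x y
        using Iadd[OF that] that by (auto simp: I_def self_module_def)
      show sI: "s \<odot>\<^bsub>?S\<^esub> y \<in> I" if "s \<in> carrier R" "y \<in> I" for s y
        using Ismult[OF that] that by (auto simp: I_def self_module_def)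
      show "\<ominus>\<^bsub>?S\<^esub> x \<in> I" if "x \<in> I" for x
      proof -
        have x: "x \<in> carrier ?S" using that by (simp add: I_def self_module_def)
        have "\<ominus>\<^bsub>?S\<^esub> x = \<ominus>\<^bsub>R\<^esub> \<one>\<^bsub>R\<^esub> \<odot>\<^bsub>?S\<^esub> x"
          using S.smult_l_minus[OF _ x, of "\<one>\<^bsub>R\<^esub>"] S.smult_one[OF x] by simp
        then show ?thesis using sI[OF _ that, of "\<ominus>\<^bsub>R\<^esub> \<one>\<^bsub>R\<^esub>"] by simp
      qed
    qed
    then have "module R ?A"
      by (rule submodule.submodule_is_module) (rule S.module_axioms)
    moreover have "\<phi> \<in> mod_hom R ?A E"
      using \<phi>[OF Iadd] \<phi>[OF Ismult] sub(2)[OF \<phi>G] by (auto simp: mod_hom_def self_module_def)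
    moreover have "(\<lambda>x. x) \<in> mod_hom R ?A ?S"
      by (auto simp: mod_hom_def self_module_def I_def)
    ultimately obtain \<psi> where \<psi>: "\<psi> \<in> mod_hom R ?S E" "\<forall>a\<in>I. \<psi> a = \<phi> a"
      using E S.module_axioms unfolding injective_module_def by fastforce
    define e where "e = \<psi> \<one>\<^bsub>R\<^esub>"
    have e: "e \<in> carrier E"
      using mod_homD(1)[OF \<psi>(1)] by (simp add: e_def self_module_def)
    have \<psi>e: "\<psi> r = r \<odot>\<^bsub>E\<^esub> e" if "r \<in> carrier R" for r
      using mod_homD(3)[OF \<psi>(1), of r "\<one>\<^bsub>R\<^esub>"] that by (simp add: e_def self_module_def)
    define H where "H = {(x \<oplus>\<^bsub>B\<^esub> r \<odot>\<^bsub>B\<^esub> b, y \<oplus>\<^bsub>E\<^esub> r \<odot>\<^bsub>E\<^esub> e) | x y r. (x, y) \<in> G \<and> r \<in> carrier R}"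
    have HI: "(x \<oplus>\<^bsub>B\<^esub> r \<odot>\<^bsub>B\<^esub> b, y \<oplus>\<^bsub>E\<^esub> r \<odot>\<^bsub>E\<^esub> e) \<in> H" if "(x, y) \<in> G" "r \<in> carrier R" for x y r
      using that by (auto simp: H_def)
    have GH: "G \<subseteq> H"
    proof (rule subrelI)
      fix x y assume xy: "(x, y) \<in> G"
      show "(x, y) \<in> H" using HI[OF xy, of "\<zero>\<^bsub>R\<^esub>"] sub[OF xy] b e by simp
    qed
    have "P H"
      unfolding P_def
    proof (intro conjI allI impI ballI)
      show "H \<subseteq> carrier B \<times> carrier E" using sub b e by (auto simp: H_def)
      show "?G0 \<subseteq> H" using GH base by blast
      fix b1 e1 b2 e2 assume "(b1, e1) \<in> H" "(b2, e2) \<in> H"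
      then obtain x1 y1 r1 x2 y2 r2 where
        *: "(x1, y1) \<in> G" "r1 \<in> carrier R" "b1 = x1 \<oplus>\<^bsub>B\<^esub> r1 \<odot>\<^bsub>B\<^esub> b" "e1 = y1 \<oplus>\<^bsub>E\<^esub> r1 \<odot>\<^bsub>E\<^esub> e"
           "(x2, y2) \<in> G" "r2 \<in> carrier R" "b2 = x2 \<oplus>\<^bsub>B\<^esub> r2 \<odot>\<^bsub>B\<^esub> b" "e2 = y2 \<oplus>\<^bsub>E\<^esub> r2 \<odot>\<^bsub>E\<^esub> e"
        unfolding H_def by blast
      have "b1 \<oplus>\<^bsub>B\<^esub> b2 = (x1 \<oplus>\<^bsub>B\<^esub> x2) \<oplus>\<^bsub>B\<^esub> (r1 \<oplus>\<^bsub>R\<^esub> r2) \<odot>\<^bsub>B\<^esub> b"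
        "e1 \<oplus>\<^bsub>E\<^esub> e2 = (y1 \<oplus>\<^bsub>E\<^esub> y2) \<oplus>\<^bsub>E\<^esub> (r1 \<oplus>\<^bsub>R\<^esub> r2) \<odot>\<^bsub>E\<^esub> e"
        using * sub b e by (simp_all add: B.smult_l_distr E.smult_l_distr B.M.a_ac E.M.a_ac)
      then show "(b1 \<oplus>\<^bsub>B\<^esub> b2, e1 \<oplus>\<^bsub>E\<^esub> e2) \<in> H"
        using HI[OF add, of x1 y1 x2 y2 "r1 \<oplus>\<^bsub>R\<^esub> r2"] * by simp
    next
      fix s b1 e1 assume s: "s \<in> carrier R" and "(b1, e1) \<in> H"
      then obtain x1 y1 r1 where
        *: "(x1, y1) \<in> G" "r1 \<in> carrier R" "b1 = x1 \<oplus>\<^bsub>B\<^esub> r1 \<odot>\<^bsub>B\<^esub> b" "e1 = y1 \<oplus>\<^bsub>E\<^esub> r1 \<odot>\<^bsub>E\<^esub> e"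
        unfolding H_def by blast
      have "s \<odot>\<^bsub>B\<^esub> b1 = s \<odot>\<^bsub>B\<^esub> x1 \<oplus>\<^bsub>B\<^esub> (s \<otimes>\<^bsub>R\<^esub> r1) \<odot>\<^bsub>B\<^esub> b"
        "s \<odot>\<^bsub>E\<^esub> e1 = s \<odot>\<^bsub>E\<^esub> y1 \<oplus>\<^bsub>E\<^esub> (s \<otimes>\<^bsub>R\<^esub> r1) \<odot>\<^bsub>E\<^esub> e"
        using * s sub b e by (simp_all add: B.smult_r_distr E.smult_r_distr B.smult_assoc1 E.smult_assoc1)
      then show "(s \<odot>\<^bsub>B\<^esub> b1, s \<odot>\<^bsub>E\<^esub> e1) \<in> H"
        using HI[OF smult, of s x1 y1 "s \<otimes>\<^bsub>R\<^esub> r1"] * s by simp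
    next
      fix z assume "(\<zero>\<^bsub>B\<^esub>, z) \<in> H"
      then obtain x y r where
        *: "(x, y) \<in> G" "r \<in> carrier R" "\<zero>\<^bsub>B\<^esub> = x \<oplus>\<^bsub>B\<^esub> r \<odot>\<^bsub>B\<^esub> b" "z = y \<oplus>\<^bsub>E\<^esub> r \<odot>\<^bsub>E\<^esub> e"
        unfolding H_def by blast
      have "r \<odot>\<^bsub>B\<^esub> b = \<ominus>\<^bsub>B\<^esub> x"
        using * sub(1)[OF *(1)] b by (metis B.M.minus_equality B.M.a_comm B.smult_closed)
      then have "(r \<odot>\<^bsub>B\<^esub> b, \<ominus>\<^bsub>E\<^esub> y) \<in> G" using minus[OF *(1)] by simp
      then have "r \<in> I" "\<phi> r = \<ominus>\<^bsub>E\<^esub> y"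
        using *(2) \<phi> by (auto simp: I_def)
      then have "r \<odot>\<^bsub>E\<^esub> e = \<ominus>\<^bsub>E\<^esub> y" using \<psi>(2) \<psi>e[OF *(2)] by force
      then show "z = \<zero>\<^bsub>E\<^esub>" using *(4) sub(2)[OF *(1)] by (simp add: E.M.r_neg)
    qed
    then have "H = G" using max GH by blast
    moreover have "(b, e) \<in> H" using HI[OF zero, of "\<one>\<^bsub>R\<^esub>"] b e by simp
    ultimately show ?thesis by blast
  qed
  define h where "h b = (THE e. (b, e) \<in> G)" for b
  have h: "(b, e) \<in> G \<Longrightarrow> h b = e" for b e
    unfolding h_def by (rule the_equality) (auto intro: sv)
  have hG: "b \<in> carrier B \<Longrightarrow> (b, h b) \<in> G" for b
    using total h by blast
  have "h \<in> mod_hom R B E"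
    using h[OF add[OF hG hG]] h[OF smult[OF _ hG]] sub(2)[OF hG] by (auto simp: mod_hom_def)
  then show ?thesis using h[OF base] by blast
qed

definition essential_submodule ::
    "('r,'s) ring_scheme \<Rightarrow> 'e set \<Rightarrow> ('r,'e,'x) module_scheme \<Rightarrow> bool"
  where "essential_submodule R A E \<longleftrightarrow> submodule A R E \<and>
    (\<forall>N. submodule N R E \<and> N \<inter> A = {\<zero>\<^bsub>E\<^esub>} \<longrightarrow> N = {\<zero>\<^bsub>E\<^esub>})"

definition injective_envelope ::
    "('r,'s) ring_scheme \<Rightarrow> ('r,'a,'x) module_scheme \<Rightarrow> ('r,'e,'y) module_scheme \<Rightarrow> bool"
  where "injective_envelope R A E \<longleftrightarrow> injective_module R E \<and>
    (\<exists>\<iota>\<in>mod_hom R A E. inj_on \<iota> (carrier A) \<and> essential_submodule R (\<iota> ` carrier A) E)"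


section \<open>Localization\<close>

definition fraction :: "('r,'s) ring_scheme \<Rightarrow> 'r set \<Rightarrow> ('r,'m,'x) module_scheme \<Rightarrow> 'm \<Rightarrow> 'r \<Rightarrow> ('m \<times> 'r) set"
  where "fraction R S M x s =
    {(y, t). y \<in> carrier M \<and> t \<in> S \<and> (\<exists>u\<in>S. u \<odot>\<^bsub>M\<^esub> (t \<odot>\<^bsub>M\<^esub> x) = u \<odot>\<^bsub>M\<^esub> (s \<odot>\<^bsub>M\<^esub> y))}"

text \<open>The operations on classes of fractions are unions over all representatives; on the classes
  \<open>fraction R S M x s\<close> all members of such a union coincide.\<close>

definition frac_add ::
    "('r,'s) ring_scheme \<Rightarrow> 'r set \<Rightarrow> ('r,'m,'x) module_scheme \<Rightarrow>
      ('m \<times> 'r) set \<Rightarrow> ('m \<times> 'r) set \<Rightarrow> ('m \<times> 'r) set"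
  where "frac_add R S M U V =
    (\<Union>(x, s)\<in>U. \<Union>(y, t)\<in>V. fraction R S M (t \<odot>\<^bsub>M\<^esub> x \<oplus>\<^bsub>M\<^esub> s \<odot>\<^bsub>M\<^esub> y) (s \<otimes>\<^bsub>R\<^esub> t))"

definition frac_smult ::
    "('r,'s) ring_scheme \<Rightarrow> 'r set \<Rightarrow> ('r,'m,'x) module_scheme \<Rightarrow>
      ('r \<times> 'r) set \<Rightarrow> ('m \<times> 'r) set \<Rightarrow> ('m \<times> 'r) set"
  where "frac_smult R S M A U =
    (\<Union>(a, s)\<in>A. \<Union>(x, t)\<in>U. fraction R S M (a \<odot>\<^bsub>M\<^esub> x) (s \<otimes>\<^bsub>R\<^esub> t))"

definition loc_ring :: "('r,'s) ring_scheme \<Rightarrow> 'r set \<Rightarrow> ('r \<times> 'r) set ring"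
  where "loc_ring R S =
    \<lparr>carrier = {fraction R S (self_module R) a s | a s. a \<in> carrier R \<and> s \<in> S},
     monoid.mult = frac_smult R S (self_module R),
     one = fraction R S (self_module R) \<one>\<^bsub>R\<^esub> \<one>\<^bsub>R\<^esub>,
     ring.zero = fraction R S (self_module R) \<zero>\<^bsub>R\<^esub> \<one>\<^bsub>R\<^esub>,
     ring.add = frac_add R S (self_module R)\<rparr>"

definition loc_module ::
    "('r,'s) ring_scheme \<Rightarrow> 'r set \<Rightarrow> ('r,'m,'x) module_scheme \<Rightarrow> (('r \<times> 'r) set, ('m \<times> 'r) set) module"
  where "loc_module R S M =
    \<lparr>carrier = {fraction R S M x s | x s. x \<in> carrier M \<and> s \<in> S}, monoid.mult = undefined, one = undefined,
     ring.zero = fraction R S M \<zero>\<^bsub>M\<^esub> \<one>\<^bsub>R\<^esub>,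
     ring.add = frac_add R S M,
     smult = frac_smult R S M\<rparr>"

definition loc_map ::
    "('r,'s) ring_scheme \<Rightarrow> 'r set \<Rightarrow> ('r,'n,'y) module_scheme \<Rightarrow> ('m \<Rightarrow> 'n) \<Rightarrow>
      ('m \<times> 'r) set \<Rightarrow> ('n \<times> 'r) set"
  where "loc_map R S N f U = (\<Union>(x, s)\<in>U. fraction R S N (f x) s)"

definition Spec :: "('r,'s) ring_scheme \<Rightarrow> 'r set set"
  where "Spec R = {\<pp>. primeideal \<pp> R}"

definition MaxSpec :: "('r,'s) ring_scheme \<Rightarrow> 'r set set"
  where "MaxSpec R = {\<mm>. maximalideal \<mm> R}"

abbreviation localization_at :: "('r,'s) ring_scheme \<Rightarrow> 'r set \<Rightarrow> ('r \<times> 'r) set ring"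
  where "localization_at R \<pp> \<equiv> loc_ring R (carrier R - \<pp>)"

text \<open>\<open>residue_field R \<pp>\<close> is \<open>R\<^sub>\<pp> / \<pp>R\<^sub>\<pp>\<close>, as a module over \<open>R\<^sub>\<pp>\<close>.\<close>

definition residue_field :: "('r,'s) ring_scheme \<Rightarrow> 'r set \<Rightarrow> (('r \<times> 'r) set, ('r \<times> 'r) set set) module"
  where "residue_field R \<pp> =
    quot_module (self_module (localization_at R \<pp>))
      (Idl\<^bsub>localization_at R \<pp>\<^esub>
        ((\<lambda>a. fraction R (carrier R - \<pp>) (self_module R) a \<one>\<^bsub>R\<^esub>) ` \<pp>))"


section \<open>Complexes\<close>

text \<open>\<open>diff M i\<close> is the differential \<open>M\<^sub>i \<rightarrow> M\<^sub>i\<^sub>-\<^sub>1\<close>. All components have carriers in one type;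
  since that type is arbitrary this is no restriction.\<close>

record ('r,'m) cpx =
  obj :: "int \<Rightarrow> ('r,'m) module"
  diff :: "int \<Rightarrow> 'm \<Rightarrow> 'm"

definition chain_complex :: "('r,'s) ring_scheme \<Rightarrow> ('r,'m) cpx \<Rightarrow> bool"
  where "chain_complex R M \<longleftrightarrow>
    (\<forall>i. module R (obj M i) \<and> diff M i \<in> mod_hom R (obj M i) (obj M (i - 1)) \<and>
       (\<forall>x\<in>carrier (obj M i). diff M (i - 1) (diff M i x) = \<zero>\<^bsub>obj M (i - 1 - 1)\<^esub>))"

definition zero_cpx :: "('r,'m) cpx"
  where "zero_cpx = \<lparr>obj = (\<lambda>_. zero_module), diff = (\<lambda>_ _. undefined)\<rparr>"

definition in_degree_0 :: "('r,'m) module \<Rightarrow> ('r,'m) cpx"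
  where "in_degree_0 N =
    \<lparr>obj = (\<lambda>i. if i = 0 then N else zero_module),
     diff = (\<lambda>i _. if i = 1 then \<zero>\<^bsub>N\<^esub> else undefined)\<rparr>"

definition cycles :: "('r,'m) cpx \<Rightarrow> int \<Rightarrow> 'm set"
  where "cycles M i = {x \<in> carrier (obj M i). diff M i x = \<zero>\<^bsub>obj M (i - 1)\<^esub>}"

definition boundaries :: "('r,'m) cpx \<Rightarrow> int \<Rightarrow> 'm set"
  where "boundaries M i = diff M (i + 1) ` carrier (obj M (i + 1))"

definition homology :: "('r,'m) cpx \<Rightarrow> int \<Rightarrow> ('r,'m set) module"
  where "homology M i = quot_module ((obj M i)\<lparr>carrier := cycles M i\<rparr>) (boundaries M i)"

definition chain_map :: "('r,'s) ring_scheme \<Rightarrow> ('r,'m) cpx \<Rightarrow> ('r,'n) cpx \<Rightarrow> (int \<Rightarrow> 'm \<Rightarrow> 'n) \<Rightarrow> bool"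
  where "chain_map R M N f \<longleftrightarrow>
    (\<forall>i. f i \<in> mod_hom R (obj M i) (obj N i) \<and>
       (\<forall>x\<in>carrier (obj M i). f (i - 1) (diff M i x) = diff N i (f i x)))"

definition homology_map :: "('r,'n) cpx \<Rightarrow> (int \<Rightarrow> 'm \<Rightarrow> 'n) \<Rightarrow> int \<Rightarrow> 'm set \<Rightarrow> 'n set"
  where "homology_map N f i U = (\<Union>x\<in>U. boundaries N i +>\<^bsub>obj N i\<^esub> f i x)"

definition quasi_iso :: "('r,'s) ring_scheme \<Rightarrow> ('r,'m) cpx \<Rightarrow> ('r,'n) cpx \<Rightarrow> (int \<Rightarrow> 'm \<Rightarrow> 'n) \<Rightarrow> bool"
  where "quasi_iso R M N f \<longleftrightarrow> chain_map R M N f \<and>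
    (\<forall>i. bij_betw (homology_map N f i) (carrier (homology M i)) (carrier (homology N i)))"

text \<open>Two complexes are isomorphic in the derived category, the localization of the category of
  complexes at the quasi-isomorphisms, iff they are connected by a zigzag of quasi-isomorphisms.
  The intermediate complexes have carriers in the same type as \<open>M\<close> and \<open>N\<close>. For \<open>N\<close> the zero complex,
  the only case used below, lemma \<open>derived_iso_zero_iff\<close> shows that nothing is lost by this.\<close>

definition derived_iso :: "('r,'s) ring_scheme \<Rightarrow> ('r,'m) cpx \<Rightarrow> ('r,'m) cpx \<Rightarrow> bool"
  where "derived_iso R =
    equivclp (\<lambda>U V. chain_complex R U \<and> chain_complex R V \<and> (\<exists>f. quasi_iso R U V f))"

lemma chain_complex_zero_cpx: "cring R \<Longrightarrow> chain_complex R zero_cpx"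
  unfolding chain_complex_def
proof (intro allI conjI)
  assume "cring R"
  then have "module R zero_module"
    by (intro moduleI abelian_groupI) (auto simp: zero_module_def)
  then show "module R (obj zero_cpx i)" for i by (simp add: zero_cpx_def)
qed (auto simp: zero_cpx_def zero_module_def mod_hom_def)

lemma carrier_homology_zero_cpx: "carrier (homology zero_cpx i) = {{undefined}}"
  by (auto simp: homology_def quot_module_def zero_cpx_def zero_module_def cycles_def boundaries_def
      A_RCOSETS_def RCOSETS_def r_coset_def)

lemma singleton_homology_iff:
  assumes "chain_complex R M"
  shows "(\<exists>C. carrier (homology M i) = {C}) \<longleftrightarrow> cycles M i = boundaries M i" (is "?L = ?Z")
proof -
  let ?Mi = "obj M i" and ?B = "boundaries M i"
  interpret M: module R ?Mi using assms by (simp add: chain_complex_def)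
  have mods: "module R (obj M j)" and d: "diff M j \<in> mod_hom R (obj M j) (obj M (j - 1))" for j
    using assms by (simp_all add: chain_complex_def)
  interpret M1: module R "obj M (i + 1)" by (rule mods)
  have d1: "diff M (i + 1) \<in> mod_hom R (obj M (i + 1)) ?Mi" using d[of "i + 1"] by simp
  have B0: "\<zero>\<^bsub>?Mi\<^esub> \<in> ?B"
    using mod_hom_zero[OF mods mods d, of "i + 1"]
    by (auto simp: boundaries_def image_iff intro: bexI[of _ "\<zero>\<^bsub>obj M (i+1)\<^esub>"])
  have Bc: "?B \<subseteq> carrier ?Mi" using mod_homD(1)[OF d1] by (auto simp: boundaries_def)
  have BZ: "?B \<subseteq> cycles M i"
    using assms Bc unfolding chain_complex_def cycles_def boundaries_def
    by (auto dest!: spec[of _ "i + 1"])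
  have Badd: "x \<oplus>\<^bsub>?Mi\<^esub> y \<in> ?B" if "x \<in> ?B" "y \<in> ?B" for x y
    using that by (auto simp: boundaries_def simp flip: mod_homD(2)[OF d1])
  have Bneg: "\<ominus>\<^bsub>?Mi\<^esub> x \<in> ?B" if "x \<in> ?B" for x
  proof -
    from that obtain y where y: "y \<in> carrier (obj M (i + 1))" "x = diff M (i + 1) y"
      by (auto simp: boundaries_def)
    have "\<ominus>\<^bsub>?Mi\<^esub> x = \<ominus>\<^bsub>R\<^esub> \<one>\<^bsub>R\<^esub> \<odot>\<^bsub>?Mi\<^esub> x"
      using that Bc by (simp add: M.smult_l_minus subset_iff)
    also have "\<dots> = diff M (i + 1) (\<ominus>\<^bsub>R\<^esub> \<one>\<^bsub>R\<^esub> \<odot>\<^bsub>obj M (i + 1)\<^esub> y)"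
      using y by (simp add: mod_homD(3)[OF d1])
    finally show ?thesis using y by (auto simp: boundaries_def)
  qed
  have car: "carrier (homology M i) = (\<lambda>z. (\<lambda>x. x \<oplus>\<^bsub>?Mi\<^esub> z) ` ?B) ` cycles M i"
    by (auto simp: homology_def quot_module_def A_RCOSETS_def RCOSETS_def r_coset_def image_iff)
  have co: "(\<lambda>x. x \<oplus>\<^bsub>?Mi\<^esub> z) ` ?B = ?B \<longleftrightarrow> z \<in> ?B" if z: "z \<in> cycles M i" for z
  proof
    have zc: "z \<in> carrier ?Mi" using z by (simp add: cycles_def)
    assume "(\<lambda>x. x \<oplus>\<^bsub>?Mi\<^esub> z) ` ?B = ?B"
    with B0 have "\<zero>\<^bsub>?Mi\<^esub> \<oplus>\<^bsub>?Mi\<^esub> z \<in> ?B" by blast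
    then show "z \<in> ?B" using zc by simp
  next
    assume zB: "z \<in> ?B"
    have "x = (x \<oplus>\<^bsub>?Mi\<^esub> \<ominus>\<^bsub>?Mi\<^esub> z) \<oplus>\<^bsub>?Mi\<^esub> z" if "x \<in> ?B" for x
      using that zB Bc by (simp add: M.M.a_assoc M.M.l_neg subset_iff)
    then show "(\<lambda>x. x \<oplus>\<^bsub>?Mi\<^esub> z) ` ?B = ?B"
      using Badd[OF _ zB] Badd[OF _ Bneg[OF zB]] by (auto simp: image_iff)
  qed
  have zz: "\<zero>\<^bsub>?Mi\<^esub> \<in> cycles M i" using B0 BZ by blast
  have "?L \<longleftrightarrow> carrier (homology M i) = {?B}"
  proof
    assume ?L
    then obtain C where C: "carrier (homology M i) = {C}" ..
    have "(\<lambda>x. x \<oplus>\<^bsub>?Mi\<^esub> \<zero>\<^bsub>?Mi\<^esub>) ` ?B \<in> carrier (homology M i)"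
      using zz unfolding car by (rule imageI)
    with C show "carrier (homology M i) = {?B}"
      using co[OF zz] B0 by simp
  qed blast
  also have "\<dots> \<longleftrightarrow> ?Z"
  proof
    assume B: "carrier (homology M i) = {?B}"
    have "z \<in> ?B" if z: "z \<in> cycles M i" for z
    proof -
      have "(\<lambda>x. x \<oplus>\<^bsub>?Mi\<^esub> z) ` ?B \<in> carrier (homology M i)"
        using z unfolding car by (rule imageI)
      then show ?thesis using co[OF z] B by simp
    qed
    then show ?Z using BZ by blast
  next
    assume Z: ?Z
    then show "carrier (homology M i) = {?B}"
      using co zz unfolding car by auto
  qed
  finally show ?thesis .
qed

lemma derived_iso_zero_iff:
  assumes M: "chain_complex R M"
  shows "derived_iso R M zero_cpx \<longleftrightarrow> (\<forall>i. cycles M i = boundaries M i)"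
proof
  let ?r = "\<lambda>U V. chain_complex R U \<and> chain_complex R V \<and> (\<exists>f. quasi_iso R U V f)"
  let ?Q = "\<lambda>U. \<forall>i. \<exists>C. carrier (homology U i) = {C}"
  have sing: "(\<exists>C. P = {C}) = (\<exists>C. Q = {C})" if b: "bij_betw h P Q" for h :: "'c set \<Rightarrow> 'c set" and P Q
  proof
    assume "\<exists>C. P = {C}"
    then show "\<exists>C. Q = {C}" using bij_betw_imp_surj_on[OF b] by auto
  next
    assume "\<exists>C. Q = {C}"
    then show "\<exists>C. P = {C}" using bij_betw_imp_surj_on[OF bij_betw_inv_into[OF b]] by auto
  qed
  have rel: "?Q U \<longleftrightarrow> ?Q V" if "?r U V" for U V :: "('a, 'c) cpx"
  proof -
    from that obtain f where f: "quasi_iso R U V f" by blast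
    have "(\<exists>C. carrier (homology U i) = {C}) = (\<exists>C. carrier (homology V i) = {C})" for i
      by (rule sing[of "homology_map V f i"]) (use f in \<open>simp add: quasi_iso_def\<close>)
    then show ?thesis by (rule iff_allI)
  qed
  assume "derived_iso R M zero_cpx"
  then have "equivclp ?r M zero_cpx" by (simp add: derived_iso_def)
  then have "?Q M = ?Q (zero_cpx :: ('a, 'c) cpx)"
  proof (induction rule: equivclp_induct)
    case base
    show ?case by (rule refl)
  next
    case (step V W)
    from step.hyps(2) have "?Q V = ?Q W"
      by (elim disjE) (rule rel, assumption, rule rel[symmetric], assumption)
    with step.IH show ?case by (rule trans)
  qed
  moreover have "?Q (zero_cpx :: ('a, 'c) cpx)"
    by (simp add: carrier_homology_zero_cpx)
  ultimately have "?Q M" by (rule iffD2)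
  then show "\<forall>i. cycles M i = boundaries M i"
    using singleton_homology_iff[OF M] by simp
next
  assume "\<forall>i. cycles M i = boundaries M i"
  then have s: "\<exists>C. carrier (homology M i) = {C}" for i
    by (simp add: singleton_homology_iff[OF M])
  have ne: "C \<noteq> {}" if "C \<in> carrier (homology M i)" for C i
  proof -
    interpret M1: module R "obj M (i + 1)" using M by (simp add: chain_complex_def)
    have "boundaries M i \<noteq> {}" by (auto simp: boundaries_def)
    then show ?thesis using that
      by (auto simp: homology_def quot_module_def A_RCOSETS_def RCOSETS_def r_coset_def)
  qed
  let ?f = "\<lambda>(_::int) (_::'c). undefined :: 'c" and ?Z = "zero_cpx :: ('a, 'c) cpx"
  have "homology_map ?Z ?f i C = {undefined}" if "C \<in> carrier (homology M i)" for C i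
    using ne[OF that]
    by (auto simp: homology_map_def boundaries_def zero_cpx_def zero_module_def a_r_coset_def r_coset_def)
  then have "bij_betw (homology_map ?Z ?f i) (carrier (homology M i))
      (carrier (homology ?Z i))" for i
    using s[of i] by (auto simp: carrier_homology_zero_cpx bij_betw_def)
  moreover have "chain_map R M ?Z ?f"
    by (auto simp: chain_map_def mod_hom_def zero_cpx_def zero_module_def)
  ultimately have "quasi_iso R M ?Z ?f" by (simp add: quasi_iso_def)
  moreover have "module R (obj M 0)" using M by (simp add: chain_complex_def)
  then have "cring R" by (rule module.axioms(1))
  ultimately show "derived_iso R M zero_cpx"
    unfolding derived_iso_def using M chain_complex_zero_cpx
    by (intro r_into_equivclp conjI exI[of _ ?f])
qed

text \<open>The complex \<open>Hom\<^sub>R(M,N)\<close> for a module \<open>N\<close>: in degree \<open>i\<close> it is \<open>Hom\<^sub>R(M\<^sub>-\<^sub>i,N)\<close>, and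
  \<open>\<partial>(f) = \<partial>\<^sup>N f - (-1)\<^sup>i f \<partial>\<^sup>M\<close> for \<open>f\<close> of degree \<open>i\<close>, where \<open>\<partial>\<^sup>N = 0\<close>.\<close>

definition hom_cpx :: "('r,'s) ring_scheme \<Rightarrow> ('r,'m) cpx \<Rightarrow> ('r,'n) module \<Rightarrow> ('r,'m \<Rightarrow> 'n) cpx"
  where "hom_cpx R M N =
    \<lparr>obj = (\<lambda>i. hom_module R (obj M (- i)) N),
     diff = (\<lambda>i f. \<lambda>x\<in>carrier (obj M (1 - i)).
       if even i then \<ominus>\<^bsub>N\<^esub> f (diff M (1 - i) x) else f (diff M (1 - i) x))\<rparr>"

definition loc_cpx :: "('r,'s) ring_scheme \<Rightarrow> 'r set \<Rightarrow> ('r,'m) cpx \<Rightarrow> (('r \<times> 'r) set, ('m \<times> 'r) set) cpx"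
  where "loc_cpx R S M =
    \<lparr>obj = (\<lambda>i. loc_module R S (obj M i)),
     diff = (\<lambda>i. loc_map R S (obj M (i - 1)) (diff M i))\<rparr>"


section \<open>Co-localization and big cosupport\<close>

text \<open>Injective envelopes are unique only up to isomorphism, so a choice of them is a parameter:
  \<open>E \<mm>\<close> stands for \<open>E\<^sub>R(R/\<mm>)\<close>, and \<open>F \<pp>\<close> for \<open>E\<^bsub>R\<^sub>\<pp>\<^esub>(k(\<pp>))\<close>.\<close>

definition envelopes_at_maximal :: "('r,'s) ring_scheme \<Rightarrow> ('r set \<Rightarrow> ('r,'e) module) \<Rightarrow> bool"
  where "envelopes_at_maximal R E \<longleftrightarrow>
    (\<forall>\<mm>\<in>MaxSpec R. injective_envelope R (quot_module (self_module R) \<mm>) (E \<mm>))"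

definition envelopes_of_residue_fields ::
    "('r,'s) ring_scheme \<Rightarrow> ('r set \<Rightarrow> (('r \<times> 'r) set,'f) module) \<Rightarrow> bool"
  where "envelopes_of_residue_fields R F \<longleftrightarrow>
    (\<forall>\<pp>\<in>Spec R. injective_envelope (localization_at R \<pp>) (residue_field R \<pp>) (F \<pp>))"

definition dual ::
    "('r,'s) ring_scheme \<Rightarrow> ('r set \<Rightarrow> ('r,'e) module) \<Rightarrow> ('r,'m) cpx \<Rightarrow> ('r,'m \<Rightarrow> 'r set \<Rightarrow> 'e) cpx"
  where "dual R E M = hom_cpx R M (direct_sum (MaxSpec R) E)"

definition co_localization ::
    "('r,'s) ring_scheme \<Rightarrow> ('r set \<Rightarrow> ('r,'e) module) \<Rightarrow> ('r set \<Rightarrow> (('r \<times> 'r) set,'f) module) \<Rightarrow>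
      'r set \<Rightarrow> ('r,'m) cpx \<Rightarrow> (('r \<times> 'r) set, (('m \<Rightarrow> 'r set \<Rightarrow> 'e) \<times> 'r) set \<Rightarrow> 'f) cpx"
  where "co_localization R E F \<pp> M =
    hom_cpx (localization_at R \<pp>) (loc_cpx R (carrier R - \<pp>) (dual R E M)) (F \<pp>)"

definition coSupp ::
    "('r,'s) ring_scheme \<Rightarrow> ('r set \<Rightarrow> ('r,'e) module) \<Rightarrow> ('r set \<Rightarrow> (('r \<times> 'r) set,'f) module) \<Rightarrow>
      ('r,'m) cpx \<Rightarrow> 'r set set"
  where "coSupp R E F M =
    {\<pp> \<in> Spec R. \<not> derived_iso (localization_at R \<pp>) (co_localization R E F \<pp> M) zero_cpx}"

end

theory Submission
  imports Defs
begin

text \<open>Put \<open>J = \<Oplus> E(R/\<mm>)\<close>. The proof replaces the co-localization of \<open>M\<close> at \<open>\<pp>\<close> by a statement about single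
  functionals. If \<open>N\<close> is injective, the cycles of \<open>Hom(X,N)\<close> are the functionals that kill the boundaries
  of \<open>X\<close>, and the boundaries of \<open>Hom(X,N)\<close> are the functionals that kill the cycles of \<open>X\<close> (\<open>cycles_hom_cpx\<close>,
  \<open>boundaries_hom_cpx\<close>). This is applied twice.

  For \<open>N = E(k(\<pp>))\<close> over the local ring \<open>R\<^sub>\<pp>\<close> functionals separate points from submodules, so co-localization
  vanishes iff \<open>D(M)\<^sub>\<pp>\<close> is exact (\<open>hom_cpx_exact_iff\<close>, \<open>envelope_at_prime_separates\<close>). As localization is exact, this
  means that every cycle of \<open>D(M) = Hom(M,J)\<close> becomes a boundary after multiplication by an element outside
  \<open>\<pp>\<close> (\<open>loc_cpx_exact_iff\<close>). For \<open>N = J\<close> over \<open>R\<close> the result is \<open>coSupp_iff\<close>: a prime \<open>\<pp>\<close> lies in the cosupport of \<open>M\<close>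
  iff for some \<open>i\<close> there is a functional \<open>f : M\<^sub>i \<rightarrow> J\<close> that kills the boundaries and such that no \<open>u f\<close> with \<open>u\<close>
  outside \<open>\<pp>\<close> kills the cycles. Since \<open>J\<close> is injective, such functionals correspond to functionals on
  \<open>H\<^sub>i(M)\<close> that are not killed by any \<open>u\<close> outside \<open>\<pp>\<close> (\<open>survives_homology_iff\<close>), and this is the same criterion
  for the module \<open>H\<^sub>i(M)\<close> in degree \<open>0\<close>. Hence the first claim.

  For the second claim, functionals into \<open>J\<close> separate points from submodules as well: a cycle \<open>z\<close> that is
  no boundary has a class whose annihilator lies in some maximal ideal \<open>\<mm>\<close>, and the summand \<open>E(R/\<mm>)\<close> receives
  a functional \<open>f\<close> that kills the boundaries and for which the annihilator of \<open>f z\<close> lies in \<open>\<mm>\<close>. Then \<open>\<mm>\<close> is in the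
  cosupport.

  That \<open>J\<close> is injective is where the noetherian hypothesis matters: by Baer's criterion only functionals on
  ideals have to be extended, and those on finitely generated ideals take values in finitely many summands
  (\<open>injective_direct_sum\<close>).\<close>

section \<open>Modules and their quotients\<close>

lemma mod_homI:
  assumes "\<And>x. x \<in> carrier M \<Longrightarrow> f x \<in> carrier N"
    and "\<And>x y. \<lbrakk>x \<in> carrier M; y \<in> carrier M\<rbrakk> \<Longrightarrow> f (x \<oplus>\<^bsub>M\<^esub> y) = f x \<oplus>\<^bsub>N\<^esub> f y"
    and "\<And>r x. \<lbrakk>r \<in> carrier R; x \<in> carrier M\<rbrakk> \<Longrightarrow> f (r \<odot>\<^bsub>M\<^esub> x) = r \<odot>\<^bsub>N\<^esub> f x"
  shows "f \<in> mod_hom R M N"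
  using assms by (auto simp: mod_hom_def)

lemma mod_hom_comp:
  assumes "f \<in> mod_hom R L M" "g \<in> mod_hom R M N"
  shows "(\<lambda>x. g (f x)) \<in> mod_hom R L N"
  using mod_homD[OF assms(1)] mod_homD[OF assms(2)] by (auto intro!: mod_homI)

lemma mod_hom_minus:
  assumes "module R M" "module R N" "f \<in> mod_hom R M N" "x \<in> carrier M"
  shows "f (\<ominus>\<^bsub>M\<^esub> x) = \<ominus>\<^bsub>N\<^esub> f x"
proof -
  interpret M: module R M by fact
  interpret N: module R N by fact
  have "f (\<ominus>\<^bsub>M\<^esub> x) \<oplus>\<^bsub>N\<^esub> f x = \<zero>\<^bsub>N\<^esub>"
    using mod_homD(2)[OF assms(3), of "\<ominus>\<^bsub>M\<^esub> x" x] mod_hom_zero[OF assms(1-3)] assms(4)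
    by (simp add: M.M.l_neg)
  then show ?thesis
    using mod_homD(1)[OF assms(3)] assms(4) by (simp add: N.M.minus_equality)
qed

text \<open>The module axioms are universally quantified equations and the existence of negatives, and both
  pass along a surjection that respects the operations; \<open>Q\<close> only has to carry operations. This spares
  computing with cosets.\<close>

lemma module_surjective_image:
  fixes M :: "('r,'m,'x) module_scheme" and Q :: "('r,'q,'y) module_scheme"
  assumes "module R M" and \<pi>: "\<pi> \<in> mod_hom R M Q" "\<pi> ` carrier M = carrier Q"
    "\<pi> \<zero>\<^bsub>M\<^esub> = \<zero>\<^bsub>Q\<^esub>"
  shows "module R Q"
proof -
  interpret M: module R M by fact
  note hom = mod_homD(2,3)[OF \<pi>(1), symmetric] and cl = mod_homD(1)[OF \<pi>(1)]
  have zero: "\<zero>\<^bsub>Q\<^esub> = \<pi> \<zero>\<^bsub>M\<^esub>" using \<pi>(3) by simp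
  have lift: "\<exists>a. a \<in> carrier M \<and> x = \<pi> a" if "x \<in> carrier Q" for x
    using that \<pi>(2) by blast
  show ?thesis
  proof (intro moduleI[OF M.R.is_cring] abelian_groupI)
    fix x assume "x \<in> carrier Q"
    then obtain a where a: "a \<in> carrier M" "x = \<pi> a" using lift by blast
    then show "\<exists>y\<in>carrier Q. y \<oplus>\<^bsub>Q\<^esub> x = \<zero>\<^bsub>Q\<^esub>"
      by (intro bexI[of _ "\<pi> (\<ominus>\<^bsub>M\<^esub> a)"]) (simp_all add: hom zero M.M.l_neg cl)
  qed (auto dest!: lift simp: zero hom cl M.M.a_ac M.smult_l_distr M.smult_r_distr M.smult_assoc1)
qed

text \<open>The cosets form a group, so only the scalar action needs an argument: all members
  of \<open>N + x\<close> give the same coset \<open>N + r x\<close>.\<close>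

lemma
  assumes "module R M" "submodule N R M"
  shows quot_projection_hom: "(\<lambda>x. N +>\<^bsub>M\<^esub> x) \<in> mod_hom R M (quot_module M N)"
    and module_quot_module: "module R (quot_module M N)"
    and quot_projection_zero_iff:
      "x \<in> carrier M \<Longrightarrow> N +>\<^bsub>M\<^esub> x = \<zero>\<^bsub>quot_module M N\<^esub> \<longleftrightarrow> x \<in> N"
proof -
  interpret M: module R M by fact
  interpret N: submodule N R M by fact
  have sub: "subgroup N (add_monoid M)" by (rule N.subgroup_axioms)
  interpret N': abelian_subgroup N M
    by (intro abelian_subgroupI3 additive_subgroupI sub M.M.abelian_group_axioms)
  have z: "N +>\<^bsub>M\<^esub> \<zero>\<^bsub>M\<^esub> = N" using N'.a_subset by simp
  show zero_iff: "N +>\<^bsub>M\<^esub> x = \<zero>\<^bsub>quot_module M N\<^esub> \<longleftrightarrow> x \<in> N" if "x \<in> carrier M" for x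
    using M.a_coset_join1[OF _ that sub] M.a_coset_join2[OF that sub]
    by (auto simp: quot_module_def)
  have smult: "(\<Union>y\<in>N +>\<^bsub>M\<^esub> x. N +>\<^bsub>M\<^esub> (r \<odot>\<^bsub>M\<^esub> y)) = N +>\<^bsub>M\<^esub> (r \<odot>\<^bsub>M\<^esub> x)"
    if rx: "r \<in> carrier R" "x \<in> carrier M" for r x
  proof -
    have "N +>\<^bsub>M\<^esub> (r \<odot>\<^bsub>M\<^esub> y) = N +>\<^bsub>M\<^esub> (r \<odot>\<^bsub>M\<^esub> x)" if "y \<in> N +>\<^bsub>M\<^esub> x" for y
    proof -
      from that obtain n where n: "n \<in> N" "y = n \<oplus>\<^bsub>M\<^esub> x" by (auto simp: a_r_coset_def')
      then have "r \<odot>\<^bsub>M\<^esub> y = r \<odot>\<^bsub>M\<^esub> n \<oplus>\<^bsub>M\<^esub> r \<odot>\<^bsub>M\<^esub> x"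
        using rx N'.a_subset by (auto simp: M.smult_r_distr)
      then have "r \<odot>\<^bsub>M\<^esub> y \<in> N +>\<^bsub>M\<^esub> (r \<odot>\<^bsub>M\<^esub> x)"
        using rx n by (auto simp: a_r_coset_def')
      then show ?thesis
        using M.a_repr_independence[OF _ _ sub] rx by auto
    qed
    moreover have "x \<in> N +>\<^bsub>M\<^esub> x"
      using rx by (rule_tac N'.a_rcos_self)
    ultimately show ?thesis by blast
  qed
  show hom: "(\<lambda>x. N +>\<^bsub>M\<^esub> x) \<in> mod_hom R M (quot_module M N)"
    by (rule mod_homI)
      (auto simp: quot_module_def smult N'.a_rcos_sum intro!: M.a_rcosetsI[OF N'.a_subset])
  show "module R (quot_module M N)"
    by (rule module_surjective_image[OF assms(1) hom])
      (auto simp: quot_module_def A_RCOSETS_def' z)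
qed

lemma carrier_quot_module: "carrier (quot_module M N) = (\<lambda>x. N +>\<^bsub>M\<^esub> x) ` carrier M"
  by (auto simp: quot_module_def A_RCOSETS_def')

lemma module_restrict_carrier:
  assumes "module R M" "submodule N R M"
  shows "module R (M\<lparr>carrier := N\<rparr>)"
  using assms by (simp add: submodule.submodule_is_module)

text \<open>Negatives come for free as multiples by \<open>-1\<close>.\<close>

lemma submoduleI_smult:
  assumes "module R M" "H \<subseteq> carrier M" "\<zero>\<^bsub>M\<^esub> \<in> H"
    and "\<And>x y. \<lbrakk>x \<in> H; y \<in> H\<rbrakk> \<Longrightarrow> x \<oplus>\<^bsub>M\<^esub> y \<in> H"
    and smult: "\<And>r x. \<lbrakk>r \<in> carrier R; x \<in> H\<rbrakk> \<Longrightarrow> r \<odot>\<^bsub>M\<^esub> x \<in> H"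
  shows "submodule H R M"
proof -
  interpret M: module R M by fact
  have "\<ominus>\<^bsub>M\<^esub> x \<in> H" if "x \<in> H" for x
  proof -
    have "x \<in> carrier M" using that assms(2) by blast
    then show ?thesis
      using smult[OF _ that, of "\<ominus>\<^bsub>R\<^esub> \<one>\<^bsub>R\<^esub>"] by (simp add: M.smult_l_minus)
  qed
  then show ?thesis using assms by (intro M.submoduleI)
qed

lemma mod_hom_kernel_submodule:
  assumes "module R M" "module R N" "f \<in> mod_hom R M N"
  shows "submodule {x \<in> carrier M. f x = \<zero>\<^bsub>N\<^esub>} R M"
proof -
  interpret M: module R M by fact
  interpret N: module R N by fact
  show ?thesis
    by (rule M.submoduleI)
      (use mod_homD[OF assms(3)] mod_hom_zero[OF assms] mod_hom_minus[OF assms] in auto)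
qed

lemma mod_hom_image_submodule:
  assumes "module R M" "module R N" "f \<in> mod_hom R M N"
  shows "submodule (f ` carrier M) R N"
proof -
  interpret M: module R M by fact
  interpret N: module R N by fact
  show ?thesis
    by (rule N.submoduleI)
      (auto simp: mod_homD(1)[OF assms(3)]
        simp flip: mod_homD(2,3)[OF assms(3)] mod_hom_zero[OF assms] mod_hom_minus[OF assms])
qed

lemma self_module_simps:
  "carrier (self_module R) = carrier R" "add (self_module R) = add R"
  "zero (self_module R) = zero R" "smult (self_module R) = mult R"
  by (simp_all add: self_module_def)

lemma submodule_self_module_iff:
  assumes "cring R"
  shows "submodule I R (self_module R) \<longleftrightarrow> ideal I R"
proof -
  interpret R: cring R by fact
  interpret S: module R "self_module R" by (rule self_module_module) fact
  have neg: "\<ominus>\<^bsub>self_module R\<^esub> x = \<ominus>\<^bsub>R\<^esub> x" for x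
    by (simp add: a_inv_def self_module_def m_inv_def)
  show ?thesis
  proof
    assume I: "submodule I R (self_module R)"
    note e = S.submoduleE[OF I]
    have z: "\<zero>\<^bsub>R\<^esub> \<in> I" using submodule.axioms(1)[OF I] subgroup.one_closed
      by (fastforce simp: self_module_def)
    show "ideal I R"
    proof (rule idealI[OF R.ring_axioms])
      show "subgroup I (add_monoid R)"
        using e z neg by (intro subgroup.intro) (auto simp: self_module_def a_inv_def)
      show "r \<otimes>\<^bsub>R\<^esub> a \<in> I" if "a \<in> I" "r \<in> carrier R" for a r
        using e(4)[of r a] that by (simp add: self_module_def)
      moreover have "a \<in> I \<Longrightarrow> a \<in> carrier R" for a using e(1) by (auto simp: self_module_def)
      ultimately show "a \<otimes>\<^bsub>R\<^esub> r \<in> I" if "a \<in> I" "r \<in> carrier R" for a r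
        using that by (metis R.m_comm)
    qed
  next
    assume "ideal I R"
    then interpret I: ideal I R .
    show "submodule I R (self_module R)"
      by (rule S.submoduleI) (auto simp: neg[unfolded self_module_def] self_module_def I.I_l_closed)
  qed
qed

section \<open>Injective modules\<close>

text \<open>On the submodule \<open>f(A)\<close> of \<open>B\<close> the assignment \<open>f a \<mapsto> g a\<close> is well defined because \<open>g\<close> kills the
  kernel of \<open>f\<close>, and injectivity extends it to \<open>B\<close>. In this form injectivity covers at once the extension
  of functionals, the factorization through a quotient and the factorization through a differential.\<close>

lemma injective_module_factor:
  fixes A :: "('r,'a,'y) module_scheme" and B :: "('r,'b,'z) module_scheme"
  assumes E: "injective_module R E" and A: "module R A" and B: "module R B"
    and f: "f \<in> mod_hom R A B" and g: "g \<in> mod_hom R A E"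
    and ker: "\<And>a. a \<in> carrier A \<Longrightarrow> f a = \<zero>\<^bsub>B\<^esub> \<Longrightarrow> g a = \<zero>\<^bsub>E\<^esub>"
  shows "\<exists>h\<in>mod_hom R B E. \<forall>a\<in>carrier A. h (f a) = g a"
proof -
  have mE: "module R E" using E by (simp add: injective_module_def)
  interpret A: module R A by fact
  interpret B: module R B by fact
  interpret E: module R E by fact
  let ?I = "B\<lparr>carrier := f ` carrier A\<rparr>"
  define g' where "g' b = g (SOME a. a \<in> carrier A \<and> f a = b)" for b
  have wd: "g a = g a'" if a: "a \<in> carrier A" "a' \<in> carrier A" "f a = f a'" for a a'
  proof -
    have "f (a \<oplus>\<^bsub>A\<^esub> \<ominus>\<^bsub>A\<^esub> a') = \<zero>\<^bsub>B\<^esub>"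
      using a mod_homD[OF f] mod_hom_minus[OF A B f] by (simp add: B.M.r_neg)
    then have "g a \<oplus>\<^bsub>E\<^esub> \<ominus>\<^bsub>E\<^esub> g a' = \<zero>\<^bsub>E\<^esub>"
      using ker[of "a \<oplus>\<^bsub>A\<^esub> \<ominus>\<^bsub>A\<^esub> a'"] a mod_homD[OF g] mod_hom_minus[OF A mE g] by simp
    then show ?thesis
      using mod_homD(1)[OF g] a by (metis E.M.minus_equality E.M.minus_minus E.M.a_inv_closed)
  qed
  have g': "g' (f a) = g a" if "a \<in> carrier A" for a
  proof -
    have "(SOME a'. a' \<in> carrier A \<and> f a' = f a) \<in> carrier A
        \<and> f (SOME a'. a' \<in> carrier A \<and> f a' = f a) = f a"
      by (rule someI_ex) (use that in blast)
    then show ?thesis unfolding g'_def using wd that by blast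
  qed
  have "module R ?I"
    using module_restrict_carrier[OF B mod_hom_image_submodule[OF A B f]] .
  moreover have "(\<lambda>x. x) \<in> mod_hom R ?I B"
    using mod_homD(1)[OF f] by (auto intro!: mod_homI)
  moreover have "g' \<in> mod_hom R ?I E"
  proof (rule mod_homI)
    fix x assume "x \<in> carrier ?I"
    then obtain a where a: "a \<in> carrier A" "x = f a" by auto
    then show "g' x \<in> carrier E" using g' mod_homD(1)[OF g] by simp
    show "g' (r \<odot>\<^bsub>?I\<^esub> x) = r \<odot>\<^bsub>E\<^esub> g' x" if "r \<in> carrier R" for r
      using a that g'[of "r \<odot>\<^bsub>A\<^esub> a"] g'[of a] by (simp add: mod_homD[OF f] mod_homD[OF g])
    fix y assume "y \<in> carrier ?I"
    then obtain b where b: "b \<in> carrier A" "y = f b" by auto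
    then show "g' (x \<oplus>\<^bsub>?I\<^esub> y) = g' x \<oplus>\<^bsub>E\<^esub> g' y"
      using a g'[of "a \<oplus>\<^bsub>A\<^esub> b"] g'[of a] g'[of b] by (simp add: mod_homD[OF f] mod_homD[OF g])
  qed
  ultimately obtain h where h: "h \<in> mod_hom R B E" "\<forall>x\<in>carrier ?I. h x = g' x"
    using injective_module_extend[OF E _ B, of ?I "\<lambda>x. x" g'] by auto
  then show ?thesis using g' by (intro bexI[of _ h]) auto
qed

text \<open>The graph of a homomorphism from a submodule of \<open>B\<close> to \<open>J\<close>; graphs are used because they are
  ordered by inclusion, as Zorn's lemma wants.\<close>

definition partial_hom ::
    "('r,'s) ring_scheme \<Rightarrow> ('r,'b,'x) module_scheme \<Rightarrow> ('r,'j,'y) module_scheme \<Rightarrow> ('b \<times> 'j) set \<Rightarrow> bool"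
  where "partial_hom R B J G \<longleftrightarrow> G \<subseteq> carrier B \<times> carrier J \<and> (\<zero>\<^bsub>B\<^esub>, \<zero>\<^bsub>J\<^esub>) \<in> G \<and>
    (\<forall>b e b' e'. (b, e) \<in> G \<longrightarrow> (b', e') \<in> G \<longrightarrow> (b \<oplus>\<^bsub>B\<^esub> b', e \<oplus>\<^bsub>J\<^esub> e') \<in> G) \<and>
    (\<forall>r\<in>carrier R. \<forall>b e. (b, e) \<in> G \<longrightarrow> (r \<odot>\<^bsub>B\<^esub> b, r \<odot>\<^bsub>J\<^esub> e) \<in> G) \<and>
    (\<forall>e. (\<zero>\<^bsub>B\<^esub>, e) \<in> G \<longrightarrow> e = \<zero>\<^bsub>J\<^esub>)"

lemma partial_homD:
  assumes "partial_hom R B J G"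
  shows "(b, e) \<in> G \<Longrightarrow> b \<in> carrier B" "(b, e) \<in> G \<Longrightarrow> e \<in> carrier J"
    "(\<zero>\<^bsub>B\<^esub>, \<zero>\<^bsub>J\<^esub>) \<in> G"
    "\<lbrakk>(b, e) \<in> G; (b', e') \<in> G\<rbrakk> \<Longrightarrow> (b \<oplus>\<^bsub>B\<^esub> b', e \<oplus>\<^bsub>J\<^esub> e') \<in> G"
    "\<lbrakk>r \<in> carrier R; (b, e) \<in> G\<rbrakk> \<Longrightarrow> (r \<odot>\<^bsub>B\<^esub> b, r \<odot>\<^bsub>J\<^esub> e) \<in> G"
    "(\<zero>\<^bsub>B\<^esub>, e) \<in> G \<Longrightarrow> e = \<zero>\<^bsub>J\<^esub>"
  using assms unfolding partial_hom_def by auto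

lemma partial_hom_minus:
  assumes "module R B" "module R J" and G: "partial_hom R B J G" and "(b, e) \<in> G"
  shows "(\<ominus>\<^bsub>B\<^esub> b, \<ominus>\<^bsub>J\<^esub> e) \<in> G"
proof -
  interpret B: module R B by fact
  interpret J: module R J by fact
  show ?thesis
    using partial_homD(5)[OF G, of "\<ominus>\<^bsub>R\<^esub> \<one>\<^bsub>R\<^esub>" b e] partial_homD(1,2)[OF G] assms(4)
    by (simp add: B.smult_l_minus J.smult_l_minus)
qed

lemma partial_hom_single_valued:
  assumes "module R B" "module R J" and G: "partial_hom R B J G" and e: "(b, e) \<in> G" "(b, e') \<in> G"
  shows "e = e'"
proof -
  interpret B: module R B by fact
  interpret J: module R J by fact
  note c = partial_homD(1,2)[OF G e(1)] partial_homD(1,2)[OF G e(2)]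
  have "(b \<oplus>\<^bsub>B\<^esub> \<ominus>\<^bsub>B\<^esub> b, e \<oplus>\<^bsub>J\<^esub> \<ominus>\<^bsub>J\<^esub> e') \<in> G"
    using partial_homD(4)[OF G e(1)] partial_hom_minus[OF assms(1,2) G e(2)] by blast
  then have "e \<oplus>\<^bsub>J\<^esub> \<ominus>\<^bsub>J\<^esub> e' = \<zero>\<^bsub>J\<^esub>"
    using partial_homD(6)[OF G] c by (simp add: B.M.r_neg)
  then show ?thesis
    using c by (metis J.M.minus_equality J.M.minus_minus J.M.a_inv_closed)
qed

text \<open>Assigning the value \<open>e\<close> to \<open>b\<close> is consistent as soon as it agrees with \<open>G\<close> on the multiples of \<open>b\<close>
  that already lie in the domain of \<open>G\<close>.\<close>

lemma partial_hom_adjoin: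
  assumes "module R B" "module R J" and G: "partial_hom R B J G"
    and b: "b \<in> carrier B" and e: "e \<in> carrier J"
    and compat: "\<And>r y. \<lbrakk>r \<in> carrier R; (r \<odot>\<^bsub>B\<^esub> b, y) \<in> G\<rbrakk> \<Longrightarrow> y = r \<odot>\<^bsub>J\<^esub> e"
  shows "\<exists>H. partial_hom R B J H \<and> G \<subseteq> H \<and> (b, e) \<in> H"
proof -
  interpret B: module R B by fact
  interpret J: module R J by fact
  (* H is the sum of G and the cyclic module generated by (b, e). *)
  define H where "H = (\<lambda>((x, y), r). (x \<oplus>\<^bsub>B\<^esub> r \<odot>\<^bsub>B\<^esub> b, y \<oplus>\<^bsub>J\<^esub> r \<odot>\<^bsub>J\<^esub> e)) ` (G \<times> carrier R)"
  have HI: "(u, v) \<in> H"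
    if "(x, y) \<in> G" "r \<in> carrier R" "u = x \<oplus>\<^bsub>B\<^esub> r \<odot>\<^bsub>B\<^esub> b" "v = y \<oplus>\<^bsub>J\<^esub> r \<odot>\<^bsub>J\<^esub> e" for x y r u v
    unfolding H_def using that by (intro image_eqI[of _ _ "((x, y), r)"]) auto
  have HE: "\<exists>x y r. (x, y) \<in> G \<and> r \<in> carrier R \<and> x \<in> carrier B \<and> y \<in> carrier J
      \<and> u = x \<oplus>\<^bsub>B\<^esub> r \<odot>\<^bsub>B\<^esub> b \<and> v = y \<oplus>\<^bsub>J\<^esub> r \<odot>\<^bsub>J\<^esub> e" if "(u, v) \<in> H" for u v
    using that partial_homD(1,2)[OF G] unfolding H_def by fastforce
  have GH: "(x, y) \<in> H" if "(x, y) \<in> G" for x y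
    using HI[OF that, of "\<zero>\<^bsub>R\<^esub>"] partial_homD(1,2)[OF G that] b e by simp
  have "partial_hom R B J H"
    unfolding partial_hom_def
  proof (intro conjI allI impI ballI subrelI)
    show "(u, v) \<in> carrier B \<times> carrier J" if "(u, v) \<in> H" for u v
      using HE[OF that] b e by auto
    show "(\<zero>\<^bsub>B\<^esub>, \<zero>\<^bsub>J\<^esub>) \<in> H"
      using GH partial_homD(3)[OF G] .
    show "(u \<oplus>\<^bsub>B\<^esub> u', v \<oplus>\<^bsub>J\<^esub> v') \<in> H" if H: "(u, v) \<in> H" "(u', v') \<in> H" for u v u' v'
    proof -
      from HE[OF H(1)] HE[OF H(2)] obtain x y r x' y' r' where
        "(x, y) \<in> G" "r \<in> carrier R" "x \<in> carrier B" "y \<in> carrier J"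
        "u = x \<oplus>\<^bsub>B\<^esub> r \<odot>\<^bsub>B\<^esub> b" "v = y \<oplus>\<^bsub>J\<^esub> r \<odot>\<^bsub>J\<^esub> e"
        "(x', y') \<in> G" "r' \<in> carrier R" "x' \<in> carrier B" "y' \<in> carrier J"
        "u' = x' \<oplus>\<^bsub>B\<^esub> r' \<odot>\<^bsub>B\<^esub> b" "v' = y' \<oplus>\<^bsub>J\<^esub> r' \<odot>\<^bsub>J\<^esub> e"
        by blast
      then show ?thesis
        using b e
        by (intro HI[OF partial_homD(4)[OF G], of x y x' y' "r \<oplus>\<^bsub>R\<^esub> r'"])
          (simp_all add: B.smult_l_distr J.smult_l_distr B.M.a_ac J.M.a_ac)
    qed
    show "(s \<odot>\<^bsub>B\<^esub> u, s \<odot>\<^bsub>J\<^esub> v) \<in> H" if s: "s \<in> carrier R" and H: "(u, v) \<in> H" for s u v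
    proof -
      from HE[OF H] obtain x y r where
        "(x, y) \<in> G" "r \<in> carrier R" "x \<in> carrier B" "y \<in> carrier J"
        "u = x \<oplus>\<^bsub>B\<^esub> r \<odot>\<^bsub>B\<^esub> b" "v = y \<oplus>\<^bsub>J\<^esub> r \<odot>\<^bsub>J\<^esub> e"
        by blast
      then show ?thesis
        using b e s
        by (intro HI[OF partial_homD(5)[OF G s], of x y "s \<otimes>\<^bsub>R\<^esub> r"])
          (simp_all add: B.smult_r_distr J.smult_r_distr B.smult_assoc1 J.smult_assoc1)
    qed
    show "v = \<zero>\<^bsub>J\<^esub>" if H: "(\<zero>\<^bsub>B\<^esub>, v) \<in> H" for v
    proof -
      from HE[OF H] obtain x y r where
        *: "(x, y) \<in> G" "r \<in> carrier R" "x \<in> carrier B" "y \<in> carrier J"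
        "\<zero>\<^bsub>B\<^esub> = x \<oplus>\<^bsub>B\<^esub> r \<odot>\<^bsub>B\<^esub> b" "v = y \<oplus>\<^bsub>J\<^esub> r \<odot>\<^bsub>J\<^esub> e"
        by blast
      have "\<ominus>\<^bsub>B\<^esub> x = r \<odot>\<^bsub>B\<^esub> b"
        using * b by (metis B.M.minus_equality B.M.a_comm B.smult_closed)
      then have "\<ominus>\<^bsub>J\<^esub> y = r \<odot>\<^bsub>J\<^esub> e"
        using compat[OF *(2)] partial_hom_minus[OF assms(1,2) G *(1)] by simp
      then show ?thesis
        using *(4,6) by (metis J.M.r_neg)
    qed
  qed
  moreover have "(b, e) \<in> H"
    using HI[OF partial_homD(3)[OF G], of "\<one>\<^bsub>R\<^esub>"] b e by simp
  moreover have "G \<subseteq> H" using GH by (rule subrelI)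
  ultimately show ?thesis by blast
qed

lemma partial_hom_chain_Union:
  assumes "\<C> \<noteq> {}" "subset.chain {G. partial_hom R B J G} \<C>"
  shows "partial_hom R B J (\<Union>\<C>)"
proof -
  have ph: "partial_hom R B J G" if "G \<in> \<C>" for G
    using assms(2) that by (auto simp: subset.chain_def)
  have common: "\<exists>G\<in>\<C>. p \<in> G \<and> q \<in> G" if "p \<in> \<Union>\<C>" "q \<in> \<Union>\<C>" for p q
  proof -
    from that obtain G H where "G \<in> \<C>" "p \<in> G" "H \<in> \<C>" "q \<in> H" by blast
    moreover from this have "G \<subseteq> H \<or> H \<subseteq> G" using assms(2) unfolding subset.chain_def by blast
    ultimately show ?thesis by blast
  qed
  show ?thesis
    unfolding partial_hom_def
  proof (intro conjI allI impI ballI)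
    show "(b \<oplus>\<^bsub>B\<^esub> b', e \<oplus>\<^bsub>J\<^esub> e') \<in> \<Union>\<C>" if "(b, e) \<in> \<Union>\<C>" "(b', e') \<in> \<Union>\<C>" for b e b' e'
      using common[OF that] partial_homD(4)[OF ph] by blast
    show "(\<zero>\<^bsub>B\<^esub>, \<zero>\<^bsub>J\<^esub>) \<in> \<Union>\<C>"
      using assms(1) partial_homD(3)[OF ph] by blast
    show "\<Union>\<C> \<subseteq> carrier B \<times> carrier J"
      using ph unfolding partial_hom_def by blast
    show "(r \<odot>\<^bsub>B\<^esub> b, r \<odot>\<^bsub>J\<^esub> e) \<in> \<Union>\<C>" if "r \<in> carrier R" "(b, e) \<in> \<Union>\<C>" for r b e
      using that partial_homD(5)[OF ph] by blast
    show "e = \<zero>\<^bsub>J\<^esub>" if "(\<zero>\<^bsub>B\<^esub>, e) \<in> \<Union>\<C>" for e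
      using that partial_homD(6)[OF ph] by blast
  qed
qed

text \<open>A maximal partial homomorphism is defined on every \<open>b\<close>: the scalars that bring \<open>b\<close> into its
  domain form an ideal, and the given extension property of that ideal provides the value at \<open>b\<close>.\<close>

lemma Baer_criterion:
  fixes R :: "('r,'s) ring_scheme" and J :: "('r,'j,'x) module_scheme"
  assumes J: "module R J"
    and ext: "\<And>I \<phi>. \<lbrakk>ideal I R; \<phi> \<in> mod_hom R ((self_module R)\<lparr>carrier := I\<rparr>) J\<rbrakk>
      \<Longrightarrow> \<exists>e\<in>carrier J. \<forall>r\<in>I. \<phi> r = r \<odot>\<^bsub>J\<^esub> e"
  shows "injective_module R J"
  unfolding injective_module_def
proof (intro conjI J allI ballI impI)
  fix A B :: "('r,'r) module" and f g
  assume f: "f \<in> mod_hom R A B" and g: "g \<in> mod_hom R A J"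
    and "module R A \<and> module R B \<and> inj_on f (carrier A)"
  then have A: "module R A" and B: "module R B" and inj: "inj_on f (carrier A)" by auto
  interpret A: module R A by fact
  interpret B: module R B by fact
  interpret J: module R J by fact
  let ?G0 = "(\<lambda>a. (f a, g a)) ` carrier A"
  have f0: "f \<zero>\<^bsub>A\<^esub> = \<zero>\<^bsub>B\<^esub>" and g0: "g \<zero>\<^bsub>A\<^esub> = \<zero>\<^bsub>J\<^esub>"
    using mod_hom_zero A B J f g by blast+
  have G0: "partial_hom R B J ?G0"
    unfolding partial_hom_def
  proof (intro conjI allI impI ballI)
    show "?G0 \<subseteq> carrier B \<times> carrier J" using mod_homD(1)[OF f] mod_homD(1)[OF g] by auto
    show "(\<zero>\<^bsub>B\<^esub>, \<zero>\<^bsub>J\<^esub>) \<in> ?G0" using f0 g0 by (intro image_eqI[of _ _ "\<zero>\<^bsub>A\<^esub>"]) auto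
    show "(b \<oplus>\<^bsub>B\<^esub> b', e \<oplus>\<^bsub>J\<^esub> e') \<in> ?G0" if "(b, e) \<in> ?G0" "(b', e') \<in> ?G0" for b e b' e'
    proof -
      from that obtain a a' where "a \<in> carrier A" "a' \<in> carrier A"
        "b = f a" "e = g a" "b' = f a'" "e' = g a'" by blast
      then show ?thesis
        by (intro image_eqI[of _ _ "a \<oplus>\<^bsub>A\<^esub> a'"]) (simp_all add: mod_homD[OF f] mod_homD[OF g])
    qed
    show "(r \<odot>\<^bsub>B\<^esub> b, r \<odot>\<^bsub>J\<^esub> e) \<in> ?G0" if "r \<in> carrier R" "(b, e) \<in> ?G0" for r b e
    proof -
      from that obtain a where "a \<in> carrier A" "b = f a" "e = g a" by blast
      then show ?thesis
        using that(1)
        by (intro image_eqI[of _ _ "r \<odot>\<^bsub>A\<^esub> a"]) (simp_all add: mod_homD[OF f] mod_homD[OF g])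
    qed
    show "e = \<zero>\<^bsub>J\<^esub>" if "(\<zero>\<^bsub>B\<^esub>, e) \<in> ?G0" for e
    proof -
      from that obtain a where a: "a \<in> carrier A" "\<zero>\<^bsub>B\<^esub> = f a" "e = g a" by blast
      then have "a = \<zero>\<^bsub>A\<^esub>" using inj_onD[OF inj, of a "\<zero>\<^bsub>A\<^esub>"] f0 by simp
      then show ?thesis using a(3) g0 by simp
    qed
  qed
  let ?P = "{G. partial_hom R B J G \<and> ?G0 \<subseteq> G}"
  have "\<exists>G\<in>?P. \<forall>H\<in>?P. G \<subseteq> H \<longrightarrow> H = G"
  proof (rule subset_Zorn_nonempty)
    show "?P \<noteq> {}" using G0 by blast
    show "\<Union>\<C> \<in> ?P" if C: "\<C> \<noteq> {}" "subset.chain ?P \<C>" for \<C>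
    proof -
      have "subset.chain {G. partial_hom R B J G} \<C>"
        using C(2) unfolding subset.chain_def by blast
      then have "partial_hom R B J (\<Union>\<C>)" by (rule partial_hom_chain_Union[OF C(1)])
      moreover have "?G0 \<subseteq> \<Union>\<C>" using C unfolding subset.chain_def by blast
      ultimately show ?thesis by simp
    qed
  qed
  then obtain G where G: "partial_hom R B J G" and G0G: "?G0 \<subseteq> G"
    and max: "\<And>H. partial_hom R B J H \<Longrightarrow> G \<subseteq> H \<Longrightarrow> H = G"
    by fastforce
  note sv = partial_hom_single_valued[OF B J G]
  have total: "\<exists>e. (b, e) \<in> G" if b: "b \<in> carrier B" for b
  proof -
    define I where "I = {r \<in> carrier R. \<exists>y. (r \<odot>\<^bsub>B\<^esub> b, y) \<in> G}"
    define \<phi> where "\<phi> r = (SOME y. (r \<odot>\<^bsub>B\<^esub> b, y) \<in> G)" for r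
    have \<phi>: "(r \<odot>\<^bsub>B\<^esub> b, \<phi> r) \<in> G" if "r \<in> I" for r
      using that unfolding \<phi>_def I_def by (auto intro: someI)
    have IR: "r \<in> carrier R" if "r \<in> I" for r using that by (simp add: I_def)
    have add: "((r \<oplus>\<^bsub>R\<^esub> s) \<odot>\<^bsub>B\<^esub> b, \<phi> r \<oplus>\<^bsub>J\<^esub> \<phi> s) \<in> G" if "r \<in> I" "s \<in> I" for r s
      using partial_homD(4)[OF G \<phi>[OF that(1)] \<phi>[OF that(2)]] that b
      by (simp add: B.smult_l_distr IR)
    have smult: "((s \<otimes>\<^bsub>R\<^esub> r) \<odot>\<^bsub>B\<^esub> b, s \<odot>\<^bsub>J\<^esub> \<phi> r) \<in> G" if "s \<in> carrier R" "r \<in> I" for r s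
      using partial_homD(5)[OF G that(1) \<phi>[OF that(2)]] that b
      by (simp add: B.smult_assoc1 IR)
    have "submodule I R (self_module R)"
    proof (rule submoduleI_smult[OF self_module_module[OF module.axioms(1)[OF J]]])
      show "I \<subseteq> carrier (self_module R)" by (auto simp: I_def self_module_def)
      show "\<zero>\<^bsub>self_module R\<^esub> \<in> I"
        using partial_homD(3)[OF G] b by (auto simp: I_def self_module_def)
      show "x \<oplus>\<^bsub>self_module R\<^esub> y \<in> I" if "x \<in> I" "y \<in> I" for x y
        using add[OF that] that by (auto simp: I_def self_module_def)
      show "s \<odot>\<^bsub>self_module R\<^esub> y \<in> I" if "s \<in> carrier R" "y \<in> I" for s y
        using smult[OF that] that by (auto simp: I_def self_module_def)
    qed
    then have I: "ideal I R" by (simp add: submodule_self_module_iff[OF module.axioms(1)[OF J]])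
    have "\<phi> \<in> mod_hom R ((self_module R)\<lparr>carrier := I\<rparr>) J"
    proof (rule mod_homI, unfold self_module_def, simp_all)
      show "\<phi> x \<in> carrier J" if "x \<in> I" for x
        using partial_homD(2)[OF G \<phi>[OF that]] .
      show "\<phi> (x \<oplus>\<^bsub>R\<^esub> y) = \<phi> x \<oplus>\<^bsub>J\<^esub> \<phi> y" if "x \<in> I" "y \<in> I" for x y
      proof (rule sv[OF \<phi> add[OF that]])
        have "x \<oplus>\<^bsub>R\<^esub> y \<in> carrier R" using that IR by simp
        then show "x \<oplus>\<^bsub>R\<^esub> y \<in> I" unfolding I_def using add[OF that] by blast
      qed
      show "\<phi> (r \<otimes>\<^bsub>R\<^esub> x) = r \<odot>\<^bsub>J\<^esub> \<phi> x" if "r \<in> carrier R" "x \<in> I" for r x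
      proof (rule sv[OF \<phi> smult[OF that]])
        have "r \<otimes>\<^bsub>R\<^esub> x \<in> carrier R" using that IR by simp
        then show "r \<otimes>\<^bsub>R\<^esub> x \<in> I" unfolding I_def using smult[OF that] by blast
      qed
    qed
    with ext[OF I] obtain e where e: "e \<in> carrier J" "\<forall>r\<in>I. \<phi> r = r \<odot>\<^bsub>J\<^esub> e" by blast
    have "\<exists>H. partial_hom R B J H \<and> G \<subseteq> H \<and> (b, e) \<in> H"
    proof (rule partial_hom_adjoin[OF B J G b e(1)])
      fix r y assume r: "r \<in> carrier R" "(r \<odot>\<^bsub>B\<^esub> b, y) \<in> G"
      then have "r \<in> I" by (auto simp: I_def)
      then show "y = r \<odot>\<^bsub>J\<^esub> e" using sv[OF r(2) \<phi>] e(2) by simp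
    qed
    then show ?thesis using max by blast
  qed
  define h where "h b = (SOME e. (b, e) \<in> G)" for b
  have h: "(b, h b) \<in> G" if "b \<in> carrier B" for b
    using total[OF that] unfolding h_def by (rule someI_ex)
  have h': "h b = e" if "(b, e) \<in> G" for b e
    using sv[OF h that] partial_homD(1)[OF G that] by simp
  have "h \<in> mod_hom R B J"
  proof (rule mod_homI)
    show "h b \<in> carrier J" if "b \<in> carrier B" for b
      using partial_homD(2)[OF G h[OF that]] .
    show "h (b \<oplus>\<^bsub>B\<^esub> c) = h b \<oplus>\<^bsub>J\<^esub> h c" if "b \<in> carrier B" "c \<in> carrier B" for b c
      using h'[OF partial_homD(4)[OF G h[OF that(1)] h[OF that(2)]]] .
    show "h (r \<odot>\<^bsub>B\<^esub> b) = r \<odot>\<^bsub>J\<^esub> h b" if "r \<in> carrier R" "b \<in> carrier B" for r b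
      using h'[OF partial_homD(5)[OF G that(1) h[OF that(2)]]] .
  qed
  moreover have "h (f a) = g a" if "a \<in> carrier A" for a
    using h' G0G that by blast
  ultimately show "\<exists>h\<in>mod_hom R B J. \<forall>a\<in>carrier A. h (f a) = g a" by blast
qed

lemma module_direct_sum:
  assumes "cring R" "\<And>i. i \<in> I \<Longrightarrow> module R (E i)"
  shows "module R (direct_sum I E)"
proof -
  interpret R: cring R by fact
  have *: "abelian_group (E i)" if "i \<in> I" for i
    using assms(2)[OF that] by (simp add: module_def)
  note M = assms(2) and
    am = abelian_group.axioms(1)[OF *] and
    sm = module.smult_closed[OF assms(2)]
  have fin2: "finite {i \<in> I. f i \<oplus>\<^bsub>E i\<^esub> g i \<noteq> \<zero>\<^bsub>E i\<^esub>}"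
    if "finite {i \<in> I. f i \<noteq> \<zero>\<^bsub>E i\<^esub>}" "finite {i \<in> I. g i \<noteq> \<zero>\<^bsub>E i\<^esub>}" for f g
    by (rule finite_subset[OF _ finite_UnI[OF that]])
      (auto simp: abelian_monoid.l_zero[OF am] abelian_monoid.zero_closed[OF am])
  have fin1: "finite {i \<in> I. r \<odot>\<^bsub>E i\<^esub> f i \<noteq> \<zero>\<^bsub>E i\<^esub>}"
    if "finite {i \<in> I. f i \<noteq> \<zero>\<^bsub>E i\<^esub>}" "r \<in> carrier R" for f r
    by (rule finite_subset[OF _ that(1)]) (auto simp: module.smult_r_null[OF M] that)
  show ?thesis
  proof (intro moduleI[OF assms(1)] abelian_groupI)
    fix x assume "x \<in> carrier (direct_sum I E)"
    then have f: "finite {i \<in> I. x i \<noteq> \<zero>\<^bsub>E i\<^esub>}" and ex: "x \<in> extensional I"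
      and x: "\<And>i. i \<in> I \<Longrightarrow> x i \<in> carrier (E i)"
      by (auto simp: direct_sum_def PiE_def)
    have neg: "(\<ominus>\<^bsub>R\<^esub> \<one>\<^bsub>R\<^esub> \<odot>\<^bsub>E i\<^esub> x i) \<oplus>\<^bsub>E i\<^esub> x i = \<zero>\<^bsub>E i\<^esub>" if "i \<in> I" for i
      using x[OF that] by (simp add: module.smult_l_minus[OF M] module.smult_one[OF M]
          abelian_group.l_neg[OF *] that)
    show "\<exists>y\<in>carrier (direct_sum I E). y \<oplus>\<^bsub>direct_sum I E\<^esub> x = \<zero>\<^bsub>direct_sum I E\<^esub>"
      by (rule bexI[of _ "\<lambda>i\<in>I. \<ominus>\<^bsub>R\<^esub> \<one>\<^bsub>R\<^esub> \<odot>\<^bsub>E i\<^esub> x i"])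
        (auto simp: direct_sum_def x fin1[OF f] sm neg cong: conj_cong intro!: restrict_ext)
    show "\<one>\<^bsub>R\<^esub> \<odot>\<^bsub>direct_sum I E\<^esub> x = x"
      using ex by (intro ext) (auto simp: direct_sum_def x module.smult_one[OF M] extensional_def)
    show "\<zero>\<^bsub>direct_sum I E\<^esub> \<oplus>\<^bsub>direct_sum I E\<^esub> x = x"
      using ex by (intro ext)
        (auto simp: direct_sum_def x abelian_monoid.l_zero[OF am] extensional_def)
  qed (auto simp: direct_sum_def PiE_iff fin2 fin1 abelian_monoid.zero_closed[OF am]
      abelian_monoid.a_closed[OF am] sm
      abelian_monoid.a_assoc[OF am] abelian_monoid.a_comm[OF am]
      abelian_monoid.a_lcomm[OF am] module.smult_l_distr[OF M]
      module.smult_r_distr[OF M] module.smult_assoc1[OF M]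
      cong: conj_cong intro!: restrict_ext)
qed

text \<open>Bass: a homomorphism from a finitely generated ideal to a direct sum takes its values in the
  sum of finitely many summands, so the values at \<open>1\<close> of the componentwise extensions
  can be cut off outside a finite set.\<close>

lemma injective_direct_sum:
  fixes R :: "('r,'s) ring_scheme" and E :: "'i \<Rightarrow> ('r,'e,'x) module_scheme"
  assumes "cring R" "noetherian_ring R" and inj: "\<And>i. i \<in> I \<Longrightarrow> injective_module R (E i)"
  shows "injective_module R (direct_sum I E)"
proof -
  interpret R: cring R by fact
  have mod: "module R (E i)" if "i \<in> I" for i
    using inj[OF that] by (simp add: injective_module_def)
  let ?J = "direct_sum I E" and ?S = "self_module R"
  have S: "module R ?S" by (rule self_module_module) fact
  have mJ: "module R ?J" by (rule module_direct_sum[OF assms(1) mod])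
  show ?thesis
  proof (rule Baer_criterion[OF mJ])
    fix K \<phi> assume K: "ideal K R" and \<phi>: "\<phi> \<in> mod_hom R (?S\<lparr>carrier := K\<rparr>) ?J"
    interpret K: ideal K R by fact
    let ?K = "?S\<lparr>carrier := K\<rparr>"
    have subK: "submodule K R ?S" using K by (simp add: submodule_self_module_iff[OF assms(1)])
    have mK: "module R ?K" by (rule module_restrict_carrier[OF S subK])
    have comp: "(\<lambda>r. \<phi> r i) \<in> mod_hom R ?K (E i)" if "i \<in> I" for i
      using mod_homD[OF \<phi>] that
      by (intro mod_homI) (auto simp: direct_sum_def PiE_mem)
    obtain A where A: "A \<subseteq> carrier R" "finite A" "K = Idl\<^bsub>R\<^esub> A"
      using noetherian_ring.finetely_gen[OF assms(2) K] by blast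
    have AK: "A \<subseteq> K" using A R.genideal_self by blast
    (* The supports of the values at the generators; every value of \<phi> is supported in T. *)
    define T where "T = (\<Union>a\<in>A. {i \<in> I. \<phi> a i \<noteq> \<zero>\<^bsub>E i\<^esub>})"
    have T: "finite T"
      unfolding T_def using A(2) AK mod_homD(1)[OF \<phi>] by (auto simp: direct_sum_def)
    have off: "\<phi> r i = \<zero>\<^bsub>E i\<^esub>" if i: "i \<in> I" "i \<notin> T" and r: "r \<in> K" for i r
    proof -
      interpret Ei: module R "E i" by (rule mod[OF i(1)])
      let ?Z = "{r \<in> K. \<phi> r i = \<zero>\<^bsub>E i\<^esub>}"
      note c = mod_homD[OF comp[OF i(1)]]
      have sm: "s \<otimes>\<^bsub>R\<^esub> x \<in> ?Z" if "s \<in> carrier R" "x \<in> ?Z" for s x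
        using c(3)[of s x] that K.I_l_closed by (simp add: self_module_def)
      have "submodule ?Z R ?S"
      proof (rule submoduleI_smult[OF S])
        show "?Z \<subseteq> carrier ?S" by (auto simp: self_module_def)
        show "\<zero>\<^bsub>?S\<^esub> \<in> ?Z"
          using mod_hom_zero[OF mK mod[OF i(1)] comp[OF i(1)]] by (auto simp: self_module_def)
        show "x \<oplus>\<^bsub>?S\<^esub> y \<in> ?Z" if "x \<in> ?Z" "y \<in> ?Z" for x y
          using c(2)[of x y] that by (simp add: self_module_def)
        show "s \<odot>\<^bsub>?S\<^esub> x \<in> ?Z" if "s \<in> carrier R" "x \<in> ?Z" for s x
          using sm[OF that] by (simp add: self_module_def)
      qed
      then have "ideal ?Z R" by (simp add: submodule_self_module_iff[OF assms(1)])
      moreover have "A \<subseteq> ?Z" using AK i by (auto simp: T_def)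
      ultimately have "K \<subseteq> ?Z" unfolding A(3) by (rule R.genideal_minimal)
      then show ?thesis using r by blast
    qed
    have "\<exists>e\<in>carrier (E i). \<forall>r\<in>K. \<phi> r i = r \<odot>\<^bsub>E i\<^esub> e" if i: "i \<in> I" for i
    proof -
      have "\<exists>h\<in>mod_hom R ?S (E i). \<forall>r\<in>carrier ?K. h r = \<phi> r i"
        by (rule injective_module_extend[OF inj[OF i] mK S _ _ comp[OF i]])
          (auto intro!: mod_homI simp: self_module_def)
      then obtain h where h: "h \<in> mod_hom R ?S (E i)" "\<And>r. r \<in> K \<Longrightarrow> h r = \<phi> r i" by auto
      have "\<phi> r i = r \<odot>\<^bsub>E i\<^esub> h \<one>\<^bsub>R\<^esub>" if "r \<in> K" for r
        using mod_homD(3)[OF h(1), of r "\<one>\<^bsub>R\<^esub>"] h(2)[OF that] that by (simp add: self_module_def)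
      moreover have "h \<one>\<^bsub>R\<^esub> \<in> carrier (E i)"
        using mod_homD(1)[OF h(1)] by (simp add: self_module_def)
      ultimately show ?thesis by blast
    qed
    then obtain e where e: "\<And>i. i \<in> I \<Longrightarrow> e i \<in> carrier (E i)"
      "\<And>i r. i \<in> I \<Longrightarrow> r \<in> K \<Longrightarrow> \<phi> r i = r \<odot>\<^bsub>E i\<^esub> e i" by metis
    define e' where "e' = (\<lambda>i\<in>I. if i \<in> T then e i else \<zero>\<^bsub>E i\<^esub>)"
    have z: "\<zero>\<^bsub>E i\<^esub> \<in> carrier (E i)" if "i \<in> I" for i
      using module.axioms(2)[OF mod[OF that]]
      by (simp add: abelian_group.axioms(1) abelian_monoid.zero_closed)
    have "finite {i \<in> I. e' i \<noteq> \<zero>\<^bsub>E i\<^esub>}"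
      by (rule finite_subset[OF _ T]) (auto simp: e'_def)
    then have "e' \<in> carrier ?J"
      using e(1) z by (auto simp: direct_sum_def e'_def)
    moreover have "\<phi> r = r \<odot>\<^bsub>?J\<^esub> e'" if r: "r \<in> K" for r
    proof
      fix i
      have "\<phi> r \<in> carrier ?J" using mod_homD(1)[OF \<phi>] r by simp
      then have "\<phi> r i = undefined" if "i \<notin> I"
        using that by (auto simp: direct_sum_def)
      then show "\<phi> r i = (r \<odot>\<^bsub>?J\<^esub> e') i"
        using e(2)[OF _ r] off[OF _ _ r] module.smult_r_null[OF mod] r
        by (auto simp: direct_sum_def e'_def)
    qed
    ultimately show "\<exists>e\<in>carrier ?J. \<forall>r\<in>K. \<phi> r = r \<odot>\<^bsub>?J\<^esub> e" by blast
  qed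
qed

text \<open>The cyclic submodule of \<open>X/B\<close> generated by the class of \<open>z\<close> maps onto \<open>Q/\<mm>\<close> by sending that class
  to \<open>1\<close>, which is possible because \<open>\<mm>\<close> contains its annihilator; injectivity of \<open>F\<close> extends the map to
  \<open>X/B\<close>. The image of \<open>z\<close> in \<open>F\<close> then has an annihilator inside \<open>\<mm>\<close>. The annihilator is recorded rather than
  the mere non-vanishing, because it tells at which prime the functional survives.\<close>

lemma injective_envelope_separates:
  fixes Q :: "('q,'s) ring_scheme" and X :: "('q,'m,'x) module_scheme"
  assumes "cring Q" "ideal \<mm> Q"
    and F: "injective_envelope Q (quot_module (self_module Q) \<mm>) F"
    and X: "module Q X" and B: "submodule B Q X" and z: "z \<in> carrier X"
    and ann: "\<And>r. \<lbrakk>r \<in> carrier Q; r \<odot>\<^bsub>X\<^esub> z \<in> B\<rbrakk> \<Longrightarrow> r \<in> \<mm>"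
  shows "\<exists>\<phi>\<in>mod_hom Q X F. (\<forall>b\<in>B. \<phi> b = \<zero>\<^bsub>F\<^esub>) \<and>
    (\<forall>r\<in>carrier Q. r \<odot>\<^bsub>F\<^esub> \<phi> z = \<zero>\<^bsub>F\<^esub> \<longrightarrow> r \<in> \<mm>)"
proof -
  interpret Q: cring Q by fact
  interpret X: module Q X by fact
  let ?S = "self_module Q"
  let ?k = "quot_module ?S \<mm>" and ?XB = "quot_module X B"
  have S: "module Q ?S" by (rule self_module_module) fact
  have sub: "submodule \<mm> Q ?S" using assms(2) by (simp add: submodule_self_module_iff[OF assms(1)])
  from F obtain \<iota> where inj: "injective_module Q F" and \<iota>: "\<iota> \<in> mod_hom Q ?k F" "inj_on \<iota> (carrier ?k)"
    by (auto simp: injective_envelope_def)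
  have mF: "module Q F" using inj by (simp add: injective_module_def)
  have mk: "module Q ?k" and mXB: "module Q ?XB"
    by (rule module_quot_module[OF S sub], rule module_quot_module[OF X B])
  note pk = quot_projection_hom[OF S sub] and pX = quot_projection_hom[OF X B]
  have rz: "(\<lambda>r. r \<odot>\<^bsub>X\<^esub> z) \<in> mod_hom Q ?S X"
    by (rule mod_homI) (auto simp: self_module_def z X.smult_l_distr X.smult_assoc1)
  have "\<exists>h\<in>mod_hom Q ?XB F. \<forall>r\<in>carrier ?S. h (B +>\<^bsub>X\<^esub> (r \<odot>\<^bsub>X\<^esub> z)) = \<iota> (\<mm> +>\<^bsub>?S\<^esub> r)"
  proof (rule injective_module_factor[OF inj S mXB mod_hom_comp[OF rz pX] mod_hom_comp[OF pk \<iota>(1)]])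
    fix r assume r: "r \<in> carrier ?S" "B +>\<^bsub>X\<^esub> (r \<odot>\<^bsub>X\<^esub> z) = \<zero>\<^bsub>?XB\<^esub>"
    then have rQ: "r \<in> carrier Q" by (simp add: self_module_def)
    then have "r \<odot>\<^bsub>X\<^esub> z \<in> B" using quot_projection_zero_iff[OF X B] r(2) z by simp
    then have "r \<in> \<mm>" using ann rQ by blast
    then have "\<mm> +>\<^bsub>?S\<^esub> r = \<zero>\<^bsub>?k\<^esub>" using quot_projection_zero_iff[OF S sub r(1)] by simp
    then show "\<iota> (\<mm> +>\<^bsub>?S\<^esub> r) = \<zero>\<^bsub>F\<^esub>" using mod_hom_zero[OF mk mF \<iota>(1)] by simp
  qed
  then obtain h where h: "h \<in> mod_hom Q ?XB F"
    "\<And>r. r \<in> carrier Q \<Longrightarrow> h (B +>\<^bsub>X\<^esub> (r \<odot>\<^bsub>X\<^esub> z)) = \<iota> (\<mm> +>\<^bsub>?S\<^esub> r)"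
    by (auto simp: self_module_def)
  show ?thesis
  proof (intro bexI conjI ballI impI)
    show hom: "(\<lambda>x. h (B +>\<^bsub>X\<^esub> x)) \<in> mod_hom Q X F" by (rule mod_hom_comp[OF pX h(1)])
    show "h (B +>\<^bsub>X\<^esub> b) = \<zero>\<^bsub>F\<^esub>" if "b \<in> B" for b
      using quot_projection_zero_iff[OF X B, of b] that X.submoduleE(1)[OF B]
        mod_hom_zero[OF mXB mF h(1)] by auto
    show "r \<in> \<mm>" if r: "r \<in> carrier Q" and z0: "r \<odot>\<^bsub>F\<^esub> h (B +>\<^bsub>X\<^esub> z) = \<zero>\<^bsub>F\<^esub>" for r
    proof -
      have rS: "r \<in> carrier ?S" using r by (simp add: self_module_def)
      have "\<iota> (\<mm> +>\<^bsub>?S\<^esub> r) = \<iota> \<zero>\<^bsub>?k\<^esub>"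
        using h(2)[OF r] mod_homD(3)[OF hom r z] z0 mod_hom_zero[OF mk mF \<iota>(1)] by simp
      moreover have "\<zero>\<^bsub>?k\<^esub> \<in> carrier ?k"
        using module.axioms(2)[OF mk] by (simp add: abelian_group.axioms(1) abelian_monoid.zero_closed)
      ultimately have "\<mm> +>\<^bsub>?S\<^esub> r = \<zero>\<^bsub>?k\<^esub>"
        using inj_onD[OF \<iota>(2)] mod_homD(1)[OF pk rS] by blast
      then show ?thesis using quot_projection_zero_iff[OF S sub rS] by simp
    qed
  qed
qed

lemma direct_sum_inclusion:
  assumes "\<And>j. j \<in> I \<Longrightarrow> module R (E j)" "i \<in> I"
  shows "(\<lambda>e. \<lambda>j\<in>I. if j = i then e else \<zero>\<^bsub>E j\<^esub>) \<in> mod_hom R (E i) (direct_sum I E)"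
proof (rule mod_homI)
  have ag: "abelian_group (E j)" if "j \<in> I" for j
    using assms(1)[OF that] by (simp add: module_def)
  note am = abelian_group.axioms(1)[OF ag]
  show "(\<lambda>j\<in>I. if j = i then e else \<zero>\<^bsub>E j\<^esub>) \<in> carrier (direct_sum I E)" if "e \<in> carrier (E i)" for e
  proof -
    have "finite {j \<in> I. (\<lambda>j\<in>I. if j = i then e else \<zero>\<^bsub>E j\<^esub>) j \<noteq> \<zero>\<^bsub>E j\<^esub>}"
      by (rule finite_subset[of _ "{i}"]) auto
    then show ?thesis
      using that abelian_monoid.zero_closed[OF am] by (auto simp: direct_sum_def)
  qed
  show "(\<lambda>j\<in>I. if j = i then x \<oplus>\<^bsub>E i\<^esub> y else \<zero>\<^bsub>E j\<^esub>)
    = (\<lambda>j\<in>I. if j = i then x else \<zero>\<^bsub>E j\<^esub>) \<oplus>\<^bsub>direct_sum I E\<^esub> (\<lambda>j\<in>I. if j = i then y else \<zero>\<^bsub>E j\<^esub>)" for x y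
    by (auto simp: direct_sum_def abelian_monoid.l_zero[OF am] abelian_monoid.zero_closed[OF am])
  show "(\<lambda>j\<in>I. if j = i then r \<odot>\<^bsub>E i\<^esub> x else \<zero>\<^bsub>E j\<^esub>)
    = r \<odot>\<^bsub>direct_sum I E\<^esub> (\<lambda>j\<in>I. if j = i then x else \<zero>\<^bsub>E j\<^esub>)" if "r \<in> carrier R" for r x
    by (auto simp: direct_sum_def module.smult_r_null[OF assms(1) that])
qed

section \<open>Localization\<close>

text \<open>The operations on fractions are unions over all representatives. When all representatives give
  the same value, the union is that value.\<close>

lemma UN_pair_const:
  assumes "(x, s) \<in> U" "\<And>x' s'. (x', s') \<in> U \<Longrightarrow> F x' s' = C"
  shows "(\<Union>(x', s')\<in>U. F x' s') = C"
proof (rule SUP_eq_const)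
  show "U \<noteq> {}" using assms(1) by blast
  show "(case p of (x', s') \<Rightarrow> F x' s') = C" if "p \<in> U" for p
    using assms(2) that by (cases p) simp
qed

locale localizable_module = module +
  fixes S
  assumes S_carrier: "S \<subseteq> carrier R" and S_one [simp]: "\<one>\<^bsub>R\<^esub> \<in> S"
    and S_mult [simp]: "\<lbrakk>s \<in> S; t \<in> S\<rbrakk> \<Longrightarrow> s \<otimes>\<^bsub>R\<^esub> t \<in> S"
begin

abbreviation "mfraction \<equiv> fraction R S M"

abbreviation "rfraction \<equiv> fraction R S (self_module R)"

lemma S_closed [simp]: "s \<in> S \<Longrightarrow> s \<in> carrier R"
  using S_carrier by (rule subsetD)

lemma smult_scale:
  "\<lbrakk>a \<odot>\<^bsub>M\<^esub> x = b \<odot>\<^bsub>M\<^esub> y; a \<in> carrier R; b \<in> carrier R; c \<in> carrier R; x \<in> carrier M; y \<in> carrier M\<rbrakk>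
    \<Longrightarrow> (c \<otimes>\<^bsub>R\<^esub> a) \<odot>\<^bsub>M\<^esub> x = (c \<otimes>\<^bsub>R\<^esub> b) \<odot>\<^bsub>M\<^esub> y"
  by (simp only: smult_assoc1)

lemma mem_fraction_iff:
  assumes "x \<in> carrier M" "s \<in> S"
  shows "(y, t) \<in> mfraction x s \<longleftrightarrow>
    y \<in> carrier M \<and> t \<in> S \<and> (\<exists>u\<in>S. (u \<otimes>\<^bsub>R\<^esub> t) \<odot>\<^bsub>M\<^esub> x = (u \<otimes>\<^bsub>R\<^esub> s) \<odot>\<^bsub>M\<^esub> y)"
  unfolding fraction_def using assms by (auto simp: smult_assoc1)

lemma self_mem_fraction: "\<lbrakk>x \<in> carrier M; s \<in> S\<rbrakk> \<Longrightarrow> (x, s) \<in> mfraction x s"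
  using S_one by (auto simp: mem_fraction_iff)

text \<open>Transitivity of equality of fractions: the multiplier of \<open>x/s = z/w\<close> has to contain the
  denominator \<open>t\<close> of the intermediate fraction \<open>y/t\<close>.\<close>

lemma fraction_trans:
  assumes "x \<in> carrier M" "y \<in> carrier M" "z \<in> carrier M" "s \<in> S" "t \<in> S" "w \<in> S" "u \<in> S" "v \<in> S"
    and xy: "(u \<otimes>\<^bsub>R\<^esub> t) \<odot>\<^bsub>M\<^esub> x = (u \<otimes>\<^bsub>R\<^esub> s) \<odot>\<^bsub>M\<^esub> y"
    and yz: "(v \<otimes>\<^bsub>R\<^esub> w) \<odot>\<^bsub>M\<^esub> y = (v \<otimes>\<^bsub>R\<^esub> t) \<odot>\<^bsub>M\<^esub> z"
  shows "((u \<otimes>\<^bsub>R\<^esub> (v \<otimes>\<^bsub>R\<^esub> t)) \<otimes>\<^bsub>R\<^esub> w) \<odot>\<^bsub>M\<^esub> x = ((u \<otimes>\<^bsub>R\<^esub> (v \<otimes>\<^bsub>R\<^esub> t)) \<otimes>\<^bsub>R\<^esub> s) \<odot>\<^bsub>M\<^esub> z"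
proof -
  have "((v \<otimes>\<^bsub>R\<^esub> w) \<otimes>\<^bsub>R\<^esub> (u \<otimes>\<^bsub>R\<^esub> t)) \<odot>\<^bsub>M\<^esub> x = ((v \<otimes>\<^bsub>R\<^esub> w) \<otimes>\<^bsub>R\<^esub> (u \<otimes>\<^bsub>R\<^esub> s)) \<odot>\<^bsub>M\<^esub> y"
    by (rule smult_scale[OF xy]) (use assms(1-8) in simp_all)
  also have "\<dots> = ((u \<otimes>\<^bsub>R\<^esub> s) \<otimes>\<^bsub>R\<^esub> (v \<otimes>\<^bsub>R\<^esub> w)) \<odot>\<^bsub>M\<^esub> y"
    using assms(1-8) by (simp add: R.m_ac)
  also have "\<dots> = ((u \<otimes>\<^bsub>R\<^esub> s) \<otimes>\<^bsub>R\<^esub> (v \<otimes>\<^bsub>R\<^esub> t)) \<odot>\<^bsub>M\<^esub> z"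
    by (rule smult_scale[OF yz]) (use assms(1-8) in simp_all)
  finally show ?thesis using assms(1-8) by (simp add: R.m_ac)
qed

lemma fraction_eqI:
  assumes "x \<in> carrier M" "y \<in> carrier M" "s \<in> S" "t \<in> S" "u \<in> S"
    and eq: "(u \<otimes>\<^bsub>R\<^esub> t) \<odot>\<^bsub>M\<^esub> x = (u \<otimes>\<^bsub>R\<^esub> s) \<odot>\<^bsub>M\<^esub> y"
  shows "mfraction x s = mfraction y t"
proof -
  have "mfraction x s \<subseteq> mfraction y t"
    if *: "x \<in> carrier M" "y \<in> carrier M" "s \<in> S" "t \<in> S" "(u \<otimes>\<^bsub>R\<^esub> t) \<odot>\<^bsub>M\<^esub> x = (u \<otimes>\<^bsub>R\<^esub> s) \<odot>\<^bsub>M\<^esub> y" for x y s t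
  proof (rule subrelI)
    fix z w assume "(z, w) \<in> mfraction x s"
    then obtain v where v: "z \<in> carrier M" "w \<in> S" "v \<in> S"
      "(v \<otimes>\<^bsub>R\<^esub> w) \<odot>\<^bsub>M\<^esub> x = (v \<otimes>\<^bsub>R\<^esub> s) \<odot>\<^bsub>M\<^esub> z"
      using * by (auto simp: mem_fraction_iff)
    have "((u \<otimes>\<^bsub>R\<^esub> (v \<otimes>\<^bsub>R\<^esub> s)) \<otimes>\<^bsub>R\<^esub> w) \<odot>\<^bsub>M\<^esub> y = ((u \<otimes>\<^bsub>R\<^esub> (v \<otimes>\<^bsub>R\<^esub> s)) \<otimes>\<^bsub>R\<^esub> t) \<odot>\<^bsub>M\<^esub> z"
      by (rule fraction_trans[OF _ _ _ _ _ _ _ _ *(5)[symmetric] v(4)]) (use * v assms(5) in auto)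
    then show "(z, w) \<in> mfraction y t"
      using * v assms(5) by (auto simp: mem_fraction_iff intro!: bexI[of _ "u \<otimes>\<^bsub>R\<^esub> (v \<otimes>\<^bsub>R\<^esub> s)"])
  qed
  from this[of x y s t] this[of y x t s] assms show ?thesis by simp
qed

lemma fraction_eqD:
  assumes "x \<in> carrier M" "y \<in> carrier M" "s \<in> S" "t \<in> S" "mfraction x s = mfraction y t"
  shows "\<exists>u\<in>S. (u \<otimes>\<^bsub>R\<^esub> t) \<odot>\<^bsub>M\<^esub> x = (u \<otimes>\<^bsub>R\<^esub> s) \<odot>\<^bsub>M\<^esub> y"
  using self_mem_fraction[OF assms(2,4)] mem_fraction_iff[OF assms(1,3), of y t]
  unfolding assms(5) by blast

lemma fraction_cancel:
  "\<lbrakk>x \<in> carrier M; s \<in> S; c \<in> S\<rbrakk> \<Longrightarrow> mfraction (c \<odot>\<^bsub>M\<^esub> x) (c \<otimes>\<^bsub>R\<^esub> s) = mfraction x s"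
  by (rule fraction_eqI[of _ _ _ _ "\<one>\<^bsub>R\<^esub>"]) (auto simp: R.m_ac simp flip: smult_assoc1)

lemma fraction_zero:
  "s \<in> S \<Longrightarrow> mfraction \<zero>\<^bsub>M\<^esub> s = mfraction \<zero>\<^bsub>M\<^esub> \<one>\<^bsub>R\<^esub>"
  by (rule fraction_eqI[of _ _ _ _ "\<one>\<^bsub>R\<^esub>"]) auto

text \<open>As \<open>R\<close> itself is an instance, every computation with fractions over a module also applies to the
  ring of fractions.\<close>

lemma self_localizable: "localizable_module R (self_module R) S"
  using self_module_module[OF R.is_cring] S_carrier
  by (simp add: localizable_module_def localizable_module_axioms_def)

lemma frac_add_fraction:
  assumes "x \<in> carrier M" "y \<in> carrier M" "s \<in> S" "t \<in> S"
  shows "frac_add R S M (mfraction x s) (mfraction y t) = mfraction (t \<odot>\<^bsub>M\<^esub> x \<oplus>\<^bsub>M\<^esub> s \<odot>\<^bsub>M\<^esub> y) (s \<otimes>\<^bsub>R\<^esub> t)"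
proof -
  have "mfraction (t' \<odot>\<^bsub>M\<^esub> x' \<oplus>\<^bsub>M\<^esub> s' \<odot>\<^bsub>M\<^esub> y') (s' \<otimes>\<^bsub>R\<^esub> t') = mfraction (t \<odot>\<^bsub>M\<^esub> x \<oplus>\<^bsub>M\<^esub> s \<odot>\<^bsub>M\<^esub> y) (s \<otimes>\<^bsub>R\<^esub> t)"
    if m: "(x', s') \<in> mfraction x s" "(y', t') \<in> mfraction y t" for x' s' y' t'
  proof -
    from m obtain u v where
      *: "x' \<in> carrier M" "s' \<in> S" "u \<in> S" "y' \<in> carrier M" "t' \<in> S" "v \<in> S"
      and u: "(u \<otimes>\<^bsub>R\<^esub> s') \<odot>\<^bsub>M\<^esub> x = (u \<otimes>\<^bsub>R\<^esub> s) \<odot>\<^bsub>M\<^esub> x'"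
      and v: "(v \<otimes>\<^bsub>R\<^esub> t') \<odot>\<^bsub>M\<^esub> y = (v \<otimes>\<^bsub>R\<^esub> t) \<odot>\<^bsub>M\<^esub> y'"
      using assms by (auto simp: mem_fraction_iff)
    have "(v \<otimes>\<^bsub>R\<^esub> t \<otimes>\<^bsub>R\<^esub> t' \<otimes>\<^bsub>R\<^esub> (u \<otimes>\<^bsub>R\<^esub> s')) \<odot>\<^bsub>M\<^esub> x = (v \<otimes>\<^bsub>R\<^esub> t \<otimes>\<^bsub>R\<^esub> t' \<otimes>\<^bsub>R\<^esub> (u \<otimes>\<^bsub>R\<^esub> s)) \<odot>\<^bsub>M\<^esub> x'"
      "(u \<otimes>\<^bsub>R\<^esub> s \<otimes>\<^bsub>R\<^esub> s' \<otimes>\<^bsub>R\<^esub> (v \<otimes>\<^bsub>R\<^esub> t')) \<odot>\<^bsub>M\<^esub> y = (u \<otimes>\<^bsub>R\<^esub> s \<otimes>\<^bsub>R\<^esub> s' \<otimes>\<^bsub>R\<^esub> (v \<otimes>\<^bsub>R\<^esub> t)) \<odot>\<^bsub>M\<^esub> y'"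
      using smult_scale[OF u] smult_scale[OF v] * assms by simp_all
    then show ?thesis
      using * assms
      by (intro fraction_eqI[of _ _ _ _ "u \<otimes>\<^bsub>R\<^esub> v"])
        (simp_all add: smult_r_distr R.m_ac flip: smult_assoc1)
  qed
  then show ?thesis
    unfolding frac_add_def
    by (intro UN_pair_const[OF self_mem_fraction[OF assms(1,3)]]
        UN_pair_const[OF self_mem_fraction[OF assms(2,4)]])
qed

lemma frac_smult_fraction:
  assumes "a \<in> carrier R" "x \<in> carrier M" "s \<in> S" "t \<in> S"
  shows "frac_smult R S M (rfraction a s) (mfraction x t) = mfraction (a \<odot>\<^bsub>M\<^esub> x) (s \<otimes>\<^bsub>R\<^esub> t)"
proof -
  interpret L: localizable_module R "self_module R" S by (rule self_localizable)
  have aS: "a \<in> carrier (self_module R)" using assms by (simp add: self_module_def)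
  have "mfraction (a' \<odot>\<^bsub>M\<^esub> x') (s' \<otimes>\<^bsub>R\<^esub> t') = mfraction (a \<odot>\<^bsub>M\<^esub> x) (s \<otimes>\<^bsub>R\<^esub> t)"
    if m: "(a', s') \<in> rfraction a s" "(x', t') \<in> mfraction x t" for a' s' x' t'
  proof -
    from m(2) obtain v where
      *: "x' \<in> carrier M" "t' \<in> S" "v \<in> S"
      and v: "(v \<otimes>\<^bsub>R\<^esub> t') \<odot>\<^bsub>M\<^esub> x = (v \<otimes>\<^bsub>R\<^esub> t) \<odot>\<^bsub>M\<^esub> x'"
      using assms by (auto simp: mem_fraction_iff)
    from m(1) obtain u where
      **: "a' \<in> carrier R" "s' \<in> S" "u \<in> S" and u: "u \<otimes>\<^bsub>R\<^esub> s' \<otimes>\<^bsub>R\<^esub> a = u \<otimes>\<^bsub>R\<^esub> s \<otimes>\<^bsub>R\<^esub> a'"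
      using L.mem_fraction_iff[OF aS assms(3)] by (auto simp: self_module_def)
    have "((u \<otimes>\<^bsub>R\<^esub> s \<otimes>\<^bsub>R\<^esub> a') \<otimes>\<^bsub>R\<^esub> (v \<otimes>\<^bsub>R\<^esub> t)) \<odot>\<^bsub>M\<^esub> x' = ((u \<otimes>\<^bsub>R\<^esub> s' \<otimes>\<^bsub>R\<^esub> a) \<otimes>\<^bsub>R\<^esub> (v \<otimes>\<^bsub>R\<^esub> t')) \<odot>\<^bsub>M\<^esub> x"
      using smult_scale[OF v, of "u \<otimes>\<^bsub>R\<^esub> s \<otimes>\<^bsub>R\<^esub> a'"] u * ** assms by simp
    then show ?thesis
      using * ** assms
      by (intro fraction_eqI[of _ _ _ _ "u \<otimes>\<^bsub>R\<^esub> v"])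
        (simp_all add: R.m_ac flip: smult_assoc1)
  qed
  then show ?thesis
    unfolding frac_smult_def
    by (intro UN_pair_const[OF L.self_mem_fraction[OF aS assms(3)]]
        UN_pair_const[OF self_mem_fraction[OF assms(2,4)]])
qed

lemma loc_module_simps:
  "\<zero>\<^bsub>loc_module R S M\<^esub> = mfraction \<zero>\<^bsub>M\<^esub> \<one>\<^bsub>R\<^esub>"
  "\<lbrakk>x \<in> carrier M; y \<in> carrier M; s \<in> S; t \<in> S\<rbrakk> \<Longrightarrow>
    mfraction x s \<oplus>\<^bsub>loc_module R S M\<^esub> mfraction y t = mfraction (t \<odot>\<^bsub>M\<^esub> x \<oplus>\<^bsub>M\<^esub> s \<odot>\<^bsub>M\<^esub> y) (s \<otimes>\<^bsub>R\<^esub> t)"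
  "\<lbrakk>a \<in> carrier R; x \<in> carrier M; s \<in> S; t \<in> S\<rbrakk> \<Longrightarrow>
    rfraction a s \<odot>\<^bsub>loc_module R S M\<^esub> mfraction x t = mfraction (a \<odot>\<^bsub>M\<^esub> x) (s \<otimes>\<^bsub>R\<^esub> t)"
  by (simp_all add: loc_module_def frac_add_fraction frac_smult_fraction)

lemma fraction_closed [simp]:
  "\<lbrakk>x \<in> carrier M; s \<in> S\<rbrakk> \<Longrightarrow> mfraction x s \<in> carrier (loc_module R S M)"
  by (auto simp: loc_module_def)

lemma loc_module_elem:
  assumes "U \<in> carrier (loc_module R S M)"
  obtains x s where "x \<in> carrier M" "s \<in> S" "U = mfraction x s"
  using assms by (auto simp: loc_module_def)

lemma fraction_same_denominator_add:
  "\<lbrakk>x \<in> carrier M; y \<in> carrier M; s \<in> S\<rbrakk> \<Longrightarrow>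
    mfraction x s \<oplus>\<^bsub>loc_module R S M\<^esub> mfraction y s = mfraction (x \<oplus>\<^bsub>M\<^esub> y) s"
  using fraction_cancel[of "x \<oplus>\<^bsub>M\<^esub> y" s s] by (simp add: loc_module_simps smult_r_distr)

lemma abelian_group_loc_module: "abelian_group (loc_module R S M)"
proof (rule abelian_groupI)
  fix U assume "U \<in> carrier (loc_module R S M)"
  then obtain x s where U: "x \<in> carrier M" "s \<in> S" "U = mfraction x s" by (rule loc_module_elem)
  then show "\<zero>\<^bsub>loc_module R S M\<^esub> \<oplus>\<^bsub>loc_module R S M\<^esub> U = U" by (simp add: loc_module_simps)
  show "\<exists>V\<in>carrier (loc_module R S M). V \<oplus>\<^bsub>loc_module R S M\<^esub> U = \<zero>\<^bsub>loc_module R S M\<^esub>"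
    using U by (intro bexI[of _ "mfraction (\<ominus>\<^bsub>M\<^esub> x) s"])
      (simp_all add: fraction_same_denominator_add fraction_zero[of s] M.l_neg loc_module_simps(1))
  fix V assume "V \<in> carrier (loc_module R S M)"
  then obtain y t where V: "y \<in> carrier M" "t \<in> S" "V = mfraction y t" by (rule loc_module_elem)
  show "U \<oplus>\<^bsub>loc_module R S M\<^esub> V \<in> carrier (loc_module R S M)"
    using U V by (simp add: loc_module_simps)
  show "U \<oplus>\<^bsub>loc_module R S M\<^esub> V = V \<oplus>\<^bsub>loc_module R S M\<^esub> U"
    using U V by (simp add: loc_module_simps M.a_comm R.m_comm)
  fix W assume "W \<in> carrier (loc_module R S M)"
  then obtain z u where W: "z \<in> carrier M" "u \<in> S" "W = mfraction z u" by (rule loc_module_elem)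
  show "U \<oplus>\<^bsub>loc_module R S M\<^esub> V \<oplus>\<^bsub>loc_module R S M\<^esub> W
      = U \<oplus>\<^bsub>loc_module R S M\<^esub> (V \<oplus>\<^bsub>loc_module R S M\<^esub> W)"
    using U V W
    by (simp add: loc_module_simps smult_r_distr M.a_ac R.m_ac flip: smult_assoc1)
qed (simp add: loc_module_simps)

lemma loc_ring_simps:
  "\<zero>\<^bsub>loc_ring R S\<^esub> = rfraction \<zero>\<^bsub>R\<^esub> \<one>\<^bsub>R\<^esub>" "\<one>\<^bsub>loc_ring R S\<^esub> = rfraction \<one>\<^bsub>R\<^esub> \<one>\<^bsub>R\<^esub>"
  "\<lbrakk>a \<in> carrier R; b \<in> carrier R; s \<in> S; t \<in> S\<rbrakk> \<Longrightarrow>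
    rfraction a s \<oplus>\<^bsub>loc_ring R S\<^esub> rfraction b t = rfraction (t \<otimes>\<^bsub>R\<^esub> a \<oplus>\<^bsub>R\<^esub> s \<otimes>\<^bsub>R\<^esub> b) (s \<otimes>\<^bsub>R\<^esub> t)"
  "\<lbrakk>a \<in> carrier R; b \<in> carrier R; s \<in> S; t \<in> S\<rbrakk> \<Longrightarrow>
    rfraction a s \<otimes>\<^bsub>loc_ring R S\<^esub> rfraction b t = rfraction (a \<otimes>\<^bsub>R\<^esub> b) (s \<otimes>\<^bsub>R\<^esub> t)"
  "\<lbrakk>a \<in> carrier R; s \<in> S\<rbrakk> \<Longrightarrow> rfraction a s \<in> carrier (loc_ring R S)"
proof -
  interpret L: localizable_module R "self_module R" S by (rule self_localizable)
  show "\<zero>\<^bsub>loc_ring R S\<^esub> = rfraction \<zero>\<^bsub>R\<^esub> \<one>\<^bsub>R\<^esub>" "\<one>\<^bsub>loc_ring R S\<^esub> = rfraction \<one>\<^bsub>R\<^esub> \<one>\<^bsub>R\<^esub>"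
    by (simp_all add: loc_ring_def)
  show "\<lbrakk>a \<in> carrier R; b \<in> carrier R; s \<in> S; t \<in> S\<rbrakk> \<Longrightarrow>
    rfraction a s \<oplus>\<^bsub>loc_ring R S\<^esub> rfraction b t = rfraction (t \<otimes>\<^bsub>R\<^esub> a \<oplus>\<^bsub>R\<^esub> s \<otimes>\<^bsub>R\<^esub> b) (s \<otimes>\<^bsub>R\<^esub> t)"
    using L.frac_add_fraction[of a b s t] by (simp add: loc_ring_def self_module_def)
  show "\<lbrakk>a \<in> carrier R; b \<in> carrier R; s \<in> S; t \<in> S\<rbrakk> \<Longrightarrow>
    rfraction a s \<otimes>\<^bsub>loc_ring R S\<^esub> rfraction b t = rfraction (a \<otimes>\<^bsub>R\<^esub> b) (s \<otimes>\<^bsub>R\<^esub> t)"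
    using L.frac_smult_fraction[of a b s t] by (simp add: loc_ring_def self_module_def)
  show "\<lbrakk>a \<in> carrier R; s \<in> S\<rbrakk> \<Longrightarrow> rfraction a s \<in> carrier (loc_ring R S)"
    by (auto simp: loc_ring_def)
qed

lemma loc_ring_elem:
  assumes "A \<in> carrier (loc_ring R S)"
  obtains a s where "a \<in> carrier R" "s \<in> S" "A = rfraction a s"
  using assms by (auto simp: loc_ring_def)

text \<open>For the distributive laws the two sides have different denominators, which differ by a factor
  in \<open>S\<close> that \<open>fraction_cancel\<close> removes; the other laws hold for numerators and denominators separately.\<close>

lemma loc_smult_laws:
  shows loc_smult_closed: "\<lbrakk>A \<in> carrier (loc_ring R S); U \<in> carrier (loc_module R S M)\<rbrakk>
      \<Longrightarrow> A \<odot>\<^bsub>loc_module R S M\<^esub> U \<in> carrier (loc_module R S M)"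
    and loc_smult_one: "U \<in> carrier (loc_module R S M) \<Longrightarrow> \<one>\<^bsub>loc_ring R S\<^esub> \<odot>\<^bsub>loc_module R S M\<^esub> U = U"
    and loc_smult_assoc: "\<lbrakk>A \<in> carrier (loc_ring R S); B \<in> carrier (loc_ring R S);
        U \<in> carrier (loc_module R S M)\<rbrakk>
      \<Longrightarrow> (A \<otimes>\<^bsub>loc_ring R S\<^esub> B) \<odot>\<^bsub>loc_module R S M\<^esub> U
        = A \<odot>\<^bsub>loc_module R S M\<^esub> (B \<odot>\<^bsub>loc_module R S M\<^esub> U)"
    and loc_smult_l_distr: "\<lbrakk>A \<in> carrier (loc_ring R S); B \<in> carrier (loc_ring R S);
        U \<in> carrier (loc_module R S M)\<rbrakk>
      \<Longrightarrow> (A \<oplus>\<^bsub>loc_ring R S\<^esub> B) \<odot>\<^bsub>loc_module R S M\<^esub> U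
        = A \<odot>\<^bsub>loc_module R S M\<^esub> U \<oplus>\<^bsub>loc_module R S M\<^esub> B \<odot>\<^bsub>loc_module R S M\<^esub> U"
    and loc_smult_r_distr: "\<lbrakk>A \<in> carrier (loc_ring R S); U \<in> carrier (loc_module R S M);
        V \<in> carrier (loc_module R S M)\<rbrakk>
      \<Longrightarrow> A \<odot>\<^bsub>loc_module R S M\<^esub> (U \<oplus>\<^bsub>loc_module R S M\<^esub> V)
        = A \<odot>\<^bsub>loc_module R S M\<^esub> U \<oplus>\<^bsub>loc_module R S M\<^esub> A \<odot>\<^bsub>loc_module R S M\<^esub> V"
proof -
  note simps = loc_ring_simps loc_module_simps
  show "A \<odot>\<^bsub>loc_module R S M\<^esub> U \<in> carrier (loc_module R S M)"
    if "A \<in> carrier (loc_ring R S)" "U \<in> carrier (loc_module R S M)"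
    using that by (auto elim!: loc_ring_elem loc_module_elem simp: simps)
  show "\<one>\<^bsub>loc_ring R S\<^esub> \<odot>\<^bsub>loc_module R S M\<^esub> U = U" if "U \<in> carrier (loc_module R S M)"
    using that by (elim loc_module_elem) (simp add: simps)
  show "(A \<otimes>\<^bsub>loc_ring R S\<^esub> B) \<odot>\<^bsub>loc_module R S M\<^esub> U
      = A \<odot>\<^bsub>loc_module R S M\<^esub> (B \<odot>\<^bsub>loc_module R S M\<^esub> U)"
    if "A \<in> carrier (loc_ring R S)" "B \<in> carrier (loc_ring R S)" "U \<in> carrier (loc_module R S M)"
    using that by (elim loc_ring_elem loc_module_elem) (simp add: simps R.m_assoc smult_assoc1)
  show "(A \<oplus>\<^bsub>loc_ring R S\<^esub> B) \<odot>\<^bsub>loc_module R S M\<^esub> U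
      = A \<odot>\<^bsub>loc_module R S M\<^esub> U \<oplus>\<^bsub>loc_module R S M\<^esub> B \<odot>\<^bsub>loc_module R S M\<^esub> U"
    if "A \<in> carrier (loc_ring R S)" "B \<in> carrier (loc_ring R S)" "U \<in> carrier (loc_module R S M)"
  proof -
    from that obtain a s b t x u where
      *: "a \<in> carrier R" "s \<in> S" "b \<in> carrier R" "t \<in> S" "x \<in> carrier M" "u \<in> S"
      and eq: "A = rfraction a s" "B = rfraction b t" "U = mfraction x u"
      by (metis loc_ring_elem loc_module_elem)
    then show ?thesis
      using fraction_cancel[of "(t \<otimes>\<^bsub>R\<^esub> a \<oplus>\<^bsub>R\<^esub> s \<otimes>\<^bsub>R\<^esub> b) \<odot>\<^bsub>M\<^esub> x" "s \<otimes>\<^bsub>R\<^esub> t \<otimes>\<^bsub>R\<^esub> u" u]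
      by (simp add: simps R.m_ac smult_l_distr smult_r_distr flip: smult_assoc1)
  qed
  show "A \<odot>\<^bsub>loc_module R S M\<^esub> (U \<oplus>\<^bsub>loc_module R S M\<^esub> V)
      = A \<odot>\<^bsub>loc_module R S M\<^esub> U \<oplus>\<^bsub>loc_module R S M\<^esub> A \<odot>\<^bsub>loc_module R S M\<^esub> V"
    if "A \<in> carrier (loc_ring R S)" "U \<in> carrier (loc_module R S M)" "V \<in> carrier (loc_module R S M)"
  proof -
    from that obtain a s x u y v where
      *: "a \<in> carrier R" "s \<in> S" "x \<in> carrier M" "u \<in> S" "y \<in> carrier M" "v \<in> S"
      and eq: "A = rfraction a s" "U = mfraction x u" "V = mfraction y v"
      by (metis loc_ring_elem loc_module_elem)
    then show ?thesis
      using fraction_cancel[of "a \<odot>\<^bsub>M\<^esub> (v \<odot>\<^bsub>M\<^esub> x \<oplus>\<^bsub>M\<^esub> u \<odot>\<^bsub>M\<^esub> y)" "s \<otimes>\<^bsub>R\<^esub> (u \<otimes>\<^bsub>R\<^esub> v)" s]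
      by (simp add: simps R.m_ac smult_r_distr flip: smult_assoc1)
  qed
qed

lemma cring_loc_ring: "cring (loc_ring R S)"
proof -
  interpret L: localizable_module R "self_module R" S by (rule self_localizable)
  have same: "carrier (loc_module R S (self_module R)) = carrier (loc_ring R S)"
    "smult (loc_module R S (self_module R)) = mult (loc_ring R S)"
    "add (loc_module R S (self_module R)) = add (loc_ring R S)"
    "zero (loc_module R S (self_module R)) = zero (loc_ring R S)"
    by (auto simp: loc_ring_def loc_module_def self_module_def)
  interpret A: abelian_group "loc_module R S (self_module R)" by (rule L.abelian_group_loc_module)
  have ab: "abelian_group (loc_ring R S)"
  proof (rule abelian_groupI)
    show "\<exists>B\<in>carrier (loc_ring R S). B \<oplus>\<^bsub>loc_ring R S\<^esub> A = \<zero>\<^bsub>loc_ring R S\<^esub>"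
      if "A \<in> carrier (loc_ring R S)" for A
      using A.l_neg[unfolded same, OF that] A.a_inv_closed[unfolded same, OF that] by (rule bexI)
  qed (fact A.a_closed[unfolded same] A.zero_closed[unfolded same] A.a_assoc[unfolded same]
      A.a_comm[unfolded same] A.l_zero[unfolded same])+
  have comm: "A \<otimes>\<^bsub>loc_ring R S\<^esub> B = B \<otimes>\<^bsub>loc_ring R S\<^esub> A"
    if "A \<in> carrier (loc_ring R S)" "B \<in> carrier (loc_ring R S)" for A B
    using that by (elim loc_ring_elem) (simp add: loc_ring_simps R.m_comm)
  have one: "\<one>\<^bsub>loc_ring R S\<^esub> \<in> carrier (loc_ring R S)"
    unfolding loc_ring_simps(2) by (simp add: loc_ring_simps(5))
  have "comm_monoid (loc_ring R S)"
    by (rule comm_monoidI) (fact one L.loc_smult_laws[unfolded same] comm)+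
  then show ?thesis
    by (rule cringI[OF ab]) (fact L.loc_smult_l_distr[unfolded same])
qed

lemma module_loc_module: "module (loc_ring R S) (loc_module R S M)"
  using cring_loc_ring abelian_group_loc_module
  by (rule moduleI)
    (fact loc_smult_closed, fact loc_smult_l_distr, fact loc_smult_r_distr, fact loc_smult_assoc,
      fact loc_smult_one)

end

lemma
  assumes "localizable_module R M S" "localizable_module R N S" and f: "f \<in> mod_hom R M N"
  shows loc_map_fraction: "\<lbrakk>x \<in> carrier M; s \<in> S\<rbrakk> \<Longrightarrow>
      loc_map R S N f (fraction R S M x s) = fraction R S N (f x) s"
    and loc_map_hom: "loc_map R S N f \<in> mod_hom (loc_ring R S) (loc_module R S M) (loc_module R S N)"
proof -
  interpret M: localizable_module R M S by fact
  interpret N: localizable_module R N S by fact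
  show fr: "loc_map R S N f (M.mfraction x s) = N.mfraction (f x) s" if *: "x \<in> carrier M" "s \<in> S" for x s
  proof -
    have "N.mfraction (f y) t = N.mfraction (f x) s" if "(y, t) \<in> M.mfraction x s" for y t
    proof -
      from that * obtain u where u: "y \<in> carrier M" "t \<in> S" "u \<in> S"
        "(u \<otimes>\<^bsub>R\<^esub> t) \<odot>\<^bsub>M\<^esub> x = (u \<otimes>\<^bsub>R\<^esub> s) \<odot>\<^bsub>M\<^esub> y"
        by (auto simp: M.mem_fraction_iff)
      then have "(u \<otimes>\<^bsub>R\<^esub> s) \<odot>\<^bsub>N\<^esub> f y = (u \<otimes>\<^bsub>R\<^esub> t) \<odot>\<^bsub>N\<^esub> f x"
        using * by (simp flip: mod_homD(3)[OF f])
      then show ?thesis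
        using u * mod_homD(1)[OF f] by (intro N.fraction_eqI[of _ _ _ _ u]) auto
    qed
    then show ?thesis
      unfolding loc_map_def by (intro UN_pair_const[OF M.self_mem_fraction[OF *]])
  qed
  show "loc_map R S N f \<in> mod_hom (loc_ring R S) (loc_module R S M) (loc_module R S N)"
  proof (rule mod_homI)
    note simps = fr M.loc_module_simps N.loc_module_simps mod_homD[OF f]
    fix U assume "U \<in> carrier (loc_module R S M)"
    then obtain x s where U: "x \<in> carrier M" "s \<in> S" "U = M.mfraction x s" by (rule M.loc_module_elem)
    then show "loc_map R S N f U \<in> carrier (loc_module R S N)" by (simp add: simps)
    show "loc_map R S N f (A \<odot>\<^bsub>loc_module R S M\<^esub> U) = A \<odot>\<^bsub>loc_module R S N\<^esub> loc_map R S N f U"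
      if "A \<in> carrier (loc_ring R S)" for A
      using that U by (elim M.loc_ring_elem) (simp add: simps)
    fix V assume "V \<in> carrier (loc_module R S M)"
    then obtain y t where "y \<in> carrier M" "t \<in> S" "V = M.mfraction y t" by (rule M.loc_module_elem)
    then show "loc_map R S N f (U \<oplus>\<^bsub>loc_module R S M\<^esub> V)
        = loc_map R S N f U \<oplus>\<^bsub>loc_module R S N\<^esub> loc_map R S N f V"
      using U by (simp add: simps)
  qed
qed

section \<open>Localization of complexes and the local ring at a prime\<close>

lemma chain_complexD:
  assumes "chain_complex R M"
  shows "module R (obj M i)" "diff M i \<in> mod_hom R (obj M i) (obj M (i - 1))"
    "x \<in> carrier (obj M i) \<Longrightarrow> diff M (i - 1) (diff M i x) = \<zero>\<^bsub>obj M (i - 1 - 1)\<^esub>"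
    "diff M (i + 1) \<in> mod_hom R (obj M (i + 1)) (obj M i)"
    "x \<in> carrier (obj M (i + 1)) \<Longrightarrow> diff M i (diff M (i + 1) x) = \<zero>\<^bsub>obj M (i - 1)\<^esub>"
proof -
  have *: "module R (obj M i)" "diff M i \<in> mod_hom R (obj M i) (obj M (i - 1))"
    "x \<in> carrier (obj M i) \<Longrightarrow> diff M (i - 1) (diff M i x) = \<zero>\<^bsub>obj M (i - 1 - 1)\<^esub>" for i :: int and x
    using assms by (auto simp: chain_complex_def)
  show "module R (obj M i)" "diff M i \<in> mod_hom R (obj M i) (obj M (i - 1))"
    "x \<in> carrier (obj M i) \<Longrightarrow> diff M (i - 1) (diff M i x) = \<zero>\<^bsub>obj M (i - 1 - 1)\<^esub>"
    by (rule *)+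
  show "diff M (i + 1) \<in> mod_hom R (obj M (i + 1)) (obj M i)"
    "x \<in> carrier (obj M (i + 1)) \<Longrightarrow> diff M i (diff M (i + 1) x) = \<zero>\<^bsub>obj M (i - 1)\<^esub>"
    using *(2,3)[where i = "i + 1"] by simp_all
qed

lemma
  assumes M: "chain_complex R M"
  shows cycles_submodule: "submodule (cycles M i) R (obj M i)"
    and boundaries_submodule: "submodule (boundaries M i) R (obj M i)"
    and boundaries_subset_cycles: "boundaries M i \<subseteq> cycles M i"
proof -
  show "submodule (cycles M i) R (obj M i)"
    unfolding cycles_def by (rule mod_hom_kernel_submodule) (rule chain_complexD[OF M])+
  show "submodule (boundaries M i) R (obj M i)"
    unfolding boundaries_def by (rule mod_hom_image_submodule) (rule chain_complexD[OF M])+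
  show "boundaries M i \<subseteq> cycles M i"
    using chain_complexD(5)[OF M] mod_homD(1)[OF chain_complexD(4)[OF M]]
    by (auto simp: cycles_def boundaries_def)
qed

text \<open>Localization is exact: a fraction is a cycle iff a multiple of its numerator by an element of
  \<open>S\<close> is a cycle, and likewise for boundaries.\<close>

lemma
  assumes X: "chain_complex R X" and S: "\<And>i. localizable_module R (obj X i) S"
  shows chain_complex_loc_cpx: "chain_complex (loc_ring R S) (loc_cpx R S X)"
    and loc_cpx_exact_iff: "cycles (loc_cpx R S X) i = boundaries (loc_cpx R S X) i \<longleftrightarrow>
      (\<forall>z\<in>cycles X i. \<exists>u\<in>S. u \<odot>\<^bsub>obj X i\<^esub> z \<in> boundaries X i)"
proof -
  note d = chain_complexD(2)[OF X] and dd = chain_complexD(3)[OF X] and d' = chain_complexD(4)[OF X]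
  have fr: "diff (loc_cpx R S X) i (fraction R S (obj X i) x s) = fraction R S (obj X (i - 1)) (diff X i x) s"
    if "x \<in> carrier (obj X i)" "s \<in> S" for i x s
    using loc_map_fraction[OF S S d that] by (simp add: loc_cpx_def)
  have zero: "\<zero>\<^bsub>obj (loc_cpx R S X) i\<^esub> = fraction R S (obj X i) \<zero>\<^bsub>obj X i\<^esub> \<one>\<^bsub>R\<^esub>" for i
    by (simp add: loc_cpx_def loc_module_def)
  have car: "carrier (obj (loc_cpx R S X) i) = {fraction R S (obj X i) x s | x s. x \<in> carrier (obj X i) \<and> s \<in> S}" for i
    by (simp add: loc_cpx_def loc_module_def)
  have ddfr: "diff (loc_cpx R S X) (i - 1) (diff (loc_cpx R S X) i U) = \<zero>\<^bsub>obj (loc_cpx R S X) (i - 1 - 1)\<^esub>"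
    if "U \<in> carrier (obj (loc_cpx R S X) i)" for i U
  proof -
    from that obtain x s where x: "x \<in> carrier (obj X i)" "s \<in> S" "U = fraction R S (obj X i) x s"
      by (auto simp: car)
    then show ?thesis
      using mod_homD(1)[OF d x(1)]
      by (simp add: fr dd zero localizable_module.fraction_zero[OF S])
  qed
  show "chain_complex (loc_ring R S) (loc_cpx R S X)"
    unfolding chain_complex_def
  proof (intro allI conjI ballI ddfr)
    show "module (loc_ring R S) (obj (loc_cpx R S X) i)" for i
      using localizable_module.module_loc_module[OF S] by (simp add: loc_cpx_def)
    show "diff (loc_cpx R S X) i \<in> mod_hom (loc_ring R S) (obj (loc_cpx R S X) i) (obj (loc_cpx R S X) (i - 1))" for i
      using loc_map_hom[OF S S d] by (simp add: loc_cpx_def)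
  qed
  interpret X: localizable_module R "obj X i" S by (rule S)
  interpret X1: localizable_module R "obj X (i - 1)" S by (rule S)
  interpret X2: localizable_module R "obj X (i + 1)" S by (rule S)
  have bd: "boundaries (loc_cpx R S X) i
      = {X.mfraction (diff X (i + 1) y) t | y t. y \<in> carrier (obj X (i + 1)) \<and> t \<in> S}"
    unfolding boundaries_def using fr[of _ "i + 1"] by (force simp: car)
  show "cycles (loc_cpx R S X) i = boundaries (loc_cpx R S X) i \<longleftrightarrow>
      (\<forall>z\<in>cycles X i. \<exists>u\<in>S. u \<odot>\<^bsub>obj X i\<^esub> z \<in> boundaries X i)" (is "?L \<longleftrightarrow> ?R")
  proof
    assume L: ?L
    show ?R
    proof
      fix z assume z: "z \<in> cycles X i"
      then have zc: "z \<in> carrier (obj X i)" "diff X i z = \<zero>\<^bsub>obj X (i - 1)\<^esub>" by (auto simp: cycles_def)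
      moreover have "X.mfraction z \<one>\<^bsub>R\<^esub> \<in> carrier (obj (loc_cpx R S X) i)"
        unfolding car using zc(1) X.S_one by blast
      ultimately have "X.mfraction z \<one>\<^bsub>R\<^esub> \<in> cycles (loc_cpx R S X) i"
        by (simp add: cycles_def fr zero)
      then obtain y t where y: "y \<in> carrier (obj X (i + 1))" "t \<in> S"
        "X.mfraction z \<one>\<^bsub>R\<^esub> = X.mfraction (diff X (i + 1) y) t"
        unfolding L bd by blast
      note dy = mod_homD[OF d']
      obtain u where u: "u \<in> S" "(u \<otimes>\<^bsub>R\<^esub> t) \<odot>\<^bsub>obj X i\<^esub> z = (u \<otimes>\<^bsub>R\<^esub> \<one>\<^bsub>R\<^esub>) \<odot>\<^bsub>obj X i\<^esub> diff X (i + 1) y"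
        using X.fraction_eqD[OF zc(1) dy(1)[OF y(1)] _ y(2,3)] by auto
      then have "(u \<otimes>\<^bsub>R\<^esub> t) \<odot>\<^bsub>obj X i\<^esub> z = diff X (i + 1) (u \<odot>\<^bsub>obj X (i + 1)\<^esub> y)"
        using y dy(3) by simp
      then have "(u \<otimes>\<^bsub>R\<^esub> t) \<odot>\<^bsub>obj X i\<^esub> z \<in> boundaries X i"
        using u y by (simp add: boundaries_def)
      then show "\<exists>u\<in>S. u \<odot>\<^bsub>obj X i\<^esub> z \<in> boundaries X i"
        using u y by (intro bexI[of _ "u \<otimes>\<^bsub>R\<^esub> t"]) simp_all
    qed
  next
    assume R: ?R
    have "U \<in> boundaries (loc_cpx R S X) i" if U: "U \<in> cycles (loc_cpx R S X) i" for U
    proof -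
      from U obtain x s where x: "x \<in> carrier (obj X i)" "s \<in> S" "U = X.mfraction x s"
        and "diff (loc_cpx R S X) i U = \<zero>\<^bsub>obj (loc_cpx R S X) (i - 1)\<^esub>"
        by (auto simp: cycles_def car)
      then have "X1.mfraction (diff X i x) s = X1.mfraction \<zero>\<^bsub>obj X (i - 1)\<^esub> \<one>\<^bsub>R\<^esub>"
        by (simp add: fr zero)
      then obtain u where u: "u \<in> S" "u \<odot>\<^bsub>obj X (i - 1)\<^esub> diff X i x = \<zero>\<^bsub>obj X (i - 1)\<^esub>"
        using X1.fraction_eqD[OF mod_homD(1)[OF d x(1)] _ x(2), of "\<zero>\<^bsub>obj X (i - 1)\<^esub>" "\<one>\<^bsub>R\<^esub>"] x(2)
        by auto
      then have "u \<odot>\<^bsub>obj X i\<^esub> x \<in> cycles X i"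
        using x by (simp add: cycles_def mod_homD(3)[OF d])
      with R obtain v where v: "v \<in> S" "v \<odot>\<^bsub>obj X i\<^esub> (u \<odot>\<^bsub>obj X i\<^esub> x) \<in> boundaries X i" by blast
      then obtain y where y: "y \<in> carrier (obj X (i + 1))" "(v \<otimes>\<^bsub>R\<^esub> u) \<odot>\<^bsub>obj X i\<^esub> x = diff X (i + 1) y"
        using u x by (auto simp: boundaries_def X.smult_assoc1)
      have "U = X.mfraction (diff X (i + 1) y) (v \<otimes>\<^bsub>R\<^esub> u \<otimes>\<^bsub>R\<^esub> s)"
        using X.fraction_cancel[OF x(1,2), of "v \<otimes>\<^bsub>R\<^esub> u"] u v x y by simp
      moreover have "v \<otimes>\<^bsub>R\<^esub> u \<otimes>\<^bsub>R\<^esub> s \<in> S" using u v x by simp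
      ultimately show ?thesis using y(1) unfolding bd by blast
    qed
    then show ?L
      using boundaries_subset_cycles[OF \<open>chain_complex (loc_ring R S) (loc_cpx R S X)\<close>] by blast
  qed
qed

definition loc_max_ideal :: "('r,'s) ring_scheme \<Rightarrow> 'r set \<Rightarrow> ('r \<times> 'r) set set"
  where "loc_max_ideal R \<pp> = Idl\<^bsub>localization_at R \<pp>\<^esub>
    ((\<lambda>a. fraction R (carrier R - \<pp>) (self_module R) a \<one>\<^bsub>R\<^esub>) ` \<pp>)"

lemma localizable_at_prime:
  assumes "primeideal \<pp> R" "module R M"
  shows "localizable_module R M (carrier R - \<pp>)"
proof (rule localizable_module.intro[OF assms(2)], rule localizable_module_axioms.intro)
  interpret p: primeideal \<pp> R by fact
  show "\<one>\<^bsub>R\<^esub> \<in> carrier R - \<pp>" using p.one_imp_carrier p.I_notcarr by auto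
  show "s \<otimes>\<^bsub>R\<^esub> t \<in> carrier R - \<pp>" if "s \<in> carrier R - \<pp>" "t \<in> carrier R - \<pp>" for s t
    using that p.I_prime by auto
qed blast

text \<open>\<open>R\<^sub>\<pp>\<close> is local: a fraction outside \<open>\<pp>R\<^sub>\<pp>\<close> has its numerator outside \<open>\<pp>\<close>, hence is invertible. The ideal
  generated by \<open>\<pp>\<close> is proper because the fractions with numerator in \<open>\<pp>\<close> already form an ideal, and \<open>1\<close> is
  not one of them.\<close>

lemma
  assumes p: "primeideal \<pp> R"
  shows ideal_loc_max_ideal: "ideal (loc_max_ideal R \<pp>) (localization_at R \<pp>)"
    and one_notin_loc_max_ideal: "\<one>\<^bsub>localization_at R \<pp>\<^esub> \<notin> loc_max_ideal R \<pp>"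
    and unit_outside_loc_max_ideal:
      "\<lbrakk>A \<in> carrier (localization_at R \<pp>); A \<notin> loc_max_ideal R \<pp>\<rbrakk> \<Longrightarrow>
        \<exists>B\<in>carrier (localization_at R \<pp>). B \<otimes>\<^bsub>localization_at R \<pp>\<^esub> A = \<one>\<^bsub>localization_at R \<pp>\<^esub>"
proof -
  interpret p: primeideal \<pp> R by fact
  let ?S = "carrier R - \<pp>" and ?Q = "localization_at R \<pp>" and ?fr = "fraction R (carrier R - \<pp>) (self_module R)"
  interpret L: localizable_module R "self_module R" ?S
    by (rule localizable_at_prime[OF p self_module_module[OF p.is_cring]])
  interpret Q: cring ?Q by (rule L.cring_loc_ring)
  have pR: "a \<in> carrier R" if "a \<in> \<pp>" for a using that p.a_subset by blast
  have gen: "(\<lambda>a. ?fr a \<one>\<^bsub>R\<^esub>) ` \<pp> \<subseteq> carrier ?Q"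
    using L.loc_ring_simps(5) L.S_one pR by blast
  show I: "ideal (loc_max_ideal R \<pp>) ?Q"
    unfolding loc_max_ideal_def by (rule Q.genideal_ideal[OF gen])
  let ?K = "{?fr a s | a s. a \<in> \<pp> \<and> s \<in> ?S}"
  have KI: "?fr a s \<in> ?K" if "a \<in> \<pp>" "s \<in> ?S" for a s using that by blast
  have "submodule ?K ?Q (self_module ?Q)"
  proof (rule submoduleI_smult[OF self_module_module[OF L.cring_loc_ring]])
    show "?K \<subseteq> carrier (self_module ?Q)"
      using L.loc_ring_simps(5) pR by (auto simp: self_module_simps)
    show "\<zero>\<^bsub>self_module ?Q\<^esub> \<in> ?K"
      unfolding self_module_simps L.loc_ring_simps(1)
      by (rule KI, rule additive_subgroup.zero_closed[OF p.additive_subgroup_axioms], rule L.S_one)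
    show "U \<oplus>\<^bsub>self_module ?Q\<^esub> V \<in> ?K" if "U \<in> ?K" "V \<in> ?K" for U V
    proof -
      from that obtain a s b t where *: "a \<in> \<pp>" "s \<in> ?S" "U = ?fr a s" "b \<in> \<pp>" "t \<in> ?S" "V = ?fr b t"
        by blast
      then have "U \<oplus>\<^bsub>?Q\<^esub> V = ?fr (t \<otimes>\<^bsub>R\<^esub> a \<oplus>\<^bsub>R\<^esub> s \<otimes>\<^bsub>R\<^esub> b) (s \<otimes>\<^bsub>R\<^esub> t)"
        using L.loc_ring_simps(3) pR by simp
      moreover have "t \<otimes>\<^bsub>R\<^esub> a \<oplus>\<^bsub>R\<^esub> s \<otimes>\<^bsub>R\<^esub> b \<in> \<pp>" using * p.I_l_closed by blast
      moreover have "s \<otimes>\<^bsub>R\<^esub> t \<in> ?S" using * L.S_mult by blast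
      ultimately show ?thesis by (auto simp: self_module_simps)
    qed
    show "A \<odot>\<^bsub>self_module ?Q\<^esub> U \<in> ?K" if "A \<in> carrier ?Q" "U \<in> ?K" for A U
    proof -
      from that obtain a s b t where *: "a \<in> carrier R" "s \<in> ?S" "A = ?fr a s" "b \<in> \<pp>" "t \<in> ?S" "U = ?fr b t"
        by (auto elim!: L.loc_ring_elem)
      then have "A \<otimes>\<^bsub>?Q\<^esub> U = ?fr (a \<otimes>\<^bsub>R\<^esub> b) (s \<otimes>\<^bsub>R\<^esub> t)"
        using L.loc_ring_simps(4) pR by simp
      moreover have "a \<otimes>\<^bsub>R\<^esub> b \<in> \<pp>" using * p.I_l_closed by blast
      moreover have "s \<otimes>\<^bsub>R\<^esub> t \<in> ?S" using * L.S_mult by blast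
      ultimately show ?thesis by (auto simp: self_module_simps)
    qed
  qed
  then have "ideal ?K ?Q" by (simp add: submodule_self_module_iff[OF L.cring_loc_ring])
  then have sub: "loc_max_ideal R \<pp> \<subseteq> ?K"
    unfolding loc_max_ideal_def using L.S_one by (intro Q.genideal_minimal) blast+
  show "\<one>\<^bsub>?Q\<^esub> \<notin> loc_max_ideal R \<pp>"
  proof
    assume "\<one>\<^bsub>?Q\<^esub> \<in> loc_max_ideal R \<pp>"
    with sub obtain a s where a: "a \<in> \<pp>" "s \<in> ?S" "?fr \<one>\<^bsub>R\<^esub> \<one>\<^bsub>R\<^esub> = ?fr a s"
      unfolding L.loc_ring_simps(2) by blast
    then obtain u where u: "u \<in> ?S" "u \<otimes>\<^bsub>R\<^esub> s = u \<otimes>\<^bsub>R\<^esub> a"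
      using L.fraction_eqD[of "\<one>\<^bsub>R\<^esub>" a "\<one>\<^bsub>R\<^esub>" s] pR[OF a(1)] L.S_one by (auto simp: self_module_def)
    have "u \<otimes>\<^bsub>R\<^esub> s \<in> ?S" using u a L.S_mult by blast
    moreover have "u \<otimes>\<^bsub>R\<^esub> a \<in> \<pp>" using u a p.I_l_closed by blast
    ultimately show False using u by simp
  qed
  show "\<exists>B\<in>carrier ?Q. B \<otimes>\<^bsub>?Q\<^esub> A = \<one>\<^bsub>?Q\<^esub>" if A: "A \<in> carrier ?Q" "A \<notin> loc_max_ideal R \<pp>"
  proof -
    from A(1) obtain a s where a: "a \<in> carrier R" "s \<in> ?S" "A = ?fr a s" by (rule L.loc_ring_elem)
    have "a \<notin> \<pp>"
    proof
      assume ap: "a \<in> \<pp>"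
      have "?fr a \<one>\<^bsub>R\<^esub> \<in> loc_max_ideal R \<pp>"
        unfolding loc_max_ideal_def using Q.genideal_self[OF gen] ap by blast
      then have "?fr \<one>\<^bsub>R\<^esub> s \<otimes>\<^bsub>?Q\<^esub> ?fr a \<one>\<^bsub>R\<^esub> \<in> loc_max_ideal R \<pp>"
        using ideal.I_l_closed[OF I] L.loc_ring_simps(5) a by simp
      moreover have "?fr \<one>\<^bsub>R\<^esub> s \<otimes>\<^bsub>?Q\<^esub> ?fr a \<one>\<^bsub>R\<^esub> = A"
        using a L.loc_ring_simps(4)[of "\<one>\<^bsub>R\<^esub>" a s "\<one>\<^bsub>R\<^esub>"] L.S_one by simp
      ultimately show False using A(2) by simp
    qed
    then have aS: "a \<in> ?S" using a by simp
    have "?fr s a \<otimes>\<^bsub>?Q\<^esub> A = ?fr (s \<otimes>\<^bsub>R\<^esub> a) (a \<otimes>\<^bsub>R\<^esub> s)"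
      using a aS L.loc_ring_simps(4)[of s a a s] by simp
    also have "\<dots> = ?fr \<one>\<^bsub>R\<^esub> \<one>\<^bsub>R\<^esub>"
      using L.fraction_cancel[of "\<one>\<^bsub>R\<^esub>" "\<one>\<^bsub>R\<^esub>" "s \<otimes>\<^bsub>R\<^esub> a"] a aS L.S_mult[of s a] L.S_one
      by (simp add: self_module_def p.m_comm)
    finally show ?thesis
      using L.loc_ring_simps(5)[of s a] a aS unfolding L.loc_ring_simps(2) by blast
  qed
qed

section \<open>Duality\<close>

lemma hom_module_carrierI: "f \<in> mod_hom R M N \<Longrightarrow> module R M \<Longrightarrow>
    restrict f (carrier M) \<in> carrier (hom_module R M N)"
proof -
  assume f: "f \<in> mod_hom R M N" and "module R M"
  interpret M: module R M by fact
  show ?thesis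
    using mod_homD[OF f] by (auto simp: hom_module_def intro!: mod_homI)
qed

lemma hom_module_carrierD:
  assumes "f \<in> carrier (hom_module R M N)"
  shows "f \<in> mod_hom R M N" "f \<in> extensional (carrier M)"
  using assms by (auto simp: hom_module_def)

lemma module_hom_module:
  assumes "module R M" "module R N"
  shows "module R (hom_module R M N)"
proof -
  interpret M: module R M by fact
  interpret N: module R N by fact
  let ?H = "hom_module R M N"
  have cl: "f x \<in> carrier N" if "f \<in> carrier ?H" "x \<in> carrier M" for f x
    using mod_homD(1)[OF hom_module_carrierD(1)[OF that(1)] that(2)] .
  have ext: "f = g" if "f \<in> carrier ?H" "g \<in> carrier ?H" "\<And>x. x \<in> carrier M \<Longrightarrow> f x = g x" for f g
    using extensionalityI[OF hom_module_carrierD(2)[OF that(1)] hom_module_carrierD(2)[OF that(2)]] that(3) .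
  have v: "(f \<oplus>\<^bsub>?H\<^esub> g) x = f x \<oplus>\<^bsub>N\<^esub> g x" "\<zero>\<^bsub>?H\<^esub> x = \<zero>\<^bsub>N\<^esub>" "(r \<odot>\<^bsub>?H\<^esub> f) x = r \<odot>\<^bsub>N\<^esub> f x"
    if "x \<in> carrier M" for f g r x
    using that by (simp_all add: hom_module_def)
  have add: "f \<oplus>\<^bsub>?H\<^esub> g \<in> carrier ?H" if fg: "f \<in> carrier ?H" "g \<in> carrier ?H" for f g
  proof -
    note f = mod_homD[OF hom_module_carrierD(1)[OF fg(1)]] and g = mod_homD[OF hom_module_carrierD(1)[OF fg(2)]]
    have "(\<lambda>x. f x \<oplus>\<^bsub>N\<^esub> g x) \<in> mod_hom R M N"
      by (rule mod_homI) (simp_all add: f g N.M.a_ac N.smult_r_distr)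
    from hom_module_carrierI[OF this assms(1)] show ?thesis by (simp add: hom_module_def)
  qed
  have smult: "r \<odot>\<^bsub>?H\<^esub> f \<in> carrier ?H" if r: "r \<in> carrier R" and "f \<in> carrier ?H" for r f
  proof -
    note f = mod_homD[OF hom_module_carrierD(1)[OF that(2)]]
    have "(\<lambda>x. r \<odot>\<^bsub>N\<^esub> f x) \<in> mod_hom R M N"
      by (rule mod_homI) (simp_all add: r f N.smult_r_distr M.R.m_comm flip: N.smult_assoc1)
    from hom_module_carrierI[OF this assms(1)] show ?thesis by (simp add: hom_module_def)
  qed
  have "(\<lambda>x. \<zero>\<^bsub>N\<^esub>) \<in> mod_hom R M N" by (rule mod_homI) simp_all
  from hom_module_carrierI[OF this assms(1)] have zero: "\<zero>\<^bsub>?H\<^esub> \<in> carrier ?H"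
    by (simp add: hom_module_def)
  show ?thesis
  proof (rule moduleI[OF M.R.is_cring abelian_groupI])
    show "\<exists>g\<in>carrier ?H. g \<oplus>\<^bsub>?H\<^esub> f = \<zero>\<^bsub>?H\<^esub>" if "f \<in> carrier ?H" for f
    proof (rule bexI)
      show s: "\<ominus>\<^bsub>R\<^esub> \<one>\<^bsub>R\<^esub> \<odot>\<^bsub>?H\<^esub> f \<in> carrier ?H" using that by (intro smult) simp_all
      show "(\<ominus>\<^bsub>R\<^esub> \<one>\<^bsub>R\<^esub> \<odot>\<^bsub>?H\<^esub> f) \<oplus>\<^bsub>?H\<^esub> f = \<zero>\<^bsub>?H\<^esub>"
        by (rule ext[OF add[OF s that] zero]) (simp add: v cl[OF that] N.smult_l_minus N.M.l_neg)
    qed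
    show "f \<oplus>\<^bsub>?H\<^esub> g \<oplus>\<^bsub>?H\<^esub> h = f \<oplus>\<^bsub>?H\<^esub> (g \<oplus>\<^bsub>?H\<^esub> h)"
      if "f \<in> carrier ?H" "g \<in> carrier ?H" "h \<in> carrier ?H" for f g h
      by (rule ext) (use that in \<open>simp_all add: add v cl N.M.a_assoc\<close>)
    show "f \<oplus>\<^bsub>?H\<^esub> g = g \<oplus>\<^bsub>?H\<^esub> f" if "f \<in> carrier ?H" "g \<in> carrier ?H" for f g
      by (rule ext) (use that in \<open>simp_all add: add v cl N.M.a_comm\<close>)
    show "\<zero>\<^bsub>?H\<^esub> \<oplus>\<^bsub>?H\<^esub> f = f" if "f \<in> carrier ?H" for f
      by (rule ext) (use that in \<open>simp_all add: add zero v cl\<close>)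
    show "(a \<oplus>\<^bsub>R\<^esub> b) \<odot>\<^bsub>?H\<^esub> f = a \<odot>\<^bsub>?H\<^esub> f \<oplus>\<^bsub>?H\<^esub> b \<odot>\<^bsub>?H\<^esub> f"
      if "a \<in> carrier R" "b \<in> carrier R" "f \<in> carrier ?H" for a b f
      by (rule ext) (use that in \<open>simp_all add: add smult v cl N.smult_l_distr\<close>)
    show "a \<odot>\<^bsub>?H\<^esub> (f \<oplus>\<^bsub>?H\<^esub> g) = a \<odot>\<^bsub>?H\<^esub> f \<oplus>\<^bsub>?H\<^esub> a \<odot>\<^bsub>?H\<^esub> g"
      if "a \<in> carrier R" "f \<in> carrier ?H" "g \<in> carrier ?H" for a f g
      by (rule ext) (use that in \<open>simp_all add: add smult v cl N.smult_r_distr\<close>)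
    show "(a \<otimes>\<^bsub>R\<^esub> b) \<odot>\<^bsub>?H\<^esub> f = a \<odot>\<^bsub>?H\<^esub> (b \<odot>\<^bsub>?H\<^esub> f)"
      if "a \<in> carrier R" "b \<in> carrier R" "f \<in> carrier ?H" for a b f
      by (rule ext) (use that in \<open>simp_all add: smult v cl N.smult_assoc1\<close>)
    show "\<one>\<^bsub>R\<^esub> \<odot>\<^bsub>?H\<^esub> f = f" if "f \<in> carrier ?H" for f
      by (rule ext) (use that in \<open>simp_all add: smult v cl\<close>)
  qed (fact add zero smult)+
qed

lemma hom_cpx_diff_hom:
  assumes X: "chain_complex R X" and N: "module R N"
  shows "diff (hom_cpx R X N) i \<in> mod_hom R (hom_module R (obj X (- i)) N) (hom_module R (obj X (1 - i)) N)"
proof -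
  interpret N: module R N by fact
  interpret X1: module R "obj X (1 - i)" by (rule chain_complexD(1)[OF X])
  have d: "diff X (1 - i) \<in> mod_hom R (obj X (1 - i)) (obj X (- i))"
    using chain_complexD(4)[OF X, of "- i"] by simp
  (* The sign of the differential is an automorphism of N. *)
  define \<sigma> where "\<sigma> y = (if even i then \<ominus>\<^bsub>N\<^esub> y else y)" for y
  have \<sigma>: "\<sigma> \<in> mod_hom R N N"
    by (rule mod_homI) (auto simp: \<sigma>_def N.M.minus_add N.smult_r_minus)
  have D: "diff (hom_cpx R X N) i f = (\<lambda>x\<in>carrier (obj X (1 - i)). \<sigma> (f (diff X (1 - i) x)))" for f
    by (auto simp: hom_cpx_def \<sigma>_def)
  show ?thesis
  proof (rule mod_homI)
    fix f assume f: "f \<in> carrier (hom_module R (obj X (- i)) N)"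
    note hf = hom_module_carrierD(1)[OF f]
    show "diff (hom_cpx R X N) i f \<in> carrier (hom_module R (obj X (1 - i)) N)"
      unfolding D
      by (rule hom_module_carrierI[OF mod_hom_comp[OF mod_hom_comp[OF d hf] \<sigma>] X1.module_axioms])
    show "diff (hom_cpx R X N) i (r \<odot>\<^bsub>hom_module R (obj X (- i)) N\<^esub> f)
        = r \<odot>\<^bsub>hom_module R (obj X (1 - i)) N\<^esub> diff (hom_cpx R X N) i f" if "r \<in> carrier R" for r
      using that mod_homD(1)[OF d] mod_homD(1)[OF hf]
      by (auto simp: D hom_module_def mod_homD(3)[OF \<sigma>] intro!: restrict_ext)
    fix g assume "g \<in> carrier (hom_module R (obj X (- i)) N)"
    note hg = hom_module_carrierD(1)[OF this]
    show "diff (hom_cpx R X N) i (f \<oplus>\<^bsub>hom_module R (obj X (- i)) N\<^esub> g)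
        = diff (hom_cpx R X N) i f \<oplus>\<^bsub>hom_module R (obj X (1 - i)) N\<^esub> diff (hom_cpx R X N) i g"
      using mod_homD(1)[OF d] mod_homD(1)[OF hf] mod_homD(1)[OF hg]
      by (auto simp: D hom_module_def mod_homD(2)[OF \<sigma>] intro!: restrict_ext)
  qed
qed

text \<open>Up to sign the differential of \<open>Hom(X,N)\<close> is composition with that of \<open>X\<close>, so \<open>f\<close> is a cycle iff it
  kills the image of the incoming differential of \<open>X\<close>. Together with \<open>boundaries_hom_cpx\<close> this says that
  \<open>Hom(-,N)\<close> exchanges the roles of cycles and boundaries.\<close>

lemma cycles_hom_cpx:
  assumes X: "chain_complex R X" and N: "module R N"
  shows "cycles (hom_cpx R X N) i =
    {f \<in> carrier (hom_module R (obj X (- i)) N). \<forall>b\<in>boundaries X (- i). f b = \<zero>\<^bsub>N\<^esub>}"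
proof -
  interpret N: module R N by fact
  have d: "diff X (1 - i) \<in> mod_hom R (obj X (1 - i)) (obj X (- i))"
    using chain_complexD(4)[OF X, of "- i"] by simp
  have "diff (hom_cpx R X N) i f = \<zero>\<^bsub>hom_module R (obj X (1 - i)) N\<^esub>
      \<longleftrightarrow> (\<forall>x\<in>carrier (obj X (1 - i)). f (diff X (1 - i) x) = \<zero>\<^bsub>N\<^esub>)"
    if f: "f \<in> carrier (hom_module R (obj X (- i)) N)" for f
  proof -
    have "f (diff X (1 - i) x) \<in> carrier N" if "x \<in> carrier (obj X (1 - i))" for x
      using mod_homD(1)[OF hom_module_carrierD(1)[OF f]] mod_homD(1)[OF d that] by blast
    moreover have "\<ominus>\<^bsub>N\<^esub> y = \<zero>\<^bsub>N\<^esub> \<longleftrightarrow> y = \<zero>\<^bsub>N\<^esub>" if "y \<in> carrier N" for y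
      using that by (metis N.M.r_neg N.M.l_zero N.M.r_zero N.M.a_inv_closed)
    ultimately show ?thesis
      by (auto simp: hom_cpx_def hom_module_def fun_eq_iff restrict_def)
  qed
  then show ?thesis
    by (auto simp: cycles_def boundaries_def hom_cpx_def)
qed

lemma chain_complex_hom_cpx:
  assumes X: "chain_complex R X" and N: "module R N"
  shows "chain_complex R (hom_cpx R X N)"
  unfolding chain_complex_def
proof (intro allI conjI ballI)
  fix i
  have o: "obj (hom_cpx R X N) i = hom_module R (obj X (- i)) N" for i by (simp add: hom_cpx_def)
  show "module R (obj (hom_cpx R X N) i)"
    unfolding o by (rule module_hom_module[OF chain_complexD(1)[OF X] N])
  show d: "diff (hom_cpx R X N) i \<in> mod_hom R (obj (hom_cpx R X N) i) (obj (hom_cpx R X N) (i - 1))"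
    using hom_cpx_diff_hom[OF X N, of i] by (simp add: o)
  fix f assume f: "f \<in> carrier (obj (hom_cpx R X N) i)"
  note hf = hom_module_carrierD(1)[OF f[unfolded o]]
  interpret N: module R N by fact
  have "diff (hom_cpx R X N) i f b = \<zero>\<^bsub>N\<^esub>" if b: "b \<in> boundaries X (1 - i)" for b
  proof -
    have "b \<in> cycles X (1 - i)" using b boundaries_subset_cycles[OF X] by blast
    then have "b \<in> carrier (obj X (1 - i))" "diff X (1 - i) b = \<zero>\<^bsub>obj X (- i)\<^esub>"
      by (auto simp: cycles_def)
    then show ?thesis
      using mod_hom_zero[OF chain_complexD(1)[OF X] N hf] by (simp add: hom_cpx_def)
  qed
  then have "diff (hom_cpx R X N) i f \<in> cycles (hom_cpx R X N) (i - 1)"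
    using mod_homD(1)[OF d f] by (simp add: cycles_hom_cpx[OF X N] o)
  then show "diff (hom_cpx R X N) (i - 1) (diff (hom_cpx R X N) i f) = \<zero>\<^bsub>obj (hom_cpx R X N) (i - 1 - 1)\<^esub>"
    by (simp add: cycles_def)
qed

text \<open>For injective \<open>N\<close>, a functional that vanishes on the kernel of a differential factors through
  that differential.\<close>

lemma boundaries_hom_cpx:
  assumes X: "chain_complex R X" and N: "injective_module R N"
  shows "boundaries (hom_cpx R X N) i =
    {f \<in> carrier (hom_module R (obj X (- i)) N). \<forall>z\<in>cycles X (- i). f z = \<zero>\<^bsub>N\<^esub>}"
proof -
  have mN: "module R N" using N by (simp add: injective_module_def)
  interpret N: module R N by fact
  note mX = chain_complexD(1)[OF X]
  have d: "diff X (- i) \<in> mod_hom R (obj X (- i)) (obj X (- i - 1))"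
    using chain_complexD(2)[OF X, of "- i"] by simp
  have D: "diff (hom_cpx R X N) (i + 1) g
      = (\<lambda>x\<in>carrier (obj X (- i)). if even (i + 1) then \<ominus>\<^bsub>N\<^esub> g (diff X (- i) x) else g (diff X (- i) x))" for g
    by (simp add: hom_cpx_def cong: if_cong)
  have Dhom: "diff (hom_cpx R X N) (i + 1) g \<in> carrier (hom_module R (obj X (- i)) N)"
    if "g \<in> carrier (hom_module R (obj X (- i - 1)) N)" for g
    using mod_homD(1)[OF hom_cpx_diff_hom[OF X mN, of "i + 1"]] that by simp
  have o: "obj (hom_cpx R X N) (i + 1) = hom_module R (obj X (- i - 1)) N"
    by (simp add: hom_cpx_def)
  show ?thesis
  proof (intro equalityI subsetI CollectI conjI ballI)
    fix f assume "f \<in> boundaries (hom_cpx R X N) i"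
    then obtain g where g: "g \<in> carrier (hom_module R (obj X (- i - 1)) N)" "f = diff (hom_cpx R X N) (i + 1) g"
      by (auto simp: boundaries_def o)
    show "f \<in> carrier (hom_module R (obj X (- i)) N)" using Dhom g by simp
    fix z assume "z \<in> cycles X (- i)"
    then have "z \<in> carrier (obj X (- i))" "diff X (- i) z = \<zero>\<^bsub>obj X (- i - 1)\<^esub>"
      by (auto simp: cycles_def)
    then show "f z = \<zero>\<^bsub>N\<^esub>"
      using mod_hom_zero[OF mX mN hom_module_carrierD(1)[OF g(1)]] by (simp add: g(2) D)
  next
    fix f assume "f \<in> {f \<in> carrier (hom_module R (obj X (- i)) N). \<forall>z\<in>cycles X (- i). f z = \<zero>\<^bsub>N\<^esub>}"
    then have f: "f \<in> carrier (hom_module R (obj X (- i)) N)"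
      and van: "\<And>z. z \<in> carrier (obj X (- i)) \<Longrightarrow> diff X (- i) z = \<zero>\<^bsub>obj X (- i - 1)\<^esub> \<Longrightarrow> f z = \<zero>\<^bsub>N\<^esub>"
      by (auto simp: cycles_def)
    note hf = hom_module_carrierD(1)[OF f]
    obtain h where h: "h \<in> mod_hom R (obj X (- i - 1)) N"
      "\<And>x. x \<in> carrier (obj X (- i)) \<Longrightarrow> h (diff X (- i) x) = f x"
      using injective_module_factor[OF N mX mX d hf van] by blast
    define g where "g = restrict (\<lambda>x. if even (i + 1) then \<ominus>\<^bsub>N\<^esub> h x else h x) (carrier (obj X (- i - 1)))"
    have "(\<lambda>x. if even (i + 1) then \<ominus>\<^bsub>N\<^esub> h x else h x) \<in> mod_hom R (obj X (- i - 1)) N"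
      using mod_homD[OF h(1)] by (intro mod_homI) (auto simp: N.M.minus_add N.smult_r_minus)
    then have gc: "g \<in> carrier (hom_module R (obj X (- i - 1)) N)"
      unfolding g_def by (rule hom_module_carrierI[OF _ mX])
    have "diff (hom_cpx R X N) (i + 1) g = f"
    proof (rule extensionalityI[OF hom_module_carrierD(2)[OF Dhom[OF gc]] hom_module_carrierD(2)[OF f]])
      fix x assume x: "x \<in> carrier (obj X (- i))"
      then show "diff (hom_cpx R X N) (i + 1) g x = f x"
        using mod_homD(1)[OF d x] mod_homD(1)[OF hf x] by (simp add: D g_def h(2))
    qed
    then show "f \<in> boundaries (hom_cpx R X N) i"
      using gc by (auto simp: boundaries_def o)
  qed
qed

text \<open>If exactness of \<open>X\<close> fails at \<open>z\<close>, a functional that kills the boundaries but not \<open>z\<close> is a cycle of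
  \<open>Hom(X,N)\<close> and no boundary.\<close>

lemma hom_cpx_exact_iff:
  assumes X: "chain_complex R X" and N: "injective_module R N"
    and sep: "\<And>z. \<lbrakk>z \<in> carrier (obj X (- i)); z \<notin> boundaries X (- i)\<rbrakk> \<Longrightarrow>
      \<exists>f\<in>mod_hom R (obj X (- i)) N. (\<forall>b\<in>boundaries X (- i). f b = \<zero>\<^bsub>N\<^esub>) \<and> f z \<noteq> \<zero>\<^bsub>N\<^esub>"
  shows "cycles (hom_cpx R X N) i = boundaries (hom_cpx R X N) i \<longleftrightarrow>
    cycles X (- i) = boundaries X (- i)"
proof -
  have mN: "module R N" using N by (simp add: injective_module_def)
  note c = cycles_hom_cpx[OF X mN] and b = boundaries_hom_cpx[OF X N]
  note Zc = module.submoduleE(1)[OF chain_complexD(1)[OF X] cycles_submodule[OF X]]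
  have Bc: "boundaries X (- i) \<subseteq> carrier (obj X (- i))"
    using boundaries_subset_cycles[OF X] Zc by blast
  show ?thesis
  proof
    assume eq: "cycles (hom_cpx R X N) i = boundaries (hom_cpx R X N) i"
    have "z \<in> boundaries X (- i)" if z: "z \<in> cycles X (- i)" for z
    proof (rule ccontr)
      assume nz: "z \<notin> boundaries X (- i)"
      have zc: "z \<in> carrier (obj X (- i))" using z Zc by blast
      obtain f where f: "f \<in> mod_hom R (obj X (- i)) N" "\<And>b. b \<in> boundaries X (- i) \<Longrightarrow> f b = \<zero>\<^bsub>N\<^esub>"
        "f z \<noteq> \<zero>\<^bsub>N\<^esub>"
        using sep[OF zc nz] by blast
      have "restrict f (carrier (obj X (- i))) \<in> cycles (hom_cpx R X N) i"
        using hom_module_carrierI[OF f(1) chain_complexD(1)[OF X]] f(2) Bc by (auto simp: c)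
      then show False using f(3) z zc unfolding eq by (auto simp: b)
    qed
    then show "cycles X (- i) = boundaries X (- i)" using boundaries_subset_cycles[OF X] by blast
  qed (simp add: b c)
qed

section \<open>The big cosupport\<close>

text \<open>If \<open>z\<close> is not in \<open>B\<close>, no scalar that brings \<open>z\<close> into \<open>B\<close> is a unit; over the local ring \<open>R\<^sub>\<pp>\<close> all
  these scalars therefore lie in the maximal ideal.\<close>

lemma envelope_at_prime_separates:
  assumes p: "primeideal \<pp> R"
    and F: "injective_envelope (localization_at R \<pp>) (residue_field R \<pp>) F"
    and X: "module (localization_at R \<pp>) X" and B: "submodule B (localization_at R \<pp>) X"
    and z: "z \<in> carrier X" "z \<notin> B"
  shows "\<exists>f\<in>mod_hom (localization_at R \<pp>) X F. (\<forall>b\<in>B. f b = \<zero>\<^bsub>F\<^esub>) \<and> f z \<noteq> \<zero>\<^bsub>F\<^esub>"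
proof -
  let ?Q = "localization_at R \<pp>"
  interpret X: module ?Q X by fact
  note I = ideal_loc_max_ideal[OF p]
  have F': "injective_envelope ?Q (quot_module (self_module ?Q) (loc_max_ideal R \<pp>)) F"
    using F by (simp add: residue_field_def loc_max_ideal_def)
  then interpret F: module ?Q F by (simp add: injective_envelope_def injective_module_def)
  have ann: "r \<in> loc_max_ideal R \<pp>" if r: "r \<in> carrier ?Q" "r \<odot>\<^bsub>X\<^esub> z \<in> B" for r
  proof (rule ccontr)
    assume "r \<notin> loc_max_ideal R \<pp>"
    then obtain s where s: "s \<in> carrier ?Q" "s \<otimes>\<^bsub>?Q\<^esub> r = \<one>\<^bsub>?Q\<^esub>"
      using unit_outside_loc_max_ideal[OF p r(1)] by blast
    then have "z = s \<odot>\<^bsub>X\<^esub> (r \<odot>\<^bsub>X\<^esub> z)" using r(1) z(1) by (simp flip: X.smult_assoc1)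
    also have "\<dots> \<in> B" using s(1) r(2) by (rule submodule.smult_closed[OF B])
    finally show False using z(2) by simp
  qed
  obtain f where f: "f \<in> mod_hom ?Q X F" "\<And>b. b \<in> B \<Longrightarrow> f b = \<zero>\<^bsub>F\<^esub>"
    "\<And>r. r \<in> carrier ?Q \<Longrightarrow> r \<odot>\<^bsub>F\<^esub> f z = \<zero>\<^bsub>F\<^esub> \<Longrightarrow> r \<in> loc_max_ideal R \<pp>"
    using injective_envelope_separates[OF X.R.is_cring I F' X B z(1) ann] by blast
  have "f z \<noteq> \<zero>\<^bsub>F\<^esub>"
  proof
    assume "f z = \<zero>\<^bsub>F\<^esub>"
    then show False using f(3)[of "\<one>\<^bsub>?Q\<^esub>"] one_notin_loc_max_ideal[OF p] by simp
  qed
  with f(1,2) show ?thesis by blast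
qed

lemma exists_maximal_ideal:
  assumes "noetherian_ring R" "cring R" and I: "ideal I R" "\<one>\<^bsub>R\<^esub> \<notin> I"
  shows "\<exists>\<mm>. maximalideal \<mm> R \<and> I \<subseteq> \<mm>"
proof -
  interpret R: cring R by fact
  let ?P = "{J. ideal J R \<and> I \<subseteq> J \<and> \<one>\<^bsub>R\<^esub> \<notin> J}"
  have "\<exists>J\<in>?P. \<forall>K\<in>?P. J \<subseteq> K \<longrightarrow> K = J"
  proof (rule subset_Zorn_nonempty)
    show "?P \<noteq> {}" using I by blast
    show "\<Union>\<C> \<in> ?P" if C: "\<C> \<noteq> {}" "subset.chain ?P \<C>" for \<C>
    proof -
      have "subset.chain {J. ideal J R} \<C>" using C(2) unfolding subset.chain_def by blast
      then have "\<Union>\<C> \<in> \<C>" using noetherian_ring.ideal_chain_is_trivial[OF assms(1) C(1)] by blast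
      then show ?thesis using C(2) unfolding subset.chain_def by blast
    qed
  qed
  then obtain J where J: "ideal J R" "I \<subseteq> J" "\<one>\<^bsub>R\<^esub> \<notin> J"
    and max: "\<And>K. \<lbrakk>ideal K R; I \<subseteq> K; \<one>\<^bsub>R\<^esub> \<notin> K; J \<subseteq> K\<rbrakk> \<Longrightarrow> K = J"
    by fastforce
  have "maximalideal J R"
  proof (rule maximalidealI[OF J(1)])
    show "carrier R \<noteq> J" using J(3) by blast
    show "K = J \<or> K = carrier R" if K: "ideal K R" "J \<subseteq> K" "K \<subseteq> carrier R" for K
      using max[OF K(1) _ _ K(2)] J(2) K(2) ideal.one_imp_carrier[OF K(1)] by blast
  qed
  then show ?thesis using J(2) by blast
qed

text \<open>For a functional \<open>f\<close> into \<open>J\<close>: the class \<open>f/1\<close> of its restriction to \<open>Z\<close> is non-zero in \<open>Hom(Z,J)\<^sub>\<pp>\<close>.\<close>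

definition survives :: "('r,'s) ring_scheme \<Rightarrow> ('r,'n,'x) module_scheme \<Rightarrow> 'r set \<Rightarrow> ('m \<Rightarrow> 'n) \<Rightarrow> 'm set \<Rightarrow> bool"
  where "survives R J \<pp> f Z \<longleftrightarrow> (\<forall>u\<in>carrier R - \<pp>. \<exists>z\<in>Z. u \<odot>\<^bsub>J\<^esub> f z \<noteq> \<zero>\<^bsub>J\<^esub>)"

locale colocalization_setting =
  fixes R :: "('r,'s) ring_scheme"
    and E :: "'r set \<Rightarrow> ('r,'e) module"
    and F :: "'r set \<Rightarrow> (('r \<times> 'r) set,'f) module"
  assumes cring: "cring R" and noetherian: "noetherian_ring R"
    and envE: "envelopes_at_maximal R E" and envF: "envelopes_of_residue_fields R F"
begin

definition J :: "('r, 'r set \<Rightarrow> 'e) module"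
  where "J = direct_sum (MaxSpec R) E"

lemma injective_E: "\<mm> \<in> MaxSpec R \<Longrightarrow> injective_module R (E \<mm>)"
  using envE by (simp add: envelopes_at_maximal_def injective_envelope_def)

lemma injective_J: "injective_module R J"
  unfolding J_def by (rule injective_direct_sum[OF cring noetherian injective_E])

lemma module_J: "module R J"
  using injective_J by (simp add: injective_module_def)

text \<open>A maximal ideal \<open>\<mm>\<close> that contains the annihilator of the class of \<open>z\<close> modulo \<open>B\<close> selects the summand \<open>E(R/\<mm>)\<close>
  of \<open>J\<close>, which already separates \<open>z\<close> from \<open>B\<close>.\<close>

lemma J_separates:
  fixes X :: "('r,'m,'x) module_scheme"
  assumes X: "module R X" and B: "submodule B R X" and z: "z \<in> carrier X" "z \<notin> B"
  shows "\<exists>\<mm>\<in>MaxSpec R. \<exists>f\<in>mod_hom R X J. (\<forall>b\<in>B. f b = \<zero>\<^bsub>J\<^esub>) \<and>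
    (\<forall>r\<in>carrier R. r \<odot>\<^bsub>J\<^esub> f z = \<zero>\<^bsub>J\<^esub> \<longrightarrow> r \<in> \<mm>)"
proof -
  interpret X: module R X by fact
  let ?I = "{r \<in> carrier R. r \<odot>\<^bsub>X\<^esub> z \<in> B}"
  have "submodule ?I R (self_module R)"
    using X.submoduleE[OF B] z(1) submodule.smult_closed[OF B]
      subgroup.one_closed[OF submodule.axioms(1)[OF B]]
    by (intro submoduleI_smult[OF self_module_module[OF cring]])
      (auto simp: self_module_simps X.smult_l_distr X.smult_assoc1)
  then have I: "ideal ?I R" by (simp add: submodule_self_module_iff[OF cring])
  have "\<one>\<^bsub>R\<^esub> \<notin> ?I" using z by simp
  then obtain \<mm> where m: "maximalideal \<mm> R" "?I \<subseteq> \<mm>"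
    using exists_maximal_ideal[OF noetherian cring I] by blast
  then have mm: "\<mm> \<in> MaxSpec R" by (simp add: MaxSpec_def)
  then have env: "injective_envelope R (quot_module (self_module R) \<mm>) (E \<mm>)"
    using envE by (simp add: envelopes_at_maximal_def)
  have im: "ideal \<mm> R" using m(1) by (rule maximalideal.axioms(1))
  obtain f where f: "f \<in> mod_hom R X (E \<mm>)" "\<And>b. b \<in> B \<Longrightarrow> f b = \<zero>\<^bsub>E \<mm>\<^esub>"
    "\<And>r. r \<in> carrier R \<Longrightarrow> r \<odot>\<^bsub>E \<mm>\<^esub> f z = \<zero>\<^bsub>E \<mm>\<^esub> \<Longrightarrow> r \<in> \<mm>"
    using injective_envelope_separates[OF cring im env X B z(1)] m(2) by blast
  have mod: "module R (E \<nn>)" if "\<nn> \<in> MaxSpec R" for \<nn>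
    using injective_E[OF that] by (simp add: injective_module_def)
  let ?inc = "\<lambda>e. \<lambda>\<nn>\<in>MaxSpec R. if \<nn> = \<mm> then e else \<zero>\<^bsub>E \<nn>\<^esub>"
  have inc: "?inc \<in> mod_hom R (E \<mm>) J"
    unfolding J_def by (rule direct_sum_inclusion[OF mod mm])
  have hom: "(\<lambda>x. ?inc (f x)) \<in> mod_hom R X J" by (rule mod_hom_comp[OF f(1) inc])
  have kill: "?inc (f b) = \<zero>\<^bsub>J\<^esub>" if "b \<in> B" for b
    unfolding f(2)[OF that] by (rule mod_hom_zero[OF mod[OF mm] module_J inc])
  have ann: "r \<in> \<mm>" if r: "r \<in> carrier R" "r \<odot>\<^bsub>J\<^esub> ?inc (f z) = \<zero>\<^bsub>J\<^esub>" for r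
  proof -
    have "(r \<odot>\<^bsub>J\<^esub> ?inc (f z)) \<mm> = \<zero>\<^bsub>E \<mm>\<^esub>" unfolding r(2) using mm by (simp add: J_def direct_sum_def)
    then show ?thesis using f(3)[OF r(1)] mm by (simp add: J_def direct_sum_def)
  qed
  show ?thesis
  proof (rule bexI[OF _ mm], rule bexI[OF _ hom], intro conjI ballI impI)
    show "?inc (f b) = \<zero>\<^bsub>J\<^esub>" if "b \<in> B" for b using that by (rule kill)
    show "r \<in> \<mm>" if "r \<in> carrier R" "r \<odot>\<^bsub>J\<^esub> ?inc (f z) = \<zero>\<^bsub>J\<^esub>" for r using that by (rule ann)
  qed
qed

text \<open>The description of the big cosupport on which everything rests. As \<open>E(k(\<pp>))\<close> detects exactness,
  co-localization at \<open>\<pp>\<close> vanishes iff \<open>D(M)\<^sub>\<pp>\<close> is exact, that is, iff every cycle of \<open>D(M)\<close> becomes a boundary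
  after multiplication by some \<open>u\<close> outside \<open>\<pp>\<close>. The cycles are the functionals into \<open>J\<close> that kill the boundaries of \<open>M\<close>,
  and the boundaries are those that kill the cycles of \<open>M\<close>.\<close>

lemma coSupp_iff:
  fixes M :: "('r,'m) cpx"
  assumes M: "chain_complex R M"
  shows "\<pp> \<in> coSupp R E F M \<longleftrightarrow> \<pp> \<in> Spec R \<and>
    (\<exists>i. \<exists>f\<in>mod_hom R (obj M i) J. (\<forall>b\<in>boundaries M i. f b = \<zero>\<^bsub>J\<^esub>) \<and> survives R J \<pp> f (cycles M i))"
proof (cases "\<pp> \<in> Spec R")
  case True
  then have p: "primeideal \<pp> R" by (simp add: Spec_def)
  let ?S = "carrier R - \<pp>" and ?Q = "localization_at R \<pp>" and ?D = "dual R E M"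
  have D: "?D = hom_cpx R M J" by (simp add: dual_def J_def)
  interpret J: module R J by (rule module_J)
  have cD: "chain_complex R ?D" unfolding D by (rule chain_complex_hom_cpx[OF M module_J])
  note loc = localizable_at_prime[OF p chain_complexD(1)[OF cD]]
  have cL: "chain_complex ?Q (loc_cpx R ?S ?D)" by (rule chain_complex_loc_cpx[OF cD loc])
  have envp: "injective_envelope ?Q (residue_field R \<pp>) (F \<pp>)"
    using envF True by (simp add: envelopes_of_residue_fields_def)
  then have injF: "injective_module ?Q (F \<pp>)" by (simp add: injective_envelope_def)
  then have mF: "module ?Q (F \<pp>)" by (simp add: injective_module_def)
  have C: "co_localization R E F \<pp> M = hom_cpx ?Q (loc_cpx R ?S ?D) (F \<pp>)"
    by (simp add: co_localization_def)
  have o: "obj ?D (- i) = hom_module R (obj M i) J" for i by (simp add: D hom_cpx_def)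
  have "cycles (co_localization R E F \<pp> M) i = boundaries (co_localization R E F \<pp> M) i
      \<longleftrightarrow> (\<forall>f\<in>mod_hom R (obj M i) J. (\<forall>b\<in>boundaries M i. f b = \<zero>\<^bsub>J\<^esub>) \<longrightarrow> \<not> survives R J \<pp> f (cycles M i))"
    (is "?L \<longleftrightarrow> ?R") for i
  proof -
    note Zc = module.submoduleE(1)[OF chain_complexD(1)[OF M] cycles_submodule[OF M]]
    have Bc: "boundaries M i \<subseteq> carrier (obj M i)"
      using boundaries_subset_cycles[OF M] Zc by blast
    have "?L \<longleftrightarrow> cycles (loc_cpx R ?S ?D) (- i) = boundaries (loc_cpx R ?S ?D) (- i)"
      unfolding C
      by (rule hom_cpx_exact_iff[OF cL injF])
        (rule envelope_at_prime_separates[OF p envp chain_complexD(1)[OF cL] boundaries_submodule[OF cL]])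
    also have "\<dots> \<longleftrightarrow> (\<forall>f\<in>cycles ?D (- i). \<exists>u\<in>?S. u \<odot>\<^bsub>obj ?D (- i)\<^esub> f \<in> boundaries ?D (- i))"
      by (rule loc_cpx_exact_iff[OF cD loc])
    also have "\<dots> \<longleftrightarrow> (\<forall>f\<in>cycles ?D (- i). \<not> survives R J \<pp> f (cycles M i))"
    proof (rule ball_cong[OF refl])
      fix f assume "f \<in> cycles ?D (- i)"
      then have f: "f \<in> carrier (hom_module R (obj M i) J)"
        by (simp add: D cycles_hom_cpx[OF M module_J])
      have "u \<odot>\<^bsub>obj ?D (- i)\<^esub> f \<in> boundaries ?D (- i) \<longleftrightarrow> (\<forall>z\<in>cycles M i. u \<odot>\<^bsub>J\<^esub> f z = \<zero>\<^bsub>J\<^esub>)"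
        if u: "u \<in> ?S" for u
      proof -
        have "u \<odot>\<^bsub>hom_module R (obj M i) J\<^esub> f \<in> carrier (hom_module R (obj M i) J)"
          using module.smult_closed[OF module_hom_module[OF chain_complexD(1)[OF M] module_J] _ f] u by simp
        then show ?thesis
          unfolding o unfolding D boundaries_hom_cpx[OF M injective_J]
          using Zc[of i] by (auto simp: hom_module_def)
      qed
      then show "(\<exists>u\<in>?S. u \<odot>\<^bsub>obj ?D (- i)\<^esub> f \<in> boundaries ?D (- i)) \<longleftrightarrow> \<not> survives R J \<pp> f (cycles M i)"
        unfolding survives_def by blast
    qed
    also have "\<dots> \<longleftrightarrow> ?R"
    proof (intro iffI ballI impI)
      fix f assume *: "\<forall>f\<in>cycles ?D (- i). \<not> survives R J \<pp> f (cycles M i)"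
        and f: "f \<in> mod_hom R (obj M i) J" "\<forall>b\<in>boundaries M i. f b = \<zero>\<^bsub>J\<^esub>"
      have "restrict f (carrier (obj M i)) \<in> cycles ?D (- i)"
        using hom_module_carrierI[OF f(1) chain_complexD(1)[OF M]] f(2) Bc
        by (auto simp: D cycles_hom_cpx[OF M module_J])
      moreover have "survives R J \<pp> (restrict f (carrier (obj M i))) (cycles M i) \<longleftrightarrow> survives R J \<pp> f (cycles M i)"
        using Zc unfolding survives_def by (intro ball_cong bex_cong) auto
      ultimately show "\<not> survives R J \<pp> f (cycles M i)" using * by blast
    next
      fix f assume ?R and "f \<in> cycles ?D (- i)"
      moreover from this(2) have f: "f \<in> carrier (hom_module R (obj M i) J)"
        "\<forall>b\<in>boundaries M i. f b = \<zero>\<^bsub>J\<^esub>"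
        by (simp_all add: D cycles_hom_cpx[OF M module_J])
      ultimately show "\<not> survives R J \<pp> f (cycles M i)"
        using hom_module_carrierD(1)[OF f(1)] by blast
    qed
    finally show ?thesis .
  qed
  moreover have "chain_complex ?Q (co_localization R E F \<pp> M)"
    unfolding C by (rule chain_complex_hom_cpx[OF cL mF])
  ultimately show ?thesis
    using True by (auto simp: coSupp_def derived_iso_zero_iff)
qed (simp add: coSupp_def)

end

lemma
  fixes N :: "('r,'n) module"
  assumes "cring R" and N: "module R N"
  shows chain_complex_in_degree_0: "chain_complex R (in_degree_0 N)"
    and cycles_in_degree_0: "cycles (in_degree_0 N) 0 = carrier N"
    and boundaries_in_degree_0: "boundaries (in_degree_0 N) 0 = {\<zero>\<^bsub>N\<^esub>}"
proof -
  interpret N: module R N by fact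
  have z: "module R (zero_module :: ('r,'n) module)"
    by (rule chain_complexD(1)[OF chain_complex_zero_cpx[OF assms(1)], unfolded zero_cpx_def cpx.simps])
  show "chain_complex R (in_degree_0 N)"
    using N z by (auto simp: chain_complex_def in_degree_0_def zero_module_def intro!: mod_homI)
  show "cycles (in_degree_0 N) 0 = carrier N" "boundaries (in_degree_0 N) 0 = {\<zero>\<^bsub>N\<^esub>}"
    by (auto simp: cycles_def boundaries_def in_degree_0_def zero_module_def)
qed

context colocalization_setting
begin

text \<open>Outside degree \<open>0\<close> all functionals vanish, and in degree \<open>0\<close> every element of \<open>N\<close> is a cycle.\<close>

lemma coSupp_module_iff:
  fixes N :: "('r,'n) module"
  assumes N: "module R N"
  shows "\<pp> \<in> coSupp R E F (in_degree_0 N) \<longleftrightarrow>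
    \<pp> \<in> Spec R \<and> (\<exists>f\<in>mod_hom R N J. survives R J \<pp> f (carrier N))"
proof -
  interpret J: module R J by (rule module_J)
  let ?C = "in_degree_0 N :: ('r,'n) cpx"
  note C = chain_complex_in_degree_0[OF cring N]
  have off: "\<not> survives R J \<pp> f (cycles ?C i)"
    if "i \<noteq> 0" "f \<in> mod_hom R (obj ?C i) J" "\<pp> \<in> Spec R" for f i
  proof
    assume "survives R J \<pp> f (cycles ?C i)"
    moreover have "\<one>\<^bsub>R\<^esub> \<in> carrier R - \<pp>"
      using that(3) primeideal.I_notcarr ideal.one_imp_carrier primeideal.axioms(1)
      by (fastforce simp: Spec_def)
    ultimately obtain z where "z \<in> carrier (obj ?C i)" "\<one>\<^bsub>R\<^esub> \<odot>\<^bsub>J\<^esub> f z \<noteq> \<zero>\<^bsub>J\<^esub>"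
      by (auto simp: survives_def cycles_def)
    moreover from this have "z = \<zero>\<^bsub>obj ?C i\<^esub>"
      using that(1) by (simp add: in_degree_0_def zero_module_def)
    ultimately show False
      using mod_hom_zero[OF chain_complexD(1)[OF C] module_J that(2)] by simp
  qed
  let ?P = "\<lambda>i. \<exists>f\<in>mod_hom R (obj ?C i) J. (\<forall>b\<in>boundaries ?C i. f b = \<zero>\<^bsub>J\<^esub>) \<and> survives R J \<pp> f (cycles ?C i)"
  have "?P 0 \<longleftrightarrow> (\<exists>f\<in>mod_hom R N J. survives R J \<pp> f (carrier N))"
  proof -
    have "obj ?C 0 = N" by (simp add: in_degree_0_def)
    then show ?thesis
      using mod_hom_zero[OF N module_J]
      by (auto simp: cycles_in_degree_0[OF cring N] boundaries_in_degree_0[OF cring N])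
  qed
  moreover have "(\<exists>i. ?P i) \<longleftrightarrow> ?P 0" if "\<pp> \<in> Spec R"
  proof
    assume "\<exists>i. ?P i"
    then obtain i where i: "?P i" ..
    then have "i = 0" using off that by blast
    with i show "?P 0" by simp
  qed blast
  ultimately show ?thesis
    unfolding coSupp_iff[OF C] by (cases "\<pp> \<in> Spec R") simp_all
qed

text \<open>A functional on \<open>M\<^sub>i\<close> that kills the boundaries induces one on \<open>H\<^sub>i(M)\<close>. Conversely a functional on
  \<open>H\<^sub>i(M)\<close>, pulled back to the cycles, extends to \<open>M\<^sub>i\<close> because \<open>J\<close> is injective. Survival depends only on
  the values on cycles, which the two functionals share.\<close>

lemma survives_homology_iff:
  fixes M :: "('r,'m) cpx"
  assumes M: "chain_complex R M"
  shows "(\<exists>g\<in>mod_hom R (homology M i) J. survives R J \<pp> g (carrier (homology M i))) \<longleftrightarrow>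
    (\<exists>f\<in>mod_hom R (obj M i) J. (\<forall>b\<in>boundaries M i. f b = \<zero>\<^bsub>J\<^esub>) \<and> survives R J \<pp> f (cycles M i))"
    (is "?L \<longleftrightarrow> ?R")
  and module_homology: "module R (homology M i)"
proof -
  let ?Mi = "obj M i"
  let ?Z = "?Mi\<lparr>carrier := cycles M i\<rparr>" and ?B = "boundaries M i"
  note mM = chain_complexD(1)[OF M, of i] and sZ = cycles_submodule[OF M, of i]
  interpret Mi: module R ?Mi by (rule mM)
  have mZ: "module R ?Z" by (rule module_restrict_carrier[OF mM sZ])
  note Zc = Mi.submoduleE(1)[OF sZ] and BZ = boundaries_subset_cycles[OF M, of i]
  note sB = boundaries_submodule[OF M, of i]
  have sBZ: "submodule ?B R ?Z"
    using Mi.submoduleE(4,5)[OF sB] subgroup.one_closed[OF submodule.axioms(1)[OF sB]] BZ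
    by (intro submoduleI_smult[OF mZ]) auto
  have H: "homology M i = quot_module ?Z ?B" by (simp add: homology_def)
  show mH: "module R (homology M i)" unfolding H by (rule module_quot_module[OF mZ sBZ])
  let ?\<pi> = "\<lambda>x. ?B +>\<^bsub>?Z\<^esub> x"
  have \<pi>: "?\<pi> \<in> mod_hom R ?Z (homology M i)" unfolding H by (rule quot_projection_hom[OF mZ sBZ])
  have \<pi>0: "?\<pi> x = \<zero>\<^bsub>homology M i\<^esub> \<longleftrightarrow> x \<in> ?B" if "x \<in> cycles M i" for x
    unfolding H using quot_projection_zero_iff[OF mZ sBZ] that by simp
  have car: "carrier (homology M i) = ?\<pi> ` cycles M i" unfolding H carrier_quot_module by simp
  have inc: "(\<lambda>x. x) \<in> mod_hom R ?Z ?Mi" using Zc by (intro mod_homI) auto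
  show "?L \<longleftrightarrow> ?R"
  proof
    assume ?L
    then obtain g where g: "g \<in> mod_hom R (homology M i) J" "survives R J \<pp> g (carrier (homology M i))"
      by blast
    note g\<pi> = mod_hom_comp[OF \<pi> g(1)]
    obtain f where f: "f \<in> mod_hom R ?Mi J" "\<And>z. z \<in> cycles M i \<Longrightarrow> f z = g (?\<pi> z)"
      using injective_module_extend[OF injective_J mZ mM inc _ g\<pi>] by auto
    have "f b = \<zero>\<^bsub>J\<^esub>" if b: "b \<in> ?B" for b
    proof -
      have bZ: "b \<in> cycles M i" using b BZ by blast
      then have "?\<pi> b = \<zero>\<^bsub>homology M i\<^esub>" using \<pi>0 b by blast
      then show ?thesis using f(2)[OF bZ] mod_hom_zero[OF mH module_J g(1)] by simp
    qed
    moreover have "survives R J \<pp> f (cycles M i)"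
      using g(2) f(2) by (auto simp: survives_def car)
    ultimately show ?R using f(1) by blast
  next
    assume ?R
    then obtain f where f: "f \<in> mod_hom R ?Mi J" "\<And>b. b \<in> ?B \<Longrightarrow> f b = \<zero>\<^bsub>J\<^esub>"
      "survives R J \<pp> f (cycles M i)"
      by blast
    have "\<exists>g\<in>mod_hom R (homology M i) J. \<forall>z\<in>carrier ?Z. g (?\<pi> z) = f z"
    proof (rule injective_module_factor[OF injective_J mZ mH \<pi> mod_hom_comp[OF inc f(1)]])
      fix z assume "z \<in> carrier ?Z" "?\<pi> z = \<zero>\<^bsub>homology M i\<^esub>"
      then show "f z = \<zero>\<^bsub>J\<^esub>" using \<pi>0 f(2) by simp
    qed
    then obtain g where g: "g \<in> mod_hom R (homology M i) J" "\<And>z. z \<in> cycles M i \<Longrightarrow> g (?\<pi> z) = f z"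
      by auto
    have "survives R J \<pp> g (carrier (homology M i))"
      using f(3) g(2) by (auto simp: survives_def car)
    then show ?L using g(1) by blast
  qed
qed

lemma coSupp_eq_Union_homology:
  fixes M :: "('r,'m) cpx"
  assumes M: "chain_complex R M"
  shows "coSupp R E F M = (\<Union>i. coSupp R E F (in_degree_0 (homology M i)))"
proof (rule Set.set_eqI)
  fix \<pp>
  show "\<pp> \<in> coSupp R E F M \<longleftrightarrow> \<pp> \<in> (\<Union>i. coSupp R E F (in_degree_0 (homology M i)))"
    by (simp add: coSupp_iff[OF M] coSupp_module_iff[OF module_homology[OF M]] survives_homology_iff[OF M])
qed

text \<open>A cycle \<open>z\<close> that is no boundary yields a maximal ideal \<open>\<mm>\<close> and a functional \<open>f\<close> that kills the boundaries
  and for which no element outside \<open>\<mm>\<close> kills \<open>f z\<close>, so \<open>\<mm>\<close> itself lies in the cosupport.\<close>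

lemma coSupp_empty_iff:
  fixes M :: "('r,'m) cpx"
  assumes M: "chain_complex R M"
  shows "coSupp R E F M = {} \<longleftrightarrow> (\<forall>i. cycles M i = boundaries M i)"
proof
  assume empty: "coSupp R E F M = {}"
  show "\<forall>i. cycles M i = boundaries M i"
  proof (rule allI, rule ccontr)
    fix i assume "cycles M i \<noteq> boundaries M i"
    then obtain z where z: "z \<in> cycles M i" "z \<notin> boundaries M i"
      using boundaries_subset_cycles[OF M] by blast
    then have zc: "z \<in> carrier (obj M i)" by (simp add: cycles_def)
    obtain \<mm> f where f: "\<mm> \<in> MaxSpec R" "f \<in> mod_hom R (obj M i) J" "\<forall>b\<in>boundaries M i. f b = \<zero>\<^bsub>J\<^esub>"
      "\<And>r. r \<in> carrier R \<Longrightarrow> r \<odot>\<^bsub>J\<^esub> f z = \<zero>\<^bsub>J\<^esub> \<Longrightarrow> r \<in> \<mm>"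
      using J_separates[OF chain_complexD(1)[OF M] boundaries_submodule[OF M] zc z(2)] by blast
    have "survives R J \<mm> f (cycles M i)"
      using f(4) z(1) unfolding survives_def by blast
    moreover have "\<mm> \<in> Spec R"
      using f(1) cring.maximalideal_prime[OF cring] by (simp add: MaxSpec_def Spec_def)
    ultimately have "\<mm> \<in> coSupp R E F M" using f(2,3) coSupp_iff[OF M] by blast
    with empty show False by simp
  qed
next
  assume exact: "\<forall>i. cycles M i = boundaries M i"
  interpret J: module R J by (rule module_J)
  have "\<not> survives R J \<pp> f (cycles M i)" if "\<pp> \<in> Spec R" "\<forall>b\<in>boundaries M i. f b = \<zero>\<^bsub>J\<^esub>" for \<pp> f i
  proof
    assume "survives R J \<pp> f (cycles M i)"
    moreover have "\<one>\<^bsub>R\<^esub> \<in> carrier R - \<pp>"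
      using that(1) primeideal.I_notcarr ideal.one_imp_carrier primeideal.axioms(1)
      by (fastforce simp: Spec_def)
    ultimately obtain z where "z \<in> cycles M i" "\<one>\<^bsub>R\<^esub> \<odot>\<^bsub>J\<^esub> f z \<noteq> \<zero>\<^bsub>J\<^esub>"
      unfolding survives_def by blast
    then show False using that(2) exact by auto
  qed
  then show "coSupp R E F M = {}" using coSupp_iff[OF M] by blast
qed

end

theorem theoremA:
  fixes R :: "('r,'s) ring_scheme"
    and E :: "'r set \<Rightarrow> ('r,'e) module"
    and F :: "'r set \<Rightarrow> (('r \<times> 'r) set,'f) module"
    and M :: "('r,'m) cpx"
  assumes "cring R" and "noetherian_ring R"
    and "envelopes_at_maximal R E" and "envelopes_of_residue_fields R F"
    and "chain_complex R M"
  shows "coSupp R E F M = (\<Union>i::int. coSupp R E F (in_degree_0 (homology M i))) \<and>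
    (\<not> derived_iso R M zero_cpx \<longleftrightarrow> coSupp R E F M \<noteq> {})"
proof -
  interpret colocalization_setting R E F
    by (rule colocalization_setting.intro) (rule assms(1-4))+
  show ?thesis
    using coSupp_eq_Union_homology[OF assms(5)] coSupp_empty_iff[OF assms(5)]
      derived_iso_zero_iff[OF assms(5)] by blast
qed

end
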